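(* Let $T$ be either the theory of C$^*$-probability spaces or the theory of tracial von Neumann algebras. For a model $M$ of $T$, with distinguished state (respectively, trace) $\varphi$, let $$X(M)=\{(x,y)\in (M_1)^2 : x \text{ and } y \text{ are freely independent with respect to } \varphi\}.$$ Then the $T$-functor $X$ is not a $T$-definable set. That is, pairs of freely independent elements do not form a definable set, either relative to the theory of C$^*$-probability spaces or relative to the theory of tracial von Neumann algebras.
   Context: **Models.** A C$^*$-probability space is a pair $(M,\varphi)$ with $M$ a unital C$^*$-algebra and $\varphi$ a state on $M$. A tracial von Neumann algebra is a pair $(M,\varphi)$ with $M$ a von Neumann algebra and $\varphi=\tau$ a faithful normal tracial state. $\mathrm{Mod}(T)$ denotes the category of all models of $T$, that is, all C$^*$-probability spaces or all tracial von Neumann algebras respectively, with elementary maps as morphisms. $M_1$ is the closed operator-norm unit ball of $M$. Write $d(x,y)=\|x-y\|$ (operator norm) in the C$^*$ case and $d(x,y)=\|x-y\|_2=\tau((x-y)^*(x-y))^{1/2}$ in the tracial von Neumann case. **Formulas.** $T$-formulas are the usual formulas of continuous logic. The sorts are the closed operator-norm balls of $M$ of radius $k\in\mathbb{N}$. Atomic formulas are the real and imaginary parts of $\varphi(p(\overline{x}))$, together with $\|p(\overline{x})\|$ in the C$^*$ case and $\|p(\overline{x})\|_2$ in the tracial von Neumann case, where $p$ is a $*$-polynomial in noncommuting variables with complex coefficients. Formulas are closed under composition with continuous functions $\mathbb{R}^m\to\mathbb{R}$ and under the quantifiers $\sup$ and $\inf$ over a variable ranging over a sort. For a formula $\phi(\overline{x})$,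 $\phi^M$ denotes its interpretation in $M$ and $Z(\phi^M)$ denotes its zero-set in $M$. An elementary map $\rho:M\to N$ is one that preserves the values of all formulas. **$T$-functors.** A $T$-functor is a functor $X:\mathrm{Mod}(T)\to\mathrm{Met}$, where $\mathrm{Met}$ is the category of metric spaces with isometric embeddings as morphisms, such that for some $n\ge 1$, $X(M)$ is a closed subspace of $(M_1)^n$ for every model $M$ of $T$, and for every elementary map $\rho:M\to N$, $X(\rho)$ is the restriction of $\rho$ (applied coordinatewise) to $X(M)$. **$T$-definable sets.** A $T$-functor $X$ with $X(M)\subseteq (M_1)^n$ is a $T$-definable set if for every $\epsilon>0$ there are a $T$-formula $\phi(\overline{x})$, with $\overline{x}$ an $n$-tuple of variables ranging over the unit ball, and $\delta>0$ such that for all models $M$ of $T$: - $X(M)\subseteq Z(\phi^M)$; and - for all $\overline{a}=(a_i)_{i=1}^n\in (M_1)^n$, if $\phi^M(\overline{a})<\delta$, then $\inf_{\overline{x}\in X(M)}\max_{1\le i\le n} d(a_i,x_i)\le\epsilon$. **Free independence.** A noncommutative probability space is a unital algebra $A$ equipped with a state $\varphi$. A family $(A_i)_{i\in I}$ of unital subalgebras of $A$ is free if $\varphi(a_1a_2\cdots a_n)=0$ whenever $n\ge 1$, $a_j\in A_{i_j}$ with $i_j\ne i_{j+1}$ for all $1\le j<n$, and $\varphi(a_j)=0$ for all $j$. Two elements $a,b\in A$ are freely independent (or free) if they generate free subalgebras $\mathbb{C}[a]$ and $\mathbb{C}[b]$, where $\mathbb{C}[a]$ denotes the unital subalgebra of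 $A$ generated by $a$, i.e. the set of all polynomials in $a$ with complex coefficients (and likewise for $b$). *)

theory Defs
  imports
    "HOL-Analysis.Analysis"
    "HOL-Algebra.Module"
    "HOL-Computational_Algebra.Polynomial"
begin

section \<open>Complex algebras and C*-algebras\<close>

definition complex_ring :: "complex ring" where
  "complex_ring = \<lparr>carrier = UNIV, mult = (*), one = 1, zero = 0, add = (+)\<rparr>"

record 'a ncps = "(complex, 'a) module" +
  adj :: "'a \<Rightarrow> 'a"
  opnorm :: "'a \<Rightarrow> real"
  state :: "'a \<Rightarrow> complex"

text \<open>Distances are set to 0 off the carrier, so that the symmetry law of
  \<^locale>\<open>Metric_space\<close>, which is not relativised to the carrier, holds.\<close>

definition dist_on :: "('a, 'm) ring_scheme \<Rightarrow> ('a \<Rightarrow> real) \<Rightarrow> 'a \<Rightarrow> 'a \<Rightarrow> real" where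
  "dist_on A nrm x y =
     (if x \<in> carrier A \<and> y \<in> carrier A then nrm (x \<ominus>\<^bsub>A\<^esub> y) else 0)"

locale unital_complex_algebra = Module.module complex_ring A + Ring.ring A
  for A :: "(complex, 'a, 'm) module_scheme" (structure) +
  assumes smult_mult_left:
      "\<lbrakk>x \<in> carrier A; y \<in> carrier A\<rbrakk> \<Longrightarrow> (c \<odot> x) \<otimes> y = c \<odot> (x \<otimes> y)"
    and smult_mult_right:
      "\<lbrakk>x \<in> carrier A; y \<in> carrier A\<rbrakk> \<Longrightarrow> x \<otimes> (c \<odot> y) = c \<odot> (x \<otimes> y)"

locale unital_cstar_algebra = unital_complex_algebra A
  for A :: "'a ncps" (structure) +
  assumes adj_closed: "x \<in> carrier A \<Longrightarrow> adj A x \<in> carrier A"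
    and adj_adj: "x \<in> carrier A \<Longrightarrow> adj A (adj A x) = x"
    and adj_add: "\<lbrakk>x \<in> carrier A; y \<in> carrier A\<rbrakk> \<Longrightarrow> adj A (x \<oplus> y) = adj A x \<oplus> adj A y"
    and adj_smult: "x \<in> carrier A \<Longrightarrow> adj A (c \<odot> x) = cnj c \<odot> adj A x"
    and adj_mult: "\<lbrakk>x \<in> carrier A; y \<in> carrier A\<rbrakk> \<Longrightarrow> adj A (x \<otimes> y) = adj A y \<otimes> adj A x"
    and opnorm_nonneg: "x \<in> carrier A \<Longrightarrow> 0 \<le> opnorm A x"
    and opnorm_eq_0: "x \<in> carrier A \<Longrightarrow> opnorm A x = 0 \<longleftrightarrow> x = \<zero>"
    and opnorm_triangle:
      "\<lbrakk>x \<in> carrier A; y \<in> carrier A\<rbrakk> \<Longrightarrow> opnorm A (x \<oplus> y) \<le> opnorm A x + opnorm A y"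
    and opnorm_smult: "x \<in> carrier A \<Longrightarrow> opnorm A (c \<odot> x) = cmod c * opnorm A x"
    and opnorm_mult:
      "\<lbrakk>x \<in> carrier A; y \<in> carrier A\<rbrakk> \<Longrightarrow> opnorm A (x \<otimes> y) \<le> opnorm A x * opnorm A y"
    and cstar_identity: "x \<in> carrier A \<Longrightarrow> opnorm A (adj A x \<otimes> x) = (opnorm A x)\<^sup>2"
    and opnorm_complete:
      "Metric_space.mcomplete (carrier A) (dist_on A (opnorm A))"

locale cstar_probability_space = unital_cstar_algebra A
  for A :: "'a ncps" (structure) +
  assumes state_add:
      "\<lbrakk>x \<in> carrier A; y \<in> carrier A\<rbrakk> \<Longrightarrow> state A (x \<oplus> y) = state A x + state A y"
    and state_smult: "x \<in> carrier A \<Longrightarrow> state A (c \<odot> x) = c * state A x"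
    and state_one: "state A \<one> = 1"
    and state_positive: "x \<in> carrier A \<Longrightarrow> state A (adj A x \<otimes> x) \<in> \<real>\<^sub>\<ge>\<^sub>0"


section \<open>Von Neumann algebras\<close>

text \<open>A Hilbert space reuses the library's module record; the multiplicative fields
  of that record are ignored. The inner product is linear in its first argument.\<close>

record 'h inner_module = "(complex, 'h) module" +
  hinner :: "'h \<Rightarrow> 'h \<Rightarrow> complex"

definition hnorm :: "'h inner_module \<Rightarrow> 'h \<Rightarrow> real" where
  "hnorm H v = sqrt (Re (hinner H v v))"

locale hilbert_space = Module.module complex_ring H
  for H :: "'h inner_module" (structure) +
  assumes hinner_add_left:
      "\<lbrakk>u \<in> carrier H; v \<in> carrier H; w \<in> carrier H\<rbrakk>
        \<Longrightarrow> hinner H (u \<oplus> v) w = hinner H u w + hinner H v w"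
    and hinner_smult_left:
      "\<lbrakk>u \<in> carrier H; v \<in> carrier H\<rbrakk> \<Longrightarrow> hinner H (c \<odot> u) v = c * hinner H u v"
    and hinner_commute:
      "\<lbrakk>u \<in> carrier H; v \<in> carrier H\<rbrakk> \<Longrightarrow> hinner H v u = cnj (hinner H u v)"
    and hinner_nonneg: "u \<in> carrier H \<Longrightarrow> hinner H u u \<in> \<real>\<^sub>\<ge>\<^sub>0"
    and hinner_eq_0: "u \<in> carrier H \<Longrightarrow> hinner H u u = 0 \<longleftrightarrow> u = \<zero>"
    and hilbert_complete: "Metric_space.mcomplete (carrier H) (dist_on H (hnorm H))"

definition bounded_operators :: "'h inner_module \<Rightarrow> ('h \<Rightarrow> 'h) set" where
  "bounded_operators H =
     {T \<in> carrier H \<rightarrow>\<^sub>E carrier H.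
        (\<forall>u\<in>carrier H. \<forall>v\<in>carrier H. T (u \<oplus>\<^bsub>H\<^esub> v) = T u \<oplus>\<^bsub>H\<^esub> T v) \<and>
        (\<forall>c. \<forall>u\<in>carrier H. T (c \<odot>\<^bsub>H\<^esub> u) = c \<odot>\<^bsub>H\<^esub> T u) \<and>
        (\<exists>K. \<forall>u\<in>carrier H. hnorm H (T u) \<le> K * hnorm H u)}"

definition weak_operator_topology :: "'h inner_module \<Rightarrow> ('h \<Rightarrow> 'h) topology" where
  "weak_operator_topology H =
     pullback_topology (bounded_operators H)
       (\<lambda>T. \<lambda>(u, v)\<in>carrier H \<times> carrier H. hinner H (T u) v)
       (product_topology (\<lambda>_. euclidean) (carrier H \<times> carrier H))"

text \<open>Injective unital *-homomorphisms into the bounded operators on \<open>H\<close>.\<close>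

definition faithful_representation ::
    "'a ncps \<Rightarrow> 'h inner_module \<Rightarrow> ('a \<Rightarrow> 'h \<Rightarrow> 'h) \<Rightarrow> bool" where
  "faithful_representation A H \<pi> \<longleftrightarrow>
     \<pi> \<in> carrier A \<rightarrow> bounded_operators H \<and> inj_on \<pi> (carrier A) \<and>
     (\<forall>x\<in>carrier A. \<forall>y\<in>carrier A. \<forall>u\<in>carrier H.
        \<pi> (x \<oplus>\<^bsub>A\<^esub> y) u = \<pi> x u \<oplus>\<^bsub>H\<^esub> \<pi> y u) \<and>
     (\<forall>c. \<forall>x\<in>carrier A. \<forall>u\<in>carrier H. \<pi> (c \<odot>\<^bsub>A\<^esub> x) u = c \<odot>\<^bsub>H\<^esub> \<pi> x u) \<and>
     (\<forall>x\<in>carrier A. \<forall>y\<in>carrier A. \<forall>u\<in>carrier H. \<pi> (x \<otimes>\<^bsub>A\<^esub> y) u = \<pi> x (\<pi> y u)) \<and>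
     (\<forall>u\<in>carrier H. \<pi> \<one>\<^bsub>A\<^esub> u = u) \<and>
     (\<forall>x\<in>carrier A. \<forall>u\<in>carrier H. \<forall>v\<in>carrier H.
        hinner H (\<pi> (adj A x) u) v = hinner H u (\<pi> x v))"

text \<open>A von Neumann algebra is a C*-algebra that is *-isomorphic to a unital *-algebra
  of bounded operators which is closed in the weak operator topology. The Hilbert spaces
  range over those with carrier in \<^typ>\<open>'a \<Rightarrow> complex\<close>. Every Hilbert space of dimension at
  most the cardinality of \<^typ>\<open>'a\<close> has a copy there, namely \<open>l\<^sup>2(I)\<close> for some
  \<open>I \<subseteq> UNIV\<close>, and the GNS space of a faithful normal state on an algebra with carrier
  in \<^typ>\<open>'a\<close> is one of these, so the choice of type is no restriction for tracial
  von Neumann algebras.\<close>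

definition von_neumann_algebra :: "'a ncps \<Rightarrow> bool" where
  "von_neumann_algebra A \<longleftrightarrow>
     unital_cstar_algebra A \<and>
     (\<exists>(H :: ('a \<Rightarrow> complex) inner_module) \<pi>.
        hilbert_space H \<and> faithful_representation A H \<pi> \<and>
        closedin (weak_operator_topology H) (\<pi> ` carrier A))"

definition self_adjoints :: "'a ncps \<Rightarrow> 'a set" where
  "self_adjoints A = {x \<in> carrier A. adj A x = x}"

definition op_le :: "'a ncps \<Rightarrow> 'a \<Rightarrow> 'a \<Rightarrow> bool" where
  "op_le A x y \<longleftrightarrow> (\<exists>c\<in>carrier A. y \<ominus>\<^bsub>A\<^esub> x = adj A c \<otimes>\<^bsub>A\<^esub> c)"

definition is_op_lub :: "'a ncps \<Rightarrow> 'a set \<Rightarrow> 'a \<Rightarrow> bool" where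
  "is_op_lub A D s \<longleftrightarrow>
     s \<in> self_adjoints A \<and> (\<forall>x\<in>D. op_le A x s) \<and>
     (\<forall>t\<in>self_adjoints A. (\<forall>x\<in>D. op_le A x t) \<longrightarrow> op_le A s t)"

definition normal_state :: "'a ncps \<Rightarrow> bool" where
  "normal_state A \<longleftrightarrow>
     (\<forall>D s. D \<subseteq> self_adjoints A \<and> D \<noteq> {} \<and>
        (\<forall>x\<in>D. \<forall>y\<in>D. \<exists>z\<in>D. op_le A x z \<and> op_le A y z) \<and> is_op_lub A D s
        \<longrightarrow> Re (state A s) = (SUP x\<in>D. Re (state A x)))"

locale tracial_von_neumann_algebra = cstar_probability_space A
  for A :: "'a ncps" (structure) +
  assumes von_neumann: "von_neumann_algebra A"
    and normal: "normal_state A"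
    and faithful: "\<lbrakk>x \<in> carrier A; state A (adj A x \<otimes> x) = 0\<rbrakk> \<Longrightarrow> x = \<zero>"
    and tracial: "\<lbrakk>x \<in> carrier A; y \<in> carrier A\<rbrakk> \<Longrightarrow> state A (x \<otimes> y) = state A (y \<otimes> x)"


section \<open>The two theories and their models\<close>

datatype model_theory = CStar_Prob | Tracial_VN

fun is_model :: "model_theory \<Rightarrow> 'a ncps \<Rightarrow> bool" where
  "is_model CStar_Prob M \<longleftrightarrow> cstar_probability_space M"
| "is_model Tracial_VN M \<longleftrightarrow> tracial_von_neumann_algebra M"

definition norm2 :: "'a ncps \<Rightarrow> 'a \<Rightarrow> real" where
  "norm2 M x = sqrt (Re (state M (adj M x \<otimes>\<^bsub>M\<^esub> x)))"

fun model_norm :: "model_theory \<Rightarrow> 'a ncps \<Rightarrow> 'a \<Rightarrow> real" where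
  "model_norm CStar_Prob M = opnorm M"
| "model_norm Tracial_VN M = norm2 M"

definition model_dist :: "model_theory \<Rightarrow> 'a ncps \<Rightarrow> 'a \<Rightarrow> 'a \<Rightarrow> real" where
  "model_dist T M = dist_on M (model_norm T M)"

definition op_ball :: "'a ncps \<Rightarrow> nat \<Rightarrow> 'a set" where
  "op_ball M k = {x \<in> carrier M. opnorm M x \<le> real k}"

text \<open>\<open>(M_1)^n\<close>, as lists of length \<open>n\<close>, with the maximum metric.\<close>

definition ball_tuples :: "nat \<Rightarrow> 'a ncps \<Rightarrow> 'a list set" where
  "ball_tuples n M = {a. length a = n \<and> set a \<subseteq> op_ball M 1}"

definition tuple_dist ::
    "model_theory \<Rightarrow> nat \<Rightarrow> 'a ncps \<Rightarrow> 'a list \<Rightarrow> 'a list \<Rightarrow> real" where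
  "tuple_dist T n M a b = (MAX i\<in>{..<n}. model_dist T M (a ! i) (b ! i))"


section \<open>Formulas\<close>

datatype star_poly =
    PVar nat
  | PConst complex
  | PAdd star_poly star_poly
  | PMult star_poly star_poly
  | PStar star_poly

primrec poly_vars :: "star_poly \<Rightarrow> nat set" where
  "poly_vars (PVar i) = {i}"
| "poly_vars (PConst c) = {}"
| "poly_vars (PAdd p q) = poly_vars p \<union> poly_vars q"
| "poly_vars (PMult p q) = poly_vars p \<union> poly_vars q"
| "poly_vars (PStar p) = poly_vars p"

primrec poly_val :: "'a ncps \<Rightarrow> (nat \<Rightarrow> 'a) \<Rightarrow> star_poly \<Rightarrow> 'a" where
  "poly_val M s (PVar i) = s i"
| "poly_val M s (PConst c) = c \<odot>\<^bsub>M\<^esub> \<one>\<^bsub>M\<^esub>"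
| "poly_val M s (PAdd p q) = poly_val M s p \<oplus>\<^bsub>M\<^esub> poly_val M s q"
| "poly_val M s (PMult p q) = poly_val M s p \<otimes>\<^bsub>M\<^esub> poly_val M s q"
| "poly_val M s (PStar p) = adj M (poly_val M s p)"

text \<open>\<open>Connective f [\<phi>\<^sub>1, \<dots>, \<phi>\<^sub>m]\<close> applies a function \<open>f\<close> on \<open>\<real>\<^sup>m\<close>. In
  \<open>FSup i k \<phi>\<close> and \<open>FInf i k \<phi>\<close> the variable \<open>i\<close> ranges over the ball of radius \<open>k\<close>.\<close>

datatype formula =
    ReState star_poly
  | ImState star_poly
  | NormOf star_poly
  | Connective "(nat \<Rightarrow> real) \<Rightarrow> real" "formula list"
  | FSup nat nat formula
  | FInf nat nat formula

text \<open>Finite lists as points of \<^term>\<open>topspace (Euclidean_space (length vs))\<close>.\<close>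

definition vec_of :: "real list \<Rightarrow> nat \<Rightarrow> real" where
  "vec_of vs i = (if i < length vs then vs ! i else 0)"

fun is_formula :: "formula \<Rightarrow> bool" where
  "is_formula (Connective f \<phi>s) \<longleftrightarrow>
     continuous_map (Euclidean_space (length \<phi>s)) euclideanreal f \<and>
     (\<forall>\<phi>\<in>set \<phi>s. is_formula \<phi>)"
| "is_formula (FSup i k \<phi>) \<longleftrightarrow> is_formula \<phi>"
| "is_formula (FInf i k \<phi>) \<longleftrightarrow> is_formula \<phi>"
| "is_formula _ \<longleftrightarrow> True"

fun free_vars :: "formula \<Rightarrow> nat set" where
  "free_vars (ReState p) = poly_vars p"
| "free_vars (ImState p) = poly_vars p"
| "free_vars (NormOf p) = poly_vars p"
| "free_vars (Connective f \<phi>s) = (\<Union>\<phi>\<in>set \<phi>s. free_vars \<phi>)"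
| "free_vars (FSup i k \<phi>) = free_vars \<phi> - {i}"
| "free_vars (FInf i k \<phi>) = free_vars \<phi> - {i}"

fun interp :: "model_theory \<Rightarrow> 'a ncps \<Rightarrow> (nat \<Rightarrow> 'a) \<Rightarrow> formula \<Rightarrow> real" where
  "interp T M s (ReState p) = Re (state M (poly_val M s p))"
| "interp T M s (ImState p) = Im (state M (poly_val M s p))"
| "interp T M s (NormOf p) = model_norm T M (poly_val M s p)"
| "interp T M s (Connective f \<phi>s) = f (vec_of (map (\<lambda>\<phi>. interp T M s \<phi>) \<phi>s))"
| "interp T M s (FSup i k \<phi>) = (SUP x\<in>op_ball M k. interp T M (s(i := x)) \<phi>)"
| "interp T M s (FInf i k \<phi>) = (INF x\<in>op_ball M k. interp T M (s(i := x)) \<phi>)"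

definition interp_tuple :: "model_theory \<Rightarrow> 'a ncps \<Rightarrow> formula \<Rightarrow> 'a list \<Rightarrow> real" where
  "interp_tuple T M \<phi> a = interp T M (\<lambda>i. if i < length a then a ! i else \<zero>\<^bsub>M\<^esub>) \<phi>"

definition zero_set :: "model_theory \<Rightarrow> nat \<Rightarrow> 'a ncps \<Rightarrow> formula \<Rightarrow> 'a list set" where
  "zero_set T n M \<phi> = {a \<in> ball_tuples n M. interp_tuple T M \<phi> a = 0}"

definition elementary_map :: "model_theory \<Rightarrow> 'a ncps \<Rightarrow> 'a ncps \<Rightarrow> ('a \<Rightarrow> 'a) \<Rightarrow> bool" where
  "elementary_map T M N \<rho> \<longleftrightarrow>
     \<rho> \<in> carrier M \<rightarrow> carrier N \<and>
     (\<forall>\<phi> s. is_formula \<phi> \<and> range s \<subseteq> carrier M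
        \<longrightarrow> interp T N (\<rho> \<circ> s) \<phi> = interp T M s \<phi>)"


section \<open>T-functors and T-definable sets\<close>

text \<open>On morphisms a T-functor is restriction, so it is determined by its object part
  \<open>X\<close> and preserves composition and identities. Models range over all those with
  carrier in \<^typ>\<open>'a\<close>.\<close>

definition T_functor :: "model_theory \<Rightarrow> nat \<Rightarrow> ('a ncps \<Rightarrow> 'a list set) \<Rightarrow> bool" where
  "T_functor T n X \<longleftrightarrow>
     n \<ge> 1 \<and>
     (\<forall>M. is_model T M \<longrightarrow>
        closedin (Metric_space.mtopology (ball_tuples n M) (tuple_dist T n M)) (X M)) \<and>
     (\<forall>M N \<rho>. is_model T M \<and> is_model T N \<and> elementary_map T M N \<rho> \<longrightarrow>
        (\<forall>a\<in>X M. map \<rho> a \<in> X N) \<and>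
        (\<forall>a\<in>X M. \<forall>b\<in>X M. tuple_dist T n N (map \<rho> a) (map \<rho> b) = tuple_dist T n M a b))"

definition T_definable :: "model_theory \<Rightarrow> nat \<Rightarrow> ('a ncps \<Rightarrow> 'a list set) \<Rightarrow> bool" where
  "T_definable T n X \<longleftrightarrow>
     (\<forall>\<epsilon>>0. \<exists>\<phi> \<delta>. is_formula \<phi> \<and> free_vars \<phi> \<subseteq> {..<n} \<and> \<delta> > 0 \<and>
        (\<forall>M. is_model T M \<longrightarrow>
           X M \<subseteq> zero_set T n M \<phi> \<and>
           (\<forall>a\<in>ball_tuples n M. interp_tuple T M \<phi> a < \<delta> \<longrightarrow>
              (INF x\<in>X M. ereal (tuple_dist T n M a x)) \<le> ereal \<epsilon>)))"


section \<open>Free independence\<close>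

definition generated_algebra :: "'a ncps \<Rightarrow> 'a \<Rightarrow> 'a set" where
  "generated_algebra M a =
     range (\<lambda>p :: complex poly.
       \<Oplus>\<^bsub>M\<^esub>i\<in>{..degree p}. coeff p i \<odot>\<^bsub>M\<^esub> (a [^]\<^bsub>M\<^esub> i))"

text \<open>A word lists pairs of an index \<open>i\<close> and an element of \<open>B i\<close>.\<close>

definition free_family :: "'a ncps \<Rightarrow> 'i set \<Rightarrow> ('i \<Rightarrow> 'a set) \<Rightarrow> bool" where
  "free_family M I B \<longleftrightarrow>
     (\<forall>w. w \<noteq> [] \<and>
        (\<forall>(i, x)\<in>set w. i \<in> I \<and> x \<in> B i \<and> state M x = 0) \<and>
        (\<forall>j. Suc j < length w \<longrightarrow> fst (w ! j) \<noteq> fst (w ! Suc j))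
        \<longrightarrow> state M (foldr (\<lambda>(i, x) y. x \<otimes>\<^bsub>M\<^esub> y) w \<one>\<^bsub>M\<^esub>) = 0)"

definition freely_independent :: "'a ncps \<Rightarrow> 'a \<Rightarrow> 'a \<Rightarrow> bool" where
  "freely_independent M a b \<longleftrightarrow>
     free_family M UNIV (\<lambda>second. if second then generated_algebra M b else generated_algebra M a)"

definition free_pairs :: "'a ncps \<Rightarrow> 'a list set" where
  "free_pairs M = {[x, y] | x y. x \<in> op_ball M 1 \<and> y \<in> op_ball M 1 \<and> freely_independent M x y}"

end

theory Submission
  imports Defs
begin

text \<open>
  Freeness of \<open>x\<close> and \<open>y\<close> only involves \<open>\<complex>[x]\<close> and \<open>\<complex>[y]\<close>, not the *-algebras that they generate.
  Hence \<open>(x, x)\<close> is free as soon as the state is multiplicative on \<open>\<complex>[x]\<close>. In a finite-dimensional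
  commutative algebra with a faithful state, however, a free pair has a scalar component, because
  centred indicators \<open>h\<close>, \<open>k\<close> of level sets of \<open>x\<close>, \<open>y\<close> give the alternating word \<open>h k h k\<close> a positive
  state. Free pairs are not definable because a model of the first kind is a limit of models of the
  second kind.

  For C*-probability spaces, the state of \<open>\<complex>\<^sup>2\<close> with weights \<open>(1, 0)\<close> is a limit of faithful states.
  For tracial von Neumann algebras, pack the unit disc by discs with centres \<open>c\<^sub>i\<close> and relative areas
  \<open>w\<^sub>i\<close>. By the mean value property, \<open>\<Sum> w\<^sub>i p(c\<^sub>i) = p(0)\<close> for every polynomial \<open>p\<close>, so the trace of
  \<open>l\<^sup>\<infinity>\<close> with weights \<open>w\<close> is multiplicative on \<open>\<complex>[c]\<close>; its truncations are finite-dimensional.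

  The approximating models are images of the limit under *-homomorphisms that map balls onto
  balls, and their states and norms converge uniformly on balls. By induction the values of all
  formulas converge, without any ultraproduct.

  That free pairs form a T-functor rests on the continuity of multiplication on bounded sets, and,
  for tracial von Neumann algebras, on the fact that \<open>\<parallel>x\<parallel> \<le> 1\<close> can be expressed by formulas, namely
  by \<open>\<parallel>x a\<parallel>\<^sub>2 \<le> \<parallel>a\<parallel>\<^sub>2\<close> for all \<open>a\<close>. The latter is proved with square roots in C*-algebras.
\<close>

text \<open>In the tracial case \<open>x\<close> cannot be self-adjoint: a trace that is
  multiplicative on \<complex>[x] gives it variance 0, and faithfulness then makes it scalar. So the
  values of \<open>x\<close> have to leave every real line, and averages over discs are a natural
  source of a character on the polynomials. The approximating models are finite because indicators
  of level sets have to be polynomials in \<open>x\<close>, and interpolation provides these for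
  finitely many values. Their failure is uniform: one scalar cannot be close to two different values
  of \<open>x\<close>, and two atoms whose weights stay bounded below make this visible in the
  2-norm, so that a single \<epsilon> refutes definability. All models share the carrier type
  \<open>'a\<close>; hence every algebra is built through an injection \<open>e\<close> of sequences
  into that type.\<close>

lemma complex_ring_simps [simp]:
  "carrier complex_ring = UNIV" "mult complex_ring = (*)" "one complex_ring = 1"
  "zero complex_ring = 0" "add complex_ring = (+)"
  by (simp_all add: complex_ring_def)

section \<open>Calculation in complex algebras and C*-algebras\<close>

context unital_complex_algebra
begin

lemma smult_closed' [simp, intro]: "x \<in> carrier A \<Longrightarrow> c \<odot> x \<in> carrier A"
  using smult_closed by simp

lemma smult_distr:
  "x \<in> carrier A \<Longrightarrow> (a + b) \<odot> x = a \<odot> x \<oplus> b \<odot> x"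
  "x \<in> carrier A \<Longrightarrow> y \<in> carrier A \<Longrightarrow> a \<odot> (x \<oplus> y) = a \<odot> x \<oplus> a \<odot> y"
  using smult_l_distr smult_r_distr by simp_all

lemma smult_smult: "x \<in> carrier A \<Longrightarrow> a \<odot> (b \<odot> x) = (a * b) \<odot> x"
  using smult_assoc1 by simp

lemma smult_1 [simp]: "x \<in> carrier A \<Longrightarrow> 1 \<odot> x = x"
  using smult_one by simp

lemma smult_0 [simp]: "x \<in> carrier A \<Longrightarrow> 0 \<odot> x = \<zero>"
  using smult_l_null by simp

lemma smult_zero [simp]: "c \<odot> \<zero> = \<zero>"
  using smult_r_null by simp

lemma smult_uminus_1: "x \<in> carrier A \<Longrightarrow> (-1) \<odot> x = \<ominus> x"
proof -
  assume x: "x \<in> carrier A"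
  have "(-1) \<odot> x \<oplus> x = (-1 + 1) \<odot> x"
    using x by (simp only: smult_distr smult_1)
  also have "\<dots> = \<zero>" using x by simp
  finally show ?thesis using x minus_equality by simp
qed

lemma minus_eq_smult: "x \<in> carrier A \<Longrightarrow> y \<in> carrier A \<Longrightarrow> x \<ominus> y = x \<oplus> (-1) \<odot> y"
  by (simp add: smult_uminus_1 a_minus_def)

lemma add_smult_collect:
  assumes "x \<in> carrier A"
  shows "a \<odot> x \<oplus> b \<odot> x = (a + b) \<odot> x" "x \<oplus> b \<odot> x = (1 + b) \<odot> x"
    "a \<odot> x \<oplus> x = (a + 1) \<odot> x" "x \<oplus> x = 2 \<odot> x"
  using assms smult_distr(1)[of x a b] smult_distr(1)[of x 1 b] smult_distr(1)[of x a 1]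
    smult_distr(1)[of x 1 1] by simp_all

lemma add_smult_collect':
  assumes "x \<in> carrier A" "z \<in> carrier A"
  shows "a \<odot> x \<oplus> (b \<odot> x \<oplus> z) = (a + b) \<odot> x \<oplus> z" "x \<oplus> (b \<odot> x \<oplus> z) = (1 + b) \<odot> x \<oplus> z"
    "a \<odot> x \<oplus> (x \<oplus> z) = (a + 1) \<odot> x \<oplus> z" "x \<oplus> (x \<oplus> z) = 2 \<odot> x \<oplus> z"
  using assms by (simp_all add: a_assoc[symmetric] add_smult_collect)

lemma minus_add_cancel_mid:
  assumes "x \<in> carrier A" "y \<in> carrier A" "z \<in> carrier A"
  shows "x \<ominus> z = (x \<ominus> y) \<oplus> (y \<ominus> z)"
  using assms by algebra

text \<open>Rewriting with these brings an element to a linear combination of monomials.\<close>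

lemmas lin_simps = minus_eq_smult smult_distr(2) smult_smult smult_mult_left smult_mult_right
  l_distr r_distr a_ac add_smult_collect add_smult_collect' m_assoc

lemma minus_eq_zero_iff: "x \<in> carrier A \<Longrightarrow> y \<in> carrier A \<Longrightarrow> x \<ominus> y = \<zero> \<longleftrightarrow> x = y"
  by (metis a_minus_def add.inv_closed minus_equality minus_minus r_neg)

lemma minus_smult_swap: "x \<in> carrier A \<Longrightarrow> y \<in> carrier A \<Longrightarrow> y \<ominus> x = (-1) \<odot> (x \<ominus> y)"
  by (simp add: lin_simps)

end

context unital_cstar_algebra
begin

lemmas adj_closed' [simp, intro] = adj_closed

lemma adj_one [simp]: "adj A \<one> = \<one>"
proof -
  have "adj A (adj A \<one> \<otimes> \<one>) = adj A \<one> \<otimes> adj A (adj A \<one>)"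
    by (intro adj_mult) auto
  then show ?thesis by (simp add: adj_adj)
qed

lemma adj_zero [simp]: "adj A \<zero> = \<zero>"
  using adj_smult[of \<one> 0] by simp

lemma adj_minus: "x \<in> carrier A \<Longrightarrow> y \<in> carrier A \<Longrightarrow> adj A (x \<ominus> y) = adj A x \<ominus> adj A y"
  by (simp add: minus_eq_smult adj_add adj_smult)

lemma opnorm_zero [simp]: "opnorm A \<zero> = 0"
  by (simp add: opnorm_eq_0)

text \<open>The C*-identity and submultiplicativity bound the norm of an element by that of its
  adjoint; applying this to the adjoint gives the converse.\<close>

lemma opnorm_adj [simp]:
  assumes x: "x \<in> carrier A" shows "opnorm A (adj A x) = opnorm A x"
proof -
  have *: "opnorm A y \<le> opnorm A (adj A y)" if "y \<in> carrier A" for y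
  proof (cases "opnorm A y = 0")
    case False
    have "(opnorm A y)\<^sup>2 \<le> opnorm A (adj A y) * opnorm A y"
      using opnorm_mult[of "adj A y" y] cstar_identity[of y] that by auto
    then show ?thesis using False opnorm_nonneg[OF that] by (simp add: power2_eq_square)
  qed (use that in \<open>auto intro: opnorm_nonneg\<close>)
  show ?thesis using *[of x] *[of "adj A x"] x by (simp add: adj_adj)
qed

lemma opnorm_selfadjoint_square:
  assumes "x \<in> carrier A" "adj A x = x" shows "opnorm A (x \<otimes> x) = (opnorm A x)\<^sup>2"
  using cstar_identity[of x] assms by simp

text \<open>The C*-identity makes the norm of the unit idempotent, hence 0 or 1. The value 0 cannot
  be excluded, since the zero algebra satisfies the axioms of the locale.\<close>

lemma opnorm_one_le: "opnorm A \<one> \<le> 1"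
proof -
  have "opnorm A \<one> = opnorm A \<one> * opnorm A \<one>"
    using cstar_identity[of \<one>] by (simp add: power2_eq_square)
  then show ?thesis by (cases "opnorm A \<one> = 0") auto
qed

end

section \<open>Metrics from norms, and convergence of bounded sequences\<close>

lemma Metric_space_dist_on:
  fixes A (structure)
  assumes "Module.module complex_ring A"
    and nn: "\<And>x. x \<in> carrier A \<Longrightarrow> 0 \<le> N x"
    and z: "\<And>x. x \<in> carrier A \<Longrightarrow> N x = 0 \<longleftrightarrow> x = \<zero>"
    and t: "\<And>x y. x \<in> carrier A \<Longrightarrow> y \<in> carrier A \<Longrightarrow> N (x \<oplus> y) \<le> N x + N y"
    and s: "\<And>x c. x \<in> carrier A \<Longrightarrow> N (c \<odot> x) = cmod c * N x"
  shows "Metric_space (carrier A) (dist_on A N)"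
proof -
  interpret Module.module complex_ring A by fact
  have swap: "N (x \<ominus> y) = N (y \<ominus> x)" if c: "x \<in> carrier A" "y \<in> carrier A" for x y
  proof -
    have "(-1) \<odot> (x \<ominus> y) \<oplus> 1 \<odot> (x \<ominus> y) = (-1 + 1) \<odot> (x \<ominus> y)"
      using smult_l_distr[of "-1" 1 "x \<ominus> y"] c by simp
    then have "(-1) \<odot> (x \<ominus> y) \<oplus> (x \<ominus> y) = \<zero>"
      using smult_l_null[of "x \<ominus> y"] smult_one[of "x \<ominus> y"] c by simp
    then have "(-1) \<odot> (x \<ominus> y) = \<ominus> (x \<ominus> y)"
      using minus_equality smult_closed[of "-1" "x \<ominus> y"] c by simp
    also have "\<dots> = y \<ominus> x" using c by (simp add: a_minus_def minus_add a_comm)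
    finally show ?thesis using s[of "x \<ominus> y" "-1"] c by simp
  qed
  show ?thesis
  proof
    fix x y z
    show "0 \<le> dist_on A N x y" by (auto simp: dist_on_def intro: nn)
    show "dist_on A N x y = dist_on A N y x" by (auto simp: dist_on_def swap)
    show "dist_on A N x y = 0 \<longleftrightarrow> x = y" if c: "x \<in> carrier A" "y \<in> carrier A"
    proof -
      have "x \<ominus> y = \<zero> \<longleftrightarrow> x = y"
        using c by (metis a_minus_def add.inv_closed minus_equality minus_minus r_neg)
      then show ?thesis using c by (simp add: dist_on_def z)
    qed
    show "dist_on A N x z \<le> dist_on A N x y + dist_on A N y z"
      if c: "x \<in> carrier A" "y \<in> carrier A" "z \<in> carrier A"
    proof -
      have "x \<ominus> z = (x \<ominus> y) \<oplus> (y \<ominus> z)"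
        using c by (simp add: a_minus_def a_ac r_neg1 r_neg2)
      then show ?thesis using c t[of "x \<ominus> y" "y \<ominus> z"] by (simp add: dist_on_def)
    qed
  qed
qed

text \<open>The operator norm of a C*-algebra and the 2-norm of a tracial von Neumann algebra
  are treated simultaneously.\<close>

locale cstar_bimodule_norm = unital_cstar_algebra +
  fixes N :: "'a \<Rightarrow> real"
  assumes N_nonneg: "x \<in> carrier A \<Longrightarrow> 0 \<le> N x"
    and N_eq_0: "x \<in> carrier A \<Longrightarrow> N x = 0 \<longleftrightarrow> x = \<zero>"
    and N_triangle: "\<lbrakk>x \<in> carrier A; y \<in> carrier A\<rbrakk> \<Longrightarrow> N (x \<oplus> y) \<le> N x + N y"
    and N_smult: "x \<in> carrier A \<Longrightarrow> N (c \<odot> x) = cmod c * N x"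
    and N_mult_left: "\<lbrakk>x \<in> carrier A; y \<in> carrier A\<rbrakk> \<Longrightarrow> N (x \<otimes> y) \<le> opnorm A x * N y"
    and N_mult_right: "\<lbrakk>x \<in> carrier A; y \<in> carrier A\<rbrakk> \<Longrightarrow> N (x \<otimes> y) \<le> N x * opnorm A y"
begin

lemma N_Metric_space: "Metric_space (carrier A) (dist_on A N)"
  by (rule Metric_space_dist_on)
    (auto intro: N_nonneg N_triangle simp: N_eq_0 N_smult module_axioms)

lemma N_minus_commute: "\<lbrakk>x \<in> carrier A; y \<in> carrier A\<rbrakk> \<Longrightarrow> N (x \<ominus> y) = N (y \<ominus> x)"
  using N_smult[of "x \<ominus> y" "-1"] minus_smult_swap[of x y] by simp

text \<open>For the 2-norm, multiplication is in general jointly continuous only on sets bounded in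
  operator norm. The bound is therefore made part of convergence.\<close>

definition conv :: "(nat \<Rightarrow> 'a) \<Rightarrow> 'a \<Rightarrow> bool" where
  "conv g l \<longleftrightarrow> (\<forall>n. g n \<in> carrier A) \<and> l \<in> carrier A \<and> (\<exists>K. \<forall>n. opnorm A (g n) \<le> K) \<and>
     (\<lambda>n. N (g n \<ominus> l)) \<longlonglongrightarrow> 0"

lemma convD: "conv g l \<Longrightarrow> g n \<in> carrier A" "conv g l \<Longrightarrow> l \<in> carrier A"
  by (auto simp: conv_def)

lemma conv_const: "x \<in> carrier A \<Longrightarrow> conv (\<lambda>_. x) x"
  using minus_eq_zero_iff[of x x] N_eq_0[of \<zero>] by (auto simp: conv_def)

lemma conv_unique:
  assumes "conv g l" "conv g m" shows "l = m"
proof -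
  have c: "g n \<in> carrier A" "l \<in> carrier A" "m \<in> carrier A" for n using assms by (auto simp: conv_def)
  have "N (l \<ominus> m) \<le> N (g n \<ominus> l) + N (g n \<ominus> m)" for n
    using c N_triangle[of "l \<ominus> g n" "g n \<ominus> m"]
    by (simp add: minus_add_cancel_mid[symmetric] N_minus_commute[of l "g n"])
  moreover have "(\<lambda>n. N (g n \<ominus> l) + N (g n \<ominus> m)) \<longlonglongrightarrow> 0 + 0"
    using assms by (intro tendsto_add) (auto simp: conv_def)
  ultimately have "N (l \<ominus> m) \<le> 0" by (intro LIMSEQ_le_const) auto
  then have "N (l \<ominus> m) = 0" using N_nonneg[of "l \<ominus> m"] c by auto
  then show ?thesis using c by (simp add: N_eq_0 minus_eq_zero_iff)
qed

lemma conv_add: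
  assumes "conv g l" "conv h m" shows "conv (\<lambda>n. g n \<oplus> h n) (l \<oplus> m)"
proof -
  have c: "g n \<in> carrier A" "l \<in> carrier A" "h n \<in> carrier A" "m \<in> carrier A" for n
    using assms by (auto simp: conv_def)
  obtain K L where "opnorm A (g n) \<le> K" "opnorm A (h n) \<le> L" for n
    using assms by (auto simp: conv_def)
  then have "opnorm A (g n \<oplus> h n) \<le> K + L" for n
    using c opnorm_triangle[of "g n" "h n"] by (meson add_mono order_trans)
  moreover have "(\<lambda>n. N ((g n \<oplus> h n) \<ominus> (l \<oplus> m))) \<longlonglongrightarrow> 0"
  proof (rule tendsto_sandwich[OF _ _ tendsto_const])
    show "(\<lambda>n. N (g n \<ominus> l) + N (h n \<ominus> m)) \<longlonglongrightarrow> 0"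
      using assms by (auto simp: conv_def intro: tendsto_add_zero)
    have "(g n \<oplus> h n) \<ominus> (l \<oplus> m) = (g n \<ominus> l) \<oplus> (h n \<ominus> m)" for n
      using c(1)[of n] c(2) c(3)[of n] c(4) by algebra
    then show "\<forall>\<^sub>F n in sequentially. N ((g n \<oplus> h n) \<ominus> (l \<oplus> m)) \<le> N (g n \<ominus> l) + N (h n \<ominus> m)"
      using c by (simp add: N_triangle)
  qed (use c in \<open>simp_all add: N_nonneg\<close>)
  ultimately show ?thesis using c by (auto simp: conv_def)
qed

lemma conv_mult:
  assumes "conv g l" "conv h m" shows "conv (\<lambda>n. g n \<otimes> h n) (l \<otimes> m)"
proof -
  have c: "g n \<in> carrier A" "l \<in> carrier A" "h n \<in> carrier A" "m \<in> carrier A" for n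
    using assms by (auto simp: conv_def)
  obtain K L where b: "opnorm A (g n) \<le> K" "opnorm A (h n) \<le> L" for n
    using assms by (auto simp: conv_def)
  have "opnorm A (g n \<otimes> h n) \<le> K * L" for n
    using c opnorm_mult[of "g n" "h n"] mult_mono[OF b(1)[of n] b(2)[of n]]
    by (meson opnorm_nonneg order_trans b)
  moreover have "(\<lambda>n. N ((g n \<otimes> h n) \<ominus> (l \<otimes> m))) \<longlonglongrightarrow> 0"
  proof (rule tendsto_sandwich[OF _ _ tendsto_const])
    show "(\<lambda>n. N (g n \<ominus> l) * L + opnorm A l * N (h n \<ominus> m)) \<longlonglongrightarrow> 0"
      using assms by (auto simp: conv_def intro!: tendsto_add_zero tendsto_mult_left_zero tendsto_mult_right_zero)
    \<comment> \<open>Each product now pairs a factor that is small in \<open>N\<close> with one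
      that is bounded in operator norm, as the two bimodule inequalities require.\<close>
    have e: "(g n \<otimes> h n) \<ominus> (l \<otimes> m) = (g n \<ominus> l) \<otimes> h n \<oplus> l \<otimes> (h n \<ominus> m)" for n
      using c(1)[of n] c(2) c(3)[of n] c(4) by algebra
    have "N ((g n \<otimes> h n) \<ominus> (l \<otimes> m)) \<le> N (g n \<ominus> l) * L + opnorm A l * N (h n \<ominus> m)" for n
    proof -
      have "N ((g n \<otimes> h n) \<ominus> (l \<otimes> m)) \<le> N ((g n \<ominus> l) \<otimes> h n) + N (l \<otimes> (h n \<ominus> m))"
        unfolding e using c by (intro N_triangle) auto
      also have "\<dots> \<le> N (g n \<ominus> l) * opnorm A (h n) + opnorm A l * N (h n \<ominus> m)"
        using c by (intro add_mono N_mult_left N_mult_right) auto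
      also have "\<dots> \<le> N (g n \<ominus> l) * L + opnorm A l * N (h n \<ominus> m)"
        using c b by (intro add_mono mult_left_mono N_nonneg opnorm_nonneg) auto
      finally show ?thesis .
    qed
    then show "\<forall>\<^sub>F n in sequentially. N ((g n \<otimes> h n) \<ominus> (l \<otimes> m)) \<le> N (g n \<ominus> l) * L + opnorm A l * N (h n \<ominus> m)"
      by simp
  qed (use c in \<open>simp_all add: N_nonneg\<close>)
  ultimately show ?thesis using c by (auto simp: conv_def)
qed

lemma conv_smult:
  assumes "conv g l" "k \<longlonglongrightarrow> c" shows "conv (\<lambda>n. k n \<odot> g n) (c \<odot> l)"
proof -
  \<comment> \<open>Scalars are treated as multiples of the unit, so that \<open>conv_mult\<close>
    covers varying coefficients.\<close>
  have one: "conv (\<lambda>n. k n \<odot> \<one>) (c \<odot> \<one>)"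
  proof -
    obtain K where "cmod (k n) \<le> K" for n
      using convergent_imp_Bseq[OF convergentI[OF assms(2)]] by (auto simp: Bseq_def)
    then have "opnorm A (k n \<odot> \<one>) \<le> K * opnorm A \<one>" for n
      by (simp add: opnorm_smult mult_right_mono opnorm_nonneg)
    moreover have "N (k n \<odot> \<one> \<ominus> c \<odot> \<one>) = cmod (k n - c) * N \<one>" for n
      by (subst N_smult[symmetric]) (simp_all add: lin_simps)
    moreover have "(\<lambda>n. cmod (k n - c) * N \<one>) \<longlonglongrightarrow> 0"
      using assms(2) by (intro tendsto_mult_left_zero) (simp add: LIM_zero tendsto_norm_zero)
    ultimately show ?thesis by (auto simp: conv_def)
  qed
  have "conv (\<lambda>n. k n \<odot> \<one> \<otimes> g n) (c \<odot> \<one> \<otimes> l)"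
    using conv_mult[OF one assms(1)] .
  moreover have "k n \<odot> \<one> \<otimes> g n = k n \<odot> g n" "c \<odot> \<one> \<otimes> l = c \<odot> l" for n
    using assms by (auto simp: conv_def smult_mult_left)
  ultimately show ?thesis by simp
qed

lemma conv_minus: "conv g l \<Longrightarrow> conv h m \<Longrightarrow> conv (\<lambda>n. g n \<ominus> h n) (l \<ominus> m)"
  using conv_add[OF _ conv_smult[of h m "\<lambda>_. -1"]]
  by (auto simp: minus_eq_smult convD)

end

section \<open>Square roots in C*-algebras\<close>

text \<open>The solution of \<open>t = (1 + t\<^sup>2) / 2\<close> by iteration from 0. It dominates the norms in the
  iteration \<open>g = (h + g\<^sup>2) / 2\<close>, whose limit gives \<open>(1 - g)\<^sup>2 = 1 - h\<close>.\<close>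

primrec sqrt_majorant :: "nat \<Rightarrow> real" where
  "sqrt_majorant 0 = 0"
| "sqrt_majorant (Suc n) = (1 + (sqrt_majorant n)\<^sup>2) / 2"

lemma sqrt_majorant_bounds: "0 \<le> sqrt_majorant n \<and> sqrt_majorant n \<le> 1"
  by (induction n) (auto simp: power_le_one)

lemma sqrt_majorant_mono: "sqrt_majorant n \<le> sqrt_majorant (Suc n)"
  using sum_squares_bound[of "sqrt_majorant n" 1] by simp

lemma sqrt_majorant_convergent: "convergent sqrt_majorant"
proof (rule Bseq_monoseq_convergent)
  show "Bseq sqrt_majorant" using sqrt_majorant_bounds by (intro BseqI'[of _ 1]) auto
  show "monoseq sqrt_majorant" using sqrt_majorant_mono by (intro incseq_imp_monoseq incseq_SucI)
qed

context unital_cstar_algebra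
begin

sublocale op: cstar_bimodule_norm A "opnorm A"
  by unfold_locales (auto simp: opnorm_nonneg opnorm_eq_0 opnorm_triangle opnorm_smult opnorm_mult)

lemma op_Cauchy_conv:
  assumes g: "\<And>n. g n \<in> carrier A"
    and C: "\<And>e. e > 0 \<Longrightarrow> \<exists>n0. \<forall>m\<ge>n0. \<forall>n\<ge>n0. opnorm A (g m \<ominus> g n) < e"
    and K: "\<And>n. opnorm A (g n) \<le> K"
  obtains l where "op.conv g l"
proof -
  interpret Metric_space "carrier A" "dist_on A (opnorm A)" by (rule op.N_Metric_space)
  have "MCauchy g"
    unfolding MCauchy_def using g C by (auto simp: dist_on_def)
  then obtain l where l: "limitin mtopology g l sequentially"
    using opnorm_complete unfolding mcomplete_def by blast
  then have "l \<in> carrier A" "(\<lambda>n. dist_on A (opnorm A) (g n) l) \<longlonglongrightarrow> 0"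
    by (auto simp: limitin_metric_dist_null)
  then have "op.conv g l" using g K unfolding op.conv_def by (auto simp: dist_on_def)
  then show thesis by (rule that)
qed

lemma op_conv_adj: "op.conv g l \<Longrightarrow> op.conv (\<lambda>n. adj A (g n)) (adj A l)"
  unfolding op.conv_def by (simp add: adj_minus[symmetric])

lemma op_conv_norm_le:
  assumes "op.conv g l" "\<And>n. opnorm A (g n) \<le> K" shows "opnorm A l \<le> K"
proof -
  have c: "g n \<in> carrier A" "l \<in> carrier A" for n using assms by (auto simp: op.conv_def)
  have "opnorm A l \<le> opnorm A (g n \<ominus> l) + K" for n
  proof -
    have "l = (l \<ominus> g n) \<oplus> g n" using c(1)[of n] c(2) by algebra
    then have "opnorm A l \<le> opnorm A (l \<ominus> g n) + opnorm A (g n)"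
      using c opnorm_triangle[of "l \<ominus> g n" "g n"] by simp
    then show ?thesis using assms(2)[of n] op.N_minus_commute[of l "g n"] c by simp
  qed
  moreover have "(\<lambda>n. opnorm A (g n \<ominus> l) + K) \<longlonglongrightarrow> 0 + K"
    using assms by (intro tendsto_add) (auto simp: op.conv_def)
  ultimately show ?thesis by (intro LIMSEQ_le_const[of _ K]) auto
qed

primrec sqrt_iter :: "'a \<Rightarrow> nat \<Rightarrow> 'a" where
  "sqrt_iter h 0 = \<zero>"
| "sqrt_iter h (Suc n) = (1/2) \<odot> (h \<oplus> sqrt_iter h n \<otimes> sqrt_iter h n)"

lemma sqrt_iter_closed [simp, intro]: "h \<in> carrier A \<Longrightarrow> sqrt_iter h n \<in> carrier A"
  by (induction n) auto

lemma sqrt_iter_commute: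
  "h \<in> carrier A \<Longrightarrow> y \<in> carrier A \<Longrightarrow> h \<otimes> y = y \<otimes> h \<Longrightarrow> sqrt_iter h n \<otimes> y = y \<otimes> sqrt_iter h n"
proof (induction n)
  case (Suc n)
  let ?g = "sqrt_iter h n"
  have "?g \<otimes> ?g \<otimes> y = y \<otimes> (?g \<otimes> ?g)"
    using Suc by (metis m_assoc sqrt_iter_closed)
  then show ?case using Suc by (simp add: smult_mult_left smult_mult_right l_distr r_distr)
qed simp

lemma sqrt_iter_adj:
  "h \<in> carrier A \<Longrightarrow> adj A h = h \<Longrightarrow> adj A (sqrt_iter h n) = sqrt_iter h n"
  by (induction n) (simp_all add: adj_smult adj_add adj_mult)

text \<open>The recursion has positive coefficients, so the triangle inequality turns each step into
  the scalar recursion with the norm of \<open>h\<close> replaced by 1. For norm exactly 1 there is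
  no geometric rate in general, which is why increments are compared with those of the
  majorant.\<close>

lemma sqrt_iter_norm:
  assumes h: "h \<in> carrier A" "opnorm A h \<le> 1"
  shows "opnorm A (sqrt_iter h n) \<le> sqrt_majorant n"
    and "opnorm A (sqrt_iter h (Suc n) \<ominus> sqrt_iter h n) \<le> sqrt_majorant (Suc n) - sqrt_majorant n"
proof -
  have 1: "opnorm A (sqrt_iter h n) \<le> sqrt_majorant n" for n
  proof (induction n)
    case (Suc n)
    let ?g = "sqrt_iter h n"
    have "opnorm A (h \<oplus> ?g \<otimes> ?g) \<le> opnorm A h + opnorm A ?g * opnorm A ?g"
      using h opnorm_triangle[of h "?g \<otimes> ?g"] opnorm_mult[of ?g ?g] by auto
    also have "\<dots> \<le> 1 + sqrt_majorant n * sqrt_majorant n"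
      using h Suc sqrt_majorant_bounds[of n] by (intro add_mono mult_mono) (auto intro: opnorm_nonneg)
    finally show ?case using h by (simp add: opnorm_smult power2_eq_square)
  qed simp
  then show "opnorm A (sqrt_iter h n) \<le> sqrt_majorant n" .
  show "opnorm A (sqrt_iter h (Suc n) \<ominus> sqrt_iter h n) \<le> sqrt_majorant (Suc n) - sqrt_majorant n"
  proof (induction n)
    case 0
    then show ?case using h by (simp add: opnorm_smult minus_eq_smult)
  next
    case (Suc n)
    define g g' where "g = sqrt_iter h n" and "g' = sqrt_iter h (Suc n)"
    have c: "g \<in> carrier A" "g' \<in> carrier A" using h unfolding g_def g'_def by blast+
    have "sqrt_iter h (Suc (Suc n)) \<ominus> sqrt_iter h (Suc n) = (1/2) \<odot> (h \<oplus> g' \<otimes> g') \<ominus> (1/2) \<odot> (h \<oplus> g \<otimes> g)"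
      unfolding g_def g'_def by simp
    also have "\<dots> = (1/2) \<odot> ((h \<oplus> g' \<otimes> g') \<ominus> (h \<oplus> g \<otimes> g))"
      using c h by (simp add: minus_eq_smult smult_distr(2) smult_smult)
    also have "(h \<oplus> g' \<otimes> g') \<ominus> (h \<oplus> g \<otimes> g) = g' \<otimes> (g' \<ominus> g) \<oplus> (g' \<ominus> g) \<otimes> g"
      using c h(1) by algebra
    finally have "opnorm A (sqrt_iter h (Suc (Suc n)) \<ominus> sqrt_iter h (Suc n))
        = opnorm A (g' \<otimes> (g' \<ominus> g) \<oplus> (g' \<ominus> g) \<otimes> g) / 2"
      using c by (simp add: opnorm_smult)
    also have "\<dots> \<le> (opnorm A g' * opnorm A (g' \<ominus> g) + opnorm A (g' \<ominus> g) * opnorm A g) / 2"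
      using c by (intro divide_right_mono order_trans[OF opnorm_triangle] add_mono opnorm_mult) auto
    also have "\<dots> = (opnorm A g' + opnorm A g) * opnorm A (g' \<ominus> g) / 2"
      by (simp add: algebra_simps)
    also have "\<dots> \<le> (sqrt_majorant (Suc n) + sqrt_majorant n) * (sqrt_majorant (Suc n) - sqrt_majorant n) / 2"
      using c 1[of n] 1[of "Suc n"] Suc.IH sqrt_majorant_bounds[of n] sqrt_majorant_bounds[of "Suc n"]
      unfolding g_def[symmetric] g'_def[symmetric]
      by (intro divide_right_mono mult_mono add_mono) (auto intro: opnorm_nonneg)
    also have "\<dots> = sqrt_majorant (Suc (Suc n)) - sqrt_majorant (Suc n)"
    proof -
      have "2 * sqrt_majorant (Suc n) = 1 + (sqrt_majorant n)\<^sup>2" by simp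
      then show ?thesis
        unfolding sqrt_majorant.simps(2)[of "Suc n"] by (simp only: power2_eq_square) argo
    qed
    finally show ?case .
  qed
qed

text \<open>The commutation clause stands in for the functional calculus. The bound on
  \<open>\<one> \<ominus> b\<close> makes the construction repeatable: a square root of
  \<open>b\<close> arises by taking \<open>\<one> \<ominus> b\<close> for \<open>h\<close>.\<close>

lemma sqrt_exists:
  assumes h: "h \<in> carrier A" "adj A h = h" "opnorm A h \<le> 1"
  obtains b where "b \<in> carrier A" "adj A b = b" "b \<otimes> b = \<one> \<ominus> h" "opnorm A (\<one> \<ominus> b) \<le> 1"
    "\<And>y. y \<in> carrier A \<Longrightarrow> h \<otimes> y = y \<otimes> h \<Longrightarrow> b \<otimes> y = y \<otimes> b"
proof -
  let ?g = "sqrt_iter h"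
  have c: "?g n \<in> carrier A" for n using h by blast
  have d: "opnorm A (?g m \<ominus> ?g n) \<le> sqrt_majorant m - sqrt_majorant n" if "n \<le> m" for m n
    using that
  proof (induction m rule: dec_induct)
    case base
    then show ?case using c minus_eq_zero_iff[of "?g n" "?g n"] by simp
  next
    case (step m)
    have "opnorm A (?g (Suc m) \<ominus> ?g n) \<le> opnorm A (?g (Suc m) \<ominus> ?g m) + opnorm A (?g m \<ominus> ?g n)"
      unfolding minus_add_cancel_mid[OF c c c, of "Suc m" n m]
      by (intro opnorm_triangle minus_closed c)
    then show ?case using step.IH sqrt_iter_norm(2)[OF h(1,3), of m] by linarith
  qed
  obtain l where l: "op.conv ?g l"
  proof (rule op_Cauchy_conv[of ?g 1])
    fix e :: real assume "e > 0"
    then obtain n0 where n0: "\<forall>m\<ge>n0. \<forall>n\<ge>n0. norm (sqrt_majorant m - sqrt_majorant n) < e"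
      using convergent_Cauchy[OF sqrt_majorant_convergent] CauchyD by blast
    have "opnorm A (?g m \<ominus> ?g n) < e" if "m \<ge> n0" "n \<ge> n0" for m n
    proof (cases "n \<le> m")
      case True
      then show ?thesis using d[OF True] n0 that by (smt (verit) real_norm_def)
    next
      case False
      then show ?thesis using d[of m n] n0 that op.N_minus_commute[OF c c, of m n]
        by (smt (verit) real_norm_def linorder_le_cases)
    qed
    then show "\<exists>n0. \<forall>m\<ge>n0. \<forall>n\<ge>n0. opnorm A (?g m \<ominus> ?g n) < e" by blast
  next
    show "opnorm A (?g n) \<le> 1" for n
      using sqrt_iter_norm(1)[OF h(1,3), of n] sqrt_majorant_bounds[of n] by linarith
  qed (use c in auto)
  have lc: "l \<in> carrier A" using l by (rule op.convD)
  have "op.conv (\<lambda>n. ?g (Suc n)) l"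
    using l LIMSEQ_Suc unfolding op.conv_def by blast
  moreover have "op.conv (\<lambda>n. ?g (Suc n)) ((1/2) \<odot> (h \<oplus> l \<otimes> l))"
    unfolding sqrt_iter.simps
    by (intro op.conv_smult op.conv_add op.conv_mult op.conv_const l h tendsto_const)
  ultimately have l2: "l = (1/2) \<odot> (h \<oplus> l \<otimes> l)" by (rule op.conv_unique)
  then have "2 \<odot> l = 2 \<odot> ((1/2) \<odot> (h \<oplus> l \<otimes> l))" by simp
  then have ll: "2 \<odot> l = h \<oplus> l \<otimes> l" using h lc by (simp add: smult_smult)
  have adj: "adj A l = l"
    using op_conv_adj[OF l] l sqrt_iter_adj[OF h(1,2)] op.conv_unique by simp
  have comm: "l \<otimes> y = y \<otimes> l" if "y \<in> carrier A" "h \<otimes> y = y \<otimes> h" for y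
  proof (rule op.conv_unique)
    show "op.conv (\<lambda>n. ?g n \<otimes> y) (l \<otimes> y)" by (intro op.conv_mult op.conv_const l that)
    show "op.conv (\<lambda>n. ?g n \<otimes> y) (y \<otimes> l)"
      unfolding sqrt_iter_commute[OF h(1) that] by (intro op.conv_mult op.conv_const l that)
  qed
  show thesis
  proof (rule that[of "\<one> \<ominus> l"])
    have "(\<one> \<ominus> l) \<otimes> (\<one> \<ominus> l) = \<one> \<ominus> (l \<oplus> l) \<oplus> l \<otimes> l"
      using lc r_one[OF lc] by algebra
    also have "l \<oplus> l = h \<oplus> l \<otimes> l" using ll lc by (simp add: add_smult_collect)
    also have "\<one> \<ominus> (h \<oplus> l \<otimes> l) \<oplus> l \<otimes> l = \<one> \<ominus> h" using lc h(1) by algebra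
    finally show "(\<one> \<ominus> l) \<otimes> (\<one> \<ominus> l) = \<one> \<ominus> h" .
    have "\<one> \<ominus> (\<one> \<ominus> l) = l" using lc by algebra
    moreover have "opnorm A l \<le> 1"
      using sqrt_iter_norm(1)[OF h(1,3)] sqrt_majorant_bounds by (intro op_conv_norm_le[OF l]) (meson order_trans)
    ultimately show "opnorm A (\<one> \<ominus> (\<one> \<ominus> l)) \<le> 1" by simp
    show "(\<one> \<ominus> l) \<otimes> y = y \<otimes> (\<one> \<ominus> l)" if "y \<in> carrier A" "h \<otimes> y = y \<otimes> h" for y
    proof -
      have "(\<one> \<ominus> l) \<otimes> y = y \<ominus> l \<otimes> y" "y \<otimes> (\<one> \<ominus> l) = y \<ominus> y \<otimes> l" using lc that(1) by (simp_all add: lin_simps)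
      then show ?thesis using comm[OF that] by simp
    qed
  qed (use lc adj in \<open>auto simp: adj_minus\<close>)
qed

text \<open>\<open>k + i b\<close> is unitary, and \<open>k\<close> is its real part.\<close>

lemma opnorm_le_1_of_sum_squares:
  assumes k: "k \<in> carrier A" "adj A k = k" and b: "b \<in> carrier A" "adj A b = b"
    and comm: "b \<otimes> k = k \<otimes> b" and sum: "k \<otimes> k \<oplus> b \<otimes> b = \<one>"
  shows "opnorm A k \<le> 1"
proof -
  define u where "u = k \<oplus> \<i> \<odot> b"
  have u: "u \<in> carrier A" "adj A u = k \<oplus> (-\<i>) \<odot> b"
    using k b by (simp_all add: u_def adj_add adj_smult)
  have "adj A u \<otimes> u = k \<otimes> k \<oplus> b \<otimes> b"
    using k b unfolding u(2) unfolding u_def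
    by (simp add: lin_simps comm)
  then have "(opnorm A u)\<^sup>2 \<le> 1"
    using cstar_identity[OF u(1)] sum opnorm_one_le by simp
  then have n: "opnorm A u \<le> 1" using opnorm_nonneg[OF u(1)] power2_le_imp_le[of "opnorm A u" 1] by simp
  have "k = (1/2) \<odot> (u \<oplus> adj A u)"
    using k b unfolding u(2) unfolding u_def by (simp add: lin_simps)
  then have "opnorm A k = opnorm A ((1/2) \<odot> (u \<oplus> adj A u))" by (rule arg_cong)
  also have "\<dots> = opnorm A (u \<oplus> adj A u) / 2" using u(1) by (simp add: opnorm_smult)
  finally show ?thesis using n opnorm_triangle[of u "adj A u"] u(1) by simp
qed

text \<open>The element \<open>c\<close> is the absolute value of \<open>k\<close>. A direct square
  root of \<open>k \<otimes> k\<close> would need that \<open>\<one> \<ominus> k \<otimes> k\<close>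
  has norm at most 1. This is obtained by first writing it as a square \<open>b \<otimes> b\<close>
  and then bounding \<open>b\<close>, whose square and that of \<open>k\<close> add up to the
  unit.\<close>

lemma abs_exists:
  assumes k: "k \<in> carrier A" "adj A k = k" "opnorm A k \<le> 1"
  obtains c where "c \<in> carrier A" "adj A c = c" "c \<otimes> c = k \<otimes> k" "opnorm A (\<one> \<ominus> c) \<le> 1"
    "\<And>y. y \<in> carrier A \<Longrightarrow> k \<otimes> y = y \<otimes> k \<Longrightarrow> c \<otimes> y = y \<otimes> c"
proof -
  have kk: "k \<otimes> k \<in> carrier A" "adj A (k \<otimes> k) = k \<otimes> k" "opnorm A (k \<otimes> k) \<le> 1"
    using k opnorm_selfadjoint_square[of k] by (auto simp: adj_mult power_le_one opnorm_nonneg)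
  obtain b where b: "b \<in> carrier A" "adj A b = b" "b \<otimes> b = \<one> \<ominus> k \<otimes> k"
    "\<And>y. y \<in> carrier A \<Longrightarrow> k \<otimes> k \<otimes> y = y \<otimes> (k \<otimes> k) \<Longrightarrow> b \<otimes> y = y \<otimes> b"
    using sqrt_exists[OF kk] by metis
  have bk: "b \<otimes> k = k \<otimes> b" using k by (intro b(4)) (auto simp: m_assoc)
  have "b \<otimes> b \<oplus> k \<otimes> k = \<one>" unfolding b(3) using k(1) by algebra
  then have "opnorm A b \<le> 1"
    using opnorm_le_1_of_sum_squares[OF b(1,2) k(1,2) bk[symmetric]] by simp
  then have h: "b \<otimes> b \<in> carrier A" "adj A (b \<otimes> b) = b \<otimes> b" "opnorm A (b \<otimes> b) \<le> 1"
    using b(1,2) opnorm_selfadjoint_square[of b] by (auto simp: adj_mult power_le_one opnorm_nonneg)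
  have comm: "k \<otimes> y = y \<otimes> k \<Longrightarrow> b \<otimes> b \<otimes> y = y \<otimes> (b \<otimes> b)" if "y \<in> carrier A" for y
  proof -
    assume "k \<otimes> y = y \<otimes> k"
    then have "k \<otimes> k \<otimes> y = y \<otimes> (k \<otimes> k)" using k that by (metis m_assoc)
    then have "b \<otimes> y = y \<otimes> b" using b(4) that by simp
    then show ?thesis using b(1) that by (metis m_assoc)
  qed
  have "\<one> \<ominus> b \<otimes> b = k \<otimes> k" unfolding b(3) using k(1) by algebra
  then show thesis using sqrt_exists[OF h] comm that by metis
qed

end

section \<open>States and norms of models\<close>

text \<open>The form is tested along multiples of the conjugate of \<open>b\<close>. It may be
  degenerate, because a state of a C*-algebra need not be faithful.\<close>

lemma semidefinite_form_Cauchy_Schwarz: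
  fixes p q :: real and b :: complex
  assumes "\<And>c. p + 2 * Re (c * b) + (cmod c)\<^sup>2 * q \<ge> 0" "q \<ge> 0"
  shows "(cmod b)\<^sup>2 \<le> p * q"
proof -
  have *: "p - 2 * t * (cmod b)\<^sup>2 + t\<^sup>2 * (cmod b)\<^sup>2 * q \<ge> 0" for t :: real
  proof -
    have "p + 2 * Re ((- of_real t * cnj b) * b) + (cmod (- of_real t * cnj b))\<^sup>2 * q \<ge> 0"
      by (rule assms(1))
    moreover have "Re ((- of_real t * cnj b) * b) = - t * (cmod b)\<^sup>2"
      by (simp only: cmod_power2) (simp add: power2_eq_square algebra_simps)
    ultimately show ?thesis by (simp add: norm_mult power_mult_distrib)
  qed
  show ?thesis
  proof (cases "q = 0")
    case True
    have "(cmod b)\<^sup>2 = 0"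
    proof (rule ccontr)
      assume "(cmod b)\<^sup>2 \<noteq> 0"
      \<comment> \<open>With \<open>q = 0\<close> the form is affine in \<open>t\<close>, and this
        \<open>t\<close> gives it the value -1.\<close>
      then show False using *[of "(p + 1) / (2 * (cmod b)\<^sup>2)"] True by simp
    qed
    then show ?thesis using True by simp
  next
    case False
    then have "q > 0" using assms(2) by simp
    \<comment> \<open>The quadratic in \<open>t\<close> attains its minimum at
      \<open>1/q\<close>.\<close>
    then show ?thesis using *[of "1/q"] by (simp add: power2_eq_square field_simps)
  qed
qed

context cstar_probability_space
begin

lemma state_zero [simp]: "state A \<zero> = 0"
  using state_smult[of \<zero> 0] by simp

lemma state_minus: "x \<in> carrier A \<Longrightarrow> y \<in> carrier A \<Longrightarrow> state A (x \<ominus> y) = state A x - state A y"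
  by (simp add: minus_eq_smult state_add state_smult)

lemma state_square_real:
  "x \<in> carrier A \<Longrightarrow> state A (adj A x \<otimes> x) = of_real ((norm2 A x)\<^sup>2)"
  using state_positive[of x]
  by (auto simp: norm2_def nonneg_Reals_def complex_eq_iff complex_nonneg_Reals_iff)

lemma Re_state_square: "x \<in> carrier A \<Longrightarrow> Re (state A (adj A x \<otimes> x)) = (norm2 A x)\<^sup>2"
  by (simp add: state_square_real)

lemma norm2_nonneg: "x \<in> carrier A \<Longrightarrow> 0 \<le> norm2 A x"
  using state_positive[of x] by (auto simp: norm2_def complex_nonneg_Reals_iff)

lemma state_square_add:
  assumes "x \<in> carrier A" "y \<in> carrier A"
  shows "state A (adj A (x \<oplus> c \<odot> y) \<otimes> (x \<oplus> c \<odot> y)) =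
    of_real ((norm2 A x)\<^sup>2) + c * state A (adj A x \<otimes> y) + cnj c * state A (adj A y \<otimes> x)
      + of_real ((cmod c)\<^sup>2 * (norm2 A y)\<^sup>2)"
proof -
  have "state A (adj A (x \<oplus> c \<odot> y) \<otimes> (x \<oplus> c \<odot> y)) = state A (adj A x \<otimes> x)
     + c * state A (adj A x \<otimes> y) + cnj c * state A (adj A y \<otimes> x) + c * cnj c * state A (adj A y \<otimes> y)"
    using assms
    by (simp add: adj_add adj_smult l_distr r_distr smult_mult_left smult_mult_right smult_smult
        state_add state_smult algebra_simps)
  then show ?thesis using assms complex_norm_square[of c] by (simp add: state_square_real)
qed

text \<open>Positivity forces the state to be Hermitian: its value at the square of
  \<open>x \<oplus> c \<odot> y\<close> is real, and \<open>c = 1\<close> and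
  \<open>c = \<i>\<close> compare the imaginary and the real parts.\<close>

lemma state_adj_swap:
  assumes "x \<in> carrier A" "y \<in> carrier A"
  shows "state A (adj A x \<otimes> y) = cnj (state A (adj A y \<otimes> x))"
proof -
  have "Im (state A (adj A (x \<oplus> c \<odot> y) \<otimes> (x \<oplus> c \<odot> y))) = 0" for c
    using state_positive[of "x \<oplus> c \<odot> y"] assms by (auto simp: complex_nonneg_Reals_iff)
  from this[of 1] this[of \<i>] show ?thesis
    unfolding state_square_add[OF assms] by (simp add: complex_eq_iff)
qed

lemma norm2_add_smult:
  assumes "x \<in> carrier A" "y \<in> carrier A"
  shows "(norm2 A (x \<oplus> c \<odot> y))\<^sup>2 = (norm2 A x)\<^sup>2 + 2 * Re (c * state A (adj A x \<otimes> y)) + (cmod c)\<^sup>2 * (norm2 A y)\<^sup>2"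
proof -
  have "(norm2 A (x \<oplus> c \<odot> y))\<^sup>2 = Re (state A (adj A (x \<oplus> c \<odot> y) \<otimes> (x \<oplus> c \<odot> y)))"
    using assms by (simp add: Re_state_square)
  then show ?thesis unfolding state_square_add[OF assms]
    using state_adj_swap[OF assms(2,1)] by simp
qed

lemma state_Cauchy_Schwarz:
  assumes "x \<in> carrier A" "y \<in> carrier A"
  shows "cmod (state A (adj A x \<otimes> y)) \<le> norm2 A x * norm2 A y"
proof -
  have "(cmod (state A (adj A x \<otimes> y)))\<^sup>2 \<le> (norm2 A x)\<^sup>2 * (norm2 A y)\<^sup>2"
  proof (rule semidefinite_form_Cauchy_Schwarz)
    fix c
    show "0 \<le> (norm2 A x)\<^sup>2 + 2 * Re (c * state A (adj A x \<otimes> y)) + (cmod c)\<^sup>2 * (norm2 A y)\<^sup>2"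
      unfolding norm2_add_smult[OF assms, symmetric] by simp
  qed simp
  then show ?thesis using norm2_nonneg assms
    by (intro power2_le_imp_le[OF _ mult_nonneg_nonneg]) (simp_all add: power_mult_distrib)
qed

lemma norm2_one: "norm2 A \<one> = 1"
  using state_one by (simp add: norm2_def)

lemma norm2_smult: "x \<in> carrier A \<Longrightarrow> norm2 A (c \<odot> x) = cmod c * norm2 A x"
proof -
  assume x: "x \<in> carrier A"
  have "(norm2 A (c \<odot> x))\<^sup>2 = (cmod c * norm2 A x)\<^sup>2"
    using norm2_add_smult[of \<zero> x c] x by (simp add: norm2_def[of _ \<zero>] power_mult_distrib)
  then show ?thesis using norm2_nonneg[of x] norm2_nonneg[of "c \<odot> x"] x
    by (simp add: power2_eq_iff_nonneg)
qed

lemma norm2_triangle: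
  assumes "x \<in> carrier A" "y \<in> carrier A"
  shows "norm2 A (x \<oplus> y) \<le> norm2 A x + norm2 A y"
proof -
  have "(norm2 A (x \<oplus> y))\<^sup>2 = (norm2 A x)\<^sup>2 + 2 * Re (state A (adj A x \<otimes> y)) + (norm2 A y)\<^sup>2"
    using norm2_add_smult[OF assms, of 1] assms by simp
  also have "\<dots> \<le> (norm2 A x)\<^sup>2 + 2 * (norm2 A x * norm2 A y) + (norm2 A y)\<^sup>2"
    using state_Cauchy_Schwarz[OF assms] complex_Re_le_cmod[of "state A (adj A x \<otimes> y)"] by simp
  also have "\<dots> = (norm2 A x + norm2 A y)\<^sup>2" by (simp add: power2_sum)
  finally show ?thesis
    by (rule power2_le_imp_le) (intro add_nonneg_nonneg norm2_nonneg assms)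
qed

text \<open>For a contraction \<open>x\<close>, the difference of the unit and
  \<open>adj A x \<otimes> x\<close> is a square \<open>b \<otimes> b\<close>. Hence the squared
  2-norms of \<open>b \<otimes> y\<close> and \<open>x \<otimes> y\<close> add up to that of
  \<open>y\<close>.\<close>

lemma norm2_mult_le:
  assumes x: "x \<in> carrier A" and y: "y \<in> carrier A"
  shows "norm2 A (x \<otimes> y) \<le> opnorm A x * norm2 A y"
proof -
  have *: "norm2 A (x \<otimes> y) \<le> norm2 A y" if x: "x \<in> carrier A" and n: "opnorm A x \<le> 1" for x
  proof -
    define h where "h = adj A x \<otimes> x"
    have h: "h \<in> carrier A" "adj A h = h" "opnorm A h \<le> 1"
      using x n opnorm_nonneg[OF x] unfolding h_def cstar_identity[OF x]
      by (auto simp: adj_mult adj_adj power_le_one)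
    obtain b where b: "b \<in> carrier A" "adj A b = b" "b \<otimes> b = \<one> \<ominus> h"
      using sqrt_exists[OF h] by metis
    have "adj A (b \<otimes> y) \<otimes> (b \<otimes> y) = adj A y \<otimes> (b \<otimes> b) \<otimes> y"
      using b(1,2) y by (simp add: adj_mult m_assoc)
    also have "\<dots> = adj A y \<otimes> y \<ominus> adj A (x \<otimes> y) \<otimes> (x \<otimes> y)"
      unfolding b(3) h_def using x y by (simp add: adj_mult lin_simps)
    finally have "(norm2 A (b \<otimes> y))\<^sup>2 = (norm2 A y)\<^sup>2 - (norm2 A (x \<otimes> y))\<^sup>2"
      using b(1) x y by (simp add: Re_state_square[symmetric] state_minus)
    then have "(norm2 A (x \<otimes> y))\<^sup>2 \<le> (norm2 A y)\<^sup>2" by (smt (verit) zero_le_power2)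
    then show ?thesis using norm2_nonneg[OF y] power2_le_imp_le by blast
  qed
  show ?thesis
  proof (cases "x = \<zero>")
    case True
    then show ?thesis using y by (simp add: norm2_def)
  next
    case False
    define r where "r = opnorm A x"
    have r: "r > 0" using False opnorm_nonneg[OF x] opnorm_eq_0[OF x] unfolding r_def by simp
    have "norm2 A ((of_real (1/r) \<odot> x) \<otimes> y) \<le> norm2 A y"
      using x r by (intro *) (auto simp: opnorm_smult r_def norm_divide)
    then show ?thesis using x y r
      by (simp add: smult_mult_left norm2_smult norm_divide field_simps r_def)
  qed
qed

lemma norm2_le_opnorm: "x \<in> carrier A \<Longrightarrow> norm2 A x \<le> opnorm A x"
  using norm2_mult_le[of x \<one>] by (simp add: norm2_one)

lemma cmod_state_le_norm2: "x \<in> carrier A \<Longrightarrow> cmod (state A x) \<le> norm2 A x"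
  using state_Cauchy_Schwarz[of \<one> x] by (simp add: norm2_one)

end

text \<open>The hypothesis says that \<open>k\<close> is positive in the GNS representation, which is faithful;
  the negative part \<open>m\<close> of \<open>k\<close> then vanishes, since \<open>m\<^sup>3 = - m k m\<close>.\<close>

lemma (in cstar_probability_space) sqrt_exists_of_GNS_positive:
  assumes faithful: "\<And>x. x \<in> carrier A \<Longrightarrow> state A (adj A x \<otimes> x) = 0 \<Longrightarrow> x = \<zero>"
    and k: "k \<in> carrier A" "adj A k = k"
    and pos: "\<And>a. a \<in> carrier A \<Longrightarrow> Re (state A (adj A a \<otimes> (k \<otimes> a))) \<ge> 0"
  obtains d where "d \<in> carrier A" "adj A d = d" "d \<otimes> d = k"
    "\<And>y. y \<in> carrier A \<Longrightarrow> k \<otimes> y = y \<otimes> k \<Longrightarrow> d \<otimes> y = y \<otimes> d"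
proof (cases "k = \<zero>")
  case True
  then show thesis using that[of \<zero>] by simp
next
  case False
  define r where "r = opnorm A k"
  have r: "r > 0" using False opnorm_nonneg[OF k(1)] opnorm_eq_0[OF k(1)] unfolding r_def by simp
  define l where "l = of_real (1/r) \<odot> k"
  have l: "l \<in> carrier A" "adj A l = l" "opnorm A l \<le> 1"
    using k r by (auto simp: l_def adj_smult opnorm_smult r_def norm_divide)
  obtain c where c: "c \<in> carrier A" "adj A c = c" "c \<otimes> c = l \<otimes> l" "opnorm A (\<one> \<ominus> c) \<le> 1"
    and c_comm: "\<And>y. y \<in> carrier A \<Longrightarrow> l \<otimes> y = y \<otimes> l \<Longrightarrow> c \<otimes> y = y \<otimes> c"
    using abs_exists[OF l] by metis
  have cl: "c \<otimes> l = l \<otimes> c" using c_comm l by simp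
  have oc: "\<one> \<ominus> c \<in> carrier A" "adj A (\<one> \<ominus> c) = \<one> \<ominus> c" using c by (auto simp: adj_minus)
  \<comment> \<open>A square root of \<open>c\<close>, the absolute value of \<open>l\<close>; it
    exists because \<open>\<one> \<ominus> c\<close> has norm at most 1.\<close>
  obtain d where d: "d \<in> carrier A" "adj A d = d" "d \<otimes> d = \<one> \<ominus> (\<one> \<ominus> c)"
    and d_comm: "\<And>y. y \<in> carrier A \<Longrightarrow> (\<one> \<ominus> c) \<otimes> y = y \<otimes> (\<one> \<ominus> c) \<Longrightarrow> d \<otimes> y = y \<otimes> d"
    using sqrt_exists[OF oc c(4)] by metis
  have dd: "d \<otimes> d = c" unfolding d(3) using c(1) by algebra
  \<comment> \<open>Twice the negative part of \<open>l\<close>.\<close>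
  define m where "m = c \<ominus> l"
  have m: "m \<in> carrier A" "adj A m = m" using c(1,2) l(1,2) by (auto simp: m_def adj_minus)
  have cm: "c \<otimes> m = m \<otimes> c" "m \<otimes> l = l \<otimes> m"
    using c(1) l(1) cl by (simp_all add: m_def lin_simps)
  have lm: "l \<otimes> m = (-1) \<odot> (c \<otimes> m)"
    using c(1,3) l(1) cl by (simp add: m_def lin_simps)
  \<comment> \<open>This square equals \<open>- m l m\<close>. Its state is nonnegative as that of a
    square and nonpositive by the hypothesis on \<open>k\<close>, so faithfulness gives
    \<open>d \<otimes> m = \<zero>\<close>.\<close>
  have "adj A (d \<otimes> m) \<otimes> (d \<otimes> m) = m \<otimes> (c \<otimes> m)"
  proof -
    have "adj A (d \<otimes> m) \<otimes> (d \<otimes> m) = m \<otimes> ((d \<otimes> d) \<otimes> m)"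
      using d(1,2) m by (simp add: adj_mult m_assoc)
    then show ?thesis unfolding dd .
  qed
  also have "c \<otimes> m = (-1) \<odot> (l \<otimes> m)" using lm c(1) m by (simp add: smult_smult)
  also have "m \<otimes> ((-1) \<odot> (l \<otimes> m)) = of_real (- 1 / r) \<odot> (adj A m \<otimes> (k \<otimes> m))"
    using m k by (simp add: l_def smult_mult_left smult_mult_right smult_smult)
  finally have "Re (state A (adj A (d \<otimes> m) \<otimes> (d \<otimes> m))) \<le> 0"
    using pos[OF m(1)] r m k(1) by (simp add: state_smult field_simps)
  then have "norm2 A (d \<otimes> m) = 0" using d(1) m by (simp add: Re_state_square)
  then have dm: "d \<otimes> m = \<zero>"
    using faithful[of "d \<otimes> m"] d(1) m(1) by (simp add: state_square_real)
  have "c \<otimes> m = d \<otimes> (d \<otimes> m)" using dd d(1) m by (simp add: m_assoc[symmetric])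
  then have "c \<otimes> m = \<zero>" using dm d by simp
  moreover then have "l \<otimes> m = \<zero>" using lm by simp
  ultimately have "m \<otimes> m = \<zero>"
    using c(1) l(1) m(1) by (subst (1) m_def) (simp add: minus_eq_smult l_distr smult_mult_left)
  then have "m = \<zero>" using opnorm_selfadjoint_square[OF m] opnorm_eq_0[OF m(1)] by simp
  then have "c = l" using minus_eq_zero_iff c l unfolding m_def by blast
  show thesis
  proof (rule that[of "of_real (sqrt r) \<odot> d"])
    have "of_real (sqrt r) * of_real (sqrt r) = (of_real r :: complex)"
      using r by (simp flip: of_real_mult)
    then show "(of_real (sqrt r) \<odot> d) \<otimes> (of_real (sqrt r) \<odot> d) = k"
      using d(1) dd \<open>c = l\<close> k r by (simp add: smult_mult_left smult_mult_right smult_smult l_def flip: of_real_mult)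
    fix y assume y: "y \<in> carrier A" "k \<otimes> y = y \<otimes> k"
    then have "c \<otimes> y = y \<otimes> c" using k unfolding \<open>c = l\<close> l_def by (simp add: smult_mult_left smult_mult_right)
    then have "d \<otimes> y = y \<otimes> d" using y c(1) by (intro d_comm) (simp_all add: lin_simps)
    then show "(of_real (sqrt r) \<odot> d) \<otimes> y = y \<otimes> (of_real (sqrt r) \<odot> d)"
      using y d(1) by (simp add: smult_mult_left smult_mult_right)
  qed (use d in \<open>auto simp: adj_smult\<close>)
qed

text \<open>With \<open>h = adj A z \<otimes> z\<close>, the assumed inequality says that
  \<open>\<one> \<ominus> h\<close> is positive in the GNS representation. So \<open>h\<close> and
  \<open>\<one> \<ominus> h\<close> have commuting square roots \<open>k\<close> and
  \<open>b\<close> whose squares add up to the unit, which bounds the norm of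
  \<open>k\<close>.\<close>

lemma (in cstar_probability_space) opnorm_le_1_of_norm2:
  assumes faithful: "\<And>x. x \<in> carrier A \<Longrightarrow> state A (adj A x \<otimes> x) = 0 \<Longrightarrow> x = \<zero>"
    and z: "z \<in> carrier A"
    and le: "\<And>a. a \<in> carrier A \<Longrightarrow> norm2 A (z \<otimes> a) \<le> norm2 A a"
  shows "opnorm A z \<le> 1"
proof -
  define h where "h = adj A z \<otimes> z"
  have h: "h \<in> carrier A" "adj A h = h" using z by (auto simp: h_def adj_mult adj_adj)
  have sq: "state A (adj A a \<otimes> (h \<otimes> a)) = of_real ((norm2 A (z \<otimes> a))\<^sup>2)" if "a \<in> carrier A" for a
    using that z state_square_real[of "z \<otimes> a"] by (simp add: h_def adj_mult m_assoc)
  obtain k where k: "k \<in> carrier A" "adj A k = k" "k \<otimes> k = h"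
    and k_comm: "\<And>y. y \<in> carrier A \<Longrightarrow> h \<otimes> y = y \<otimes> h \<Longrightarrow> k \<otimes> y = y \<otimes> k"
    using sqrt_exists_of_GNS_positive[OF faithful h] sq by (metis Re_complex_of_real zero_le_power2)
  have oh: "\<one> \<ominus> h \<in> carrier A" "adj A (\<one> \<ominus> h) = \<one> \<ominus> h" using h by (auto simp: adj_minus)
  have "Re (state A (adj A a \<otimes> ((\<one> \<ominus> h) \<otimes> a))) \<ge> 0" if a: "a \<in> carrier A" for a
  proof -
    have "adj A a \<otimes> ((\<one> \<ominus> h) \<otimes> a) = adj A a \<otimes> a \<ominus> adj A a \<otimes> (h \<otimes> a)"
      using a h(1) by (simp add: lin_simps)
    then have "Re (state A (adj A a \<otimes> ((\<one> \<ominus> h) \<otimes> a))) = (norm2 A a)\<^sup>2 - (norm2 A (z \<otimes> a))\<^sup>2"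
      using a h(1) by (simp add: state_minus state_square_real sq)
    then show ?thesis using power_mono[OF le[OF a], of 2] norm2_nonneg[of "z \<otimes> a"] z a by simp
  qed
  then obtain b where b: "b \<in> carrier A" "adj A b = b" "b \<otimes> b = \<one> \<ominus> h"
    and b_comm: "\<And>y. y \<in> carrier A \<Longrightarrow> (\<one> \<ominus> h) \<otimes> y = y \<otimes> (\<one> \<ominus> h) \<Longrightarrow> b \<otimes> y = y \<otimes> b"
    using sqrt_exists_of_GNS_positive[OF faithful oh] by metis
  have "k \<otimes> h = h \<otimes> k" using k_comm h by simp
  then have "b \<otimes> k = k \<otimes> b" using k(1) h(1) by (intro b_comm) (simp_all add: lin_simps)
  moreover have "k \<otimes> k \<oplus> b \<otimes> b = \<one>" unfolding k(3) b(3) using h(1) by algebra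
  ultimately have "opnorm A k \<le> 1" using opnorm_le_1_of_sum_squares k(1,2) b(1,2) by blast
  then have "opnorm A h \<le> 1"
    using opnorm_selfadjoint_square[OF k(1,2)] k(3) opnorm_nonneg[OF k(1)] by (simp add: power_le_one)
  then have "(opnorm A z)\<^sup>2 \<le> 1\<^sup>2" using cstar_identity[OF z] by (simp add: h_def)
  then show ?thesis by (rule power2_le_imp_le) simp
qed

text \<open>This is where the trace property enters the norm estimates: by passing to adjoints it
  converts the bound for left multiplication into the one for right multiplication.\<close>

lemma (in tracial_von_neumann_algebra) norm2_adj: "x \<in> carrier A \<Longrightarrow> norm2 A (adj A x) = norm2 A x"
  using tracial[of "adj A x" x] by (simp add: norm2_def adj_adj)

lemma is_model_cstar_probability_space: "is_model T M \<Longrightarrow> cstar_probability_space M"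
  by (cases T) (auto simp: tracial_von_neumann_algebra_def)

lemma is_model_bimodule_norm:
  assumes "is_model T M" shows "cstar_bimodule_norm M (model_norm T M)"
proof (cases T)
  case CStar_Prob
  then interpret cstar_probability_space M using assms by simp
  show ?thesis using CStar_Prob op.cstar_bimodule_norm_axioms by simp
next
  case Tracial_VN
  then interpret tracial_von_neumann_algebra M using assms by simp
  have "cstar_bimodule_norm M (norm2 M)"
  proof
    show "norm2 M x = 0 \<longleftrightarrow> x = \<zero>\<^bsub>M\<^esub>" if "x \<in> carrier M" for x
    proof
      assume "norm2 M x = 0"
      then show "x = \<zero>\<^bsub>M\<^esub>" using faithful[OF that] state_square_real[OF that] by simp
    qed (simp add: norm2_def)
    show "norm2 M (x \<otimes>\<^bsub>M\<^esub> y) \<le> norm2 M x * opnorm M y" if "x \<in> carrier M" "y \<in> carrier M" for x y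
      using norm2_mult_le[of "adj M y" "adj M x"] that norm2_adj[of "x \<otimes>\<^bsub>M\<^esub> y"]
      by (simp add: adj_mult norm2_adj mult.commute)
  qed (auto intro: norm2_nonneg norm2_triangle norm2_mult_le simp: norm2_smult)
  then show ?thesis using Tracial_VN by simp
qed

lemma cmod_state_le_model_norm:
  assumes "is_model T M" "x \<in> carrier M" shows "cmod (state M x) \<le> model_norm T M x"
proof -
  interpret cstar_probability_space M using is_model_cstar_probability_space[OF assms(1)] .
  show ?thesis using cmod_state_le_norm2[OF assms(2)] norm2_le_opnorm[OF assms(2)] by (cases T) auto
qed

section \<open>Free pairs form a T-functor\<close>

definition poly_ev :: "'a ncps \<Rightarrow> 'a \<Rightarrow> complex poly \<Rightarrow> 'a" where
  "poly_ev M a p = (\<Oplus>\<^bsub>M\<^esub>i\<in>{..degree p}. coeff p i \<odot>\<^bsub>M\<^esub> (a [^]\<^bsub>M\<^esub> i))"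

lemma generated_algebra_eq: "generated_algebra M a = range (poly_ev M a)"
  by (simp add: generated_algebra_def poly_ev_def)

abbreviation word_ev :: "'a ncps \<Rightarrow> 'a \<Rightarrow> 'a \<Rightarrow> (bool \<times> complex poly) list \<Rightarrow> 'a" where
  "word_ev M a b w \<equiv>
     foldr (\<lambda>(i, p) y. poly_ev M (if i then b else a) p \<otimes>\<^bsub>M\<^esub> y) w \<one>\<^bsub>M\<^esub>"

definition alternating :: "(bool \<times> 'b) list \<Rightarrow> bool" where
  "alternating w \<longleftrightarrow> (\<forall>j. Suc j < length w \<longrightarrow> fst (w ! j) \<noteq> fst (w ! Suc j))"

text \<open>Words of polynomials, unlike words of elements, can be evaluated at several pairs. This
  allows the same word to be compared along a convergent sequence or across an elementary
  map.\<close>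

lemma freely_independent_iff:
  "freely_independent M a b \<longleftrightarrow>
     (\<forall>w. w \<noteq> [] \<and> (\<forall>(i, p)\<in>set w. state M (poly_ev M (if i then b else a) p) = 0) \<and> alternating w
        \<longrightarrow> state M (word_ev M a b w) = 0)" (is "?l \<longleftrightarrow> ?r")
proof
  let ?f = "\<lambda>(i, p). (i, poly_ev M (if i then b else a) p)"
  have fold: "foldr (\<lambda>(i, x) y. x \<otimes>\<^bsub>M\<^esub> y) (map ?f w) \<one>\<^bsub>M\<^esub> = word_ev M a b w" for w
    by (induction w) auto
  have alt: "(\<forall>j. Suc j < length (map ?f w) \<longrightarrow> fst (map ?f w ! j) \<noteq> fst (map ?f w ! Suc j)) \<longleftrightarrow> alternating w" for w
    by (simp add: alternating_def case_prod_beta)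
  {
    assume l: ?l
    show ?r
    proof (intro allI impI, elim conjE)
      fix w :: "(bool \<times> complex poly) list"
      assume w: "w \<noteq> []" "\<forall>(i, p)\<in>set w. state M (poly_ev M (if i then b else a) p) = 0" "alternating w"
      have "\<forall>j. Suc j < length (map ?f w) \<longrightarrow> fst (map ?f w ! j) \<noteq> fst (map ?f w ! Suc j)"
        using w(3) unfolding alt .
      moreover have "\<forall>(i, x)\<in>set (map ?f w). i \<in> UNIV \<and> x \<in> (if i then range (poly_ev M b)
          else range (poly_ev M a)) \<and> state M x = 0"
      proof
        fix z assume "z \<in> set (map ?f w)"
        then obtain i p where "(i, p) \<in> set w" "z = (i, poly_ev M (if i then b else a) p)" by auto
        then show "case z of (i, x) \<Rightarrow> i \<in> UNIV \<and> x \<in> (if i then range (poly_ev M b)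
          else range (poly_ev M a)) \<and> state M x = 0" using w(2) by auto
      qed
      ultimately have "state M (foldr (\<lambda>(i, x) y. x \<otimes>\<^bsub>M\<^esub> y) (map ?f w) \<one>\<^bsub>M\<^esub>) = 0"
        using w(1) l[unfolded freely_independent_def free_family_def generated_algebra_eq]
        by (metis (no_types, lifting) map_is_Nil_conv)
      then show "state M (word_ev M a b w) = 0" unfolding fold .
    qed
  next
    assume r: ?r
    show ?l
      unfolding freely_independent_def free_family_def generated_algebra_eq
    proof (intro allI impI, elim conjE)
      fix u assume u: "u \<noteq> []"
        "\<forall>(i, x)\<in>set u. i \<in> UNIV \<and> x \<in> (if i then range (poly_ev M b) else range (poly_ev M a)) \<and> state M x = 0"
        "\<forall>j. Suc j < length u \<longrightarrow> fst (u ! j) \<noteq> fst (u ! Suc j)"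
      have "\<forall>y\<in>set u. \<exists>z. y = ?f z" using u(2) by (fastforce split: if_splits)
      then have "\<exists>w. u = map ?f w" unfolding ex_map_conv .
      then obtain w where w: "u = map ?f w" by blast
      have "alternating w" using u(3) unfolding w alt .
      moreover have "\<forall>(i, p)\<in>set w. state M (poly_ev M (if i then b else a) p) = 0"
        using u(2) unfolding w by auto
      ultimately have "state M (word_ev M a b w) = 0" using r u(1) w by simp
      then show "state M (foldr (\<lambda>(i, x) y. x \<otimes>\<^bsub>M\<^esub> y) u \<one>\<^bsub>M\<^esub>) = 0" unfolding w fold .
    qed
  }
qed

context unital_cstar_algebra
begin

lemma poly_ev_0 [simp]: "poly_ev A a 0 = \<zero>"
  by (simp add: poly_ev_def)

lemma poly_ev_closed [simp, intro]: "a \<in> carrier A \<Longrightarrow> poly_ev A a p \<in> carrier A"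
  unfolding poly_ev_def by (rule finsum_closed) auto

text \<open>The Horner step, which replaces finite sums of powers by induction on the
  polynomial.\<close>

lemma poly_ev_pCons:
  assumes a: "a \<in> carrier A" shows "poly_ev A a (pCons c q) = c \<odot> \<one> \<oplus> a \<otimes> poly_ev A a q"
proof (cases "q = 0")
  case True
  then show ?thesis using a by (simp add: poly_ev_def)
next
  case False
  have "poly_ev A a (pCons c q) =
      (\<Oplus>i\<in>{..degree q}. coeff (pCons c q) (Suc i) \<odot> (a [^] Suc i)) \<oplus> coeff (pCons c q) 0 \<odot> (a [^] (0::nat))"
    unfolding poly_ev_def using False a by (simp only: degree_pCons_eq[OF False]) (rule finsum_Suc2, auto)
  also have "(\<Oplus>i\<in>{..degree q}. coeff (pCons c q) (Suc i) \<odot> (a [^] Suc i)) = a \<otimes> poly_ev A a q"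
    unfolding poly_ev_def using a
    by (subst finsum_rdistr)
      (auto intro!: finsum_cong' simp: Pi_def smult_mult_right nat_pow_Suc2[symmetric] simp del: nat_pow_Suc)
  finally show ?thesis using a by (simp add: a_comm)
qed

lemma poly_ev_minus_const:
  assumes a: "a \<in> carrier A"
  shows "poly_ev A a (p - [:c:]) = poly_ev A a p \<ominus> c \<odot> \<one>"
proof (cases p)
  case (pCons b q)
  then have "poly_ev A a (p - [:c:]) = (b - c) \<odot> \<one> \<oplus> a \<otimes> poly_ev A a q"
    using a by (simp add: poly_ev_pCons)
  then show ?thesis using a pCons by (simp add: poly_ev_pCons lin_simps)
qed

lemma word_ev_closed [simp, intro]:
  "a \<in> carrier A \<Longrightarrow> b \<in> carrier A \<Longrightarrow> word_ev A a b w \<in> carrier A"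
  by (induction w) (auto split: if_splits)

end

lemma (in cstar_bimodule_norm) conv_poly_ev:
  "conv g a \<Longrightarrow> conv (\<lambda>n. poly_ev A (g n) p) (poly_ev A a p)"
proof (induction p)
  case 0
  then show ?case by (simp add: conv_const)
next
  case (pCons c p)
  have "conv (\<lambda>n. c \<odot> \<one> \<oplus> g n \<otimes> poly_ev A (g n) p) (c \<odot> \<one> \<oplus> a \<otimes> poly_ev A a p)"
    using pCons by (intro conv_add conv_mult conv_const) auto
  then show ?case using pCons.prems by (simp add: poly_ev_pCons convD)
qed

text \<open>A word that is centred at \<open>(a, b)\<close> need not be centred at
  \<open>(g n, h n)\<close>. Each letter is recentred there by subtracting its state. These
  constants tend to 0, so the recentred words converge to the original one and have state 0.\<close>

lemma free_pair_limit:
  assumes "is_model T M" and "cstar_bimodule_norm.conv M (model_norm T M) g a"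
    and "cstar_bimodule_norm.conv M (model_norm T M) h b"
    and free: "\<And>n. freely_independent M (g n) (h n)"
  shows "freely_independent M a b"
proof -
  interpret cstar_probability_space M using is_model_cstar_probability_space[OF assms(1)] .
  interpret cstar_bimodule_norm M "model_norm T M" using is_model_bimodule_norm[OF assms(1)] .
  have state_conv: "(\<lambda>n. state M (f n)) \<longlonglongrightarrow> state M l" if "conv f l" for f l
  proof -
    have c: "f n \<in> carrier M" "l \<in> carrier M" for n using that convD by auto
    have "(\<lambda>n. state M (f n) - state M l) \<longlonglongrightarrow> 0"
    proof (rule Lim_null_comparison)
      show "\<forall>\<^sub>F n in sequentially. cmod (state M (f n) - state M l) \<le> model_norm T M (f n \<ominus>\<^bsub>M\<^esub> l)"
        using c cmod_state_le_model_norm[OF assms(1)] by (simp flip: state_minus)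
      show "(\<lambda>n. model_norm T M (f n \<ominus>\<^bsub>M\<^esub> l)) \<longlonglongrightarrow> 0" using that by (simp add: conv_def)
    qed
    then show ?thesis by (simp add: LIM_zero_iff)
  qed
  show ?thesis
    unfolding freely_independent_iff
  proof (intro allI impI, elim conjE)
    fix w :: "(bool \<times> complex poly) list"
    assume w: "w \<noteq> []" "\<forall>(i, p)\<in>set w. state M (poly_ev M (if i then b else a) p) = 0" "alternating w"
    define u where "u n i = (if i then h n else g n)" for n and i :: bool
    define centre where "centre n = (\<lambda>(i, p). (i, p - [:state M (poly_ev M (u n i) p):]))" for n
    have uc: "conv (\<lambda>n. u n i) (if i then b else a)" for i
      using assms(2,3) by (auto simp: u_def)
    have ucl: "u n i \<in> carrier M" for n i using uc convD(1) by blast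
    have ev: "poly_ev M (u n i) (p - [:c:]) = poly_ev M (u n i) p \<ominus>\<^bsub>M\<^esub> c \<odot>\<^bsub>M\<^esub> \<one>\<^bsub>M\<^esub>" for n i p c
      by (rule poly_ev_minus_const[OF ucl])
    have "state M (word_ev M (g n) (h n) (map (centre n) w)) = 0" for n
    proof (rule free[of n, unfolded freely_independent_iff, rule_format], intro conjI)
      show "alternating (map (centre n) w)"
        using w(3) by (auto simp: alternating_def centre_def case_prod_beta)
      show "\<forall>(i, p)\<in>set (map (centre n) w). state M (poly_ev M (if i then h n else g n) p) = 0"
        using ucl by (auto simp: centre_def u_def[symmetric] ev state_minus state_smult state_one)
    qed (use w in simp)
    \<comment> \<open>The induction runs over words with letters from \<open>w\<close>, since the
      letters are known to be centred at the limit only for these.\<close>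
    moreover have "conv (\<lambda>n. word_ev M (g n) (h n) (map (centre n) v)) (word_ev M a b v)"
      if "set v \<subseteq> set w" for v
      using that
    proof (induction v)
      case Nil
      then show ?case by (simp add: conv_const)
    next
      case (Cons ip v)
      obtain i p where ip: "ip = (i, p)" by (cases ip)
      have p: "conv (\<lambda>n. poly_ev M (u n i) p) (poly_ev M (if i then b else a) p)"
        by (rule conv_poly_ev[OF uc])
      have "state M (poly_ev M (if i then b else a) p) = 0" using w(2) Cons.prems ip by auto
      then have "(\<lambda>n. state M (poly_ev M (u n i) p)) \<longlonglongrightarrow> 0" using state_conv[OF p] by simp
      then have "conv (\<lambda>n. state M (poly_ev M (u n i) p) \<odot>\<^bsub>M\<^esub> \<one>\<^bsub>M\<^esub>) (0 \<odot>\<^bsub>M\<^esub> \<one>\<^bsub>M\<^esub>)"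
        by (intro conv_smult conv_const) auto
      from conv_minus[OF p this]
      have "conv (\<lambda>n. poly_ev M (u n i) (p - [:state M (poly_ev M (u n i) p):])) (poly_ev M (if i then b else a) p)"
        using convD(2)[OF p] minus_zero by (simp add: ev a_minus_def)
      from conv_mult[OF this Cons.IH] Cons.prems show ?case
        by (simp add: ip centre_def u_def)
    qed
    ultimately show "state M (word_ev M a b w) = 0"
      using state_conv[of "\<lambda>n. word_ev M (g n) (h n) (map (centre n) w)"] LIMSEQ_unique[OF _ tendsto_const]
      by (metis (no_types, lifting) LIMSEQ_const_iff order_refl ext)
  qed
qed

section \<open>Closedness of the set of free pairs\<close>

lemma tuple_dist_2: "tuple_dist T 2 M a b = max (model_dist T M (a ! 0) (b ! 0)) (model_dist T M (a ! 1) (b ! 1))"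
proof -
  have "{..<2::nat} = {0, 1}" by auto
  then show ?thesis unfolding tuple_dist_def by simp
qed

lemma ball_tuples_2: "ball_tuples 2 M = {[x, y] | x y. x \<in> op_ball M 1 \<and> y \<in> op_ball M 1}"
  by (auto simp: ball_tuples_def numeral_2_eq_2 length_Suc_conv)

lemma Metric_space_tuple_dist:
  assumes "is_model T M" shows "Metric_space (ball_tuples 2 M) (tuple_dist T 2 M)"
proof -
  interpret cstar_bimodule_norm M "model_norm T M" using is_model_bimodule_norm[OF assms] .
  interpret Metric_space "carrier M" "model_dist T M" using N_Metric_space by (simp add: model_dist_def)
  have c: "x \<in> op_ball M 1 \<Longrightarrow> x \<in> carrier M" for x by (simp add: op_ball_def)
  show ?thesis
  proof
    fix x y z
    show "0 \<le> tuple_dist T 2 M x y" unfolding tuple_dist_2 by (simp add: le_max_iff_disj)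
    show "tuple_dist T 2 M x y = tuple_dist T 2 M y x" unfolding tuple_dist_2 by (simp add: commute)
    show "tuple_dist T 2 M x y = 0 \<longleftrightarrow> x = y" if "x \<in> ball_tuples 2 M" "y \<in> ball_tuples 2 M"
    proof
      assume "tuple_dist T 2 M x y = 0"
      then have "model_dist T M (x ! 0) (y ! 0) = 0" "model_dist T M (x ! 1) (y ! 1) = 0"
        unfolding tuple_dist_2 using nonneg[of "x ! 0" "y ! 0"] nonneg[of "x ! 1" "y ! 1"] by linarith+
      then show "x = y" using that by (auto simp: ball_tuples_2 c)
    qed (use that in \<open>auto simp: tuple_dist_2 ball_tuples_2 c\<close>)
    show "tuple_dist T 2 M x z \<le> tuple_dist T 2 M x y + tuple_dist T 2 M y z"
      if "x \<in> ball_tuples 2 M" "y \<in> ball_tuples 2 M" "z \<in> ball_tuples 2 M"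
    proof -
      have m: "x ! i \<in> carrier M \<and> y ! i \<in> carrier M \<and> z ! i \<in> carrier M" if "i < 2" for i
        using that \<open>x \<in> _\<close> \<open>y \<in> _\<close> \<open>z \<in> _\<close>
        by (simp add: ball_tuples_def c subset_iff)
      show ?thesis unfolding tuple_dist_2
        using triangle[of "x ! 0" "y ! 0" "z ! 0"] triangle[of "x ! 1" "y ! 1" "z ! 1"] m[of 0] m[of 1]
        by (auto simp: max_def)
    qed
  qed
qed

lemma closedin_free_pairs:
  assumes T: "is_model T M"
  shows "closedin (Metric_space.mtopology (ball_tuples 2 M) (tuple_dist T 2 M)) (free_pairs M)"
proof -
  interpret tup: Metric_space "ball_tuples 2 M" "tuple_dist T 2 M" by (rule Metric_space_tuple_dist[OF T])
  interpret cstar_bimodule_norm M "model_norm T M" using is_model_bimodule_norm[OF T] .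
  interpret Metric_space "carrier M" "model_dist T M" using N_Metric_space by (simp add: model_dist_def)
  show ?thesis
    unfolding tup.metric_closedin_iff_sequentially_closed
  proof (intro conjI allI impI)
    show "free_pairs M \<subseteq> ball_tuples 2 M" by (auto simp: free_pairs_def ball_tuples_2)
    fix \<sigma> l assume "range \<sigma> \<subseteq> free_pairs M \<and> limitin tup.mtopology \<sigma> l sequentially"
    then have s: "range \<sigma> \<subseteq> free_pairs M" and lim: "limitin tup.mtopology \<sigma> l sequentially" by auto
    have l: "l \<in> ball_tuples 2 M" "(\<lambda>n. tuple_dist T 2 M (\<sigma> n) l) \<longlonglongrightarrow> 0"
      using lim by (auto simp: tup.limitin_metric_dist_null)
    then obtain x y where xy: "l = [x, y]" "x \<in> op_ball M 1" "y \<in> op_ball M 1" by (auto simp: ball_tuples_2)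
    have sn: "\<exists>u v. \<sigma> n = [u, v] \<and> u \<in> op_ball M 1 \<and> v \<in> op_ball M 1 \<and> freely_independent M u v" for n
      using s by (auto simp: free_pairs_def image_subset_iff)
    then obtain g h where gh: "\<And>n. \<sigma> n = [g n, h n]" "\<And>n. g n \<in> op_ball M 1" "\<And>n. h n \<in> op_ball M 1"
      "\<And>n. freely_independent M (g n) (h n)" by metis
    have "(\<lambda>n. model_dist T M (\<sigma> n ! i) (l ! i)) \<longlonglongrightarrow> 0" if "i < 2" for i
    proof (rule Lim_null_comparison[OF _ l(2)])
      have "model_dist T M (\<sigma> n ! i) (l ! i) \<le> tuple_dist T 2 M (\<sigma> n) l" for n
        using less_2_cases[OF that] by (auto simp: tuple_dist_2)
      then show "\<forall>\<^sub>F n in sequentially. norm (model_dist T M (\<sigma> n ! i) (l ! i)) \<le> tuple_dist T 2 M (\<sigma> n) l"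
        by simp
    qed
    from this[of 0] this[of 1] have "conv g x" "conv h y"
      using gh xy by (auto simp: conv_def op_ball_def model_dist_def dist_on_def intro!: exI[of _ 1])
    then have "freely_independent M x y" using free_pair_limit[OF T] gh(4) by blast
    then show "l \<in> free_pairs M" using xy by (auto simp: free_pairs_def)
  qed
qed

section \<open>Elementary maps preserve the unit ball, freeness and distances\<close>

lemma continuous_map_Euclidean_space_iff:
  "continuous_map (Euclidean_space n) euclideanreal f \<longleftrightarrow> continuous_on {x. \<forall>i\<ge>n. x i = 0} f"
  by (simp add: Euclidean_space_def euclidean_product_topology)

lemma op_ball_carrier: "x \<in> op_ball M k \<Longrightarrow> x \<in> carrier M"
  by (simp add: op_ball_def)

lemma elementary_map_op_ball:
  assumes M: "is_model T M" and N: "is_model T N" and el: "elementary_map T M N \<rho>"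
    and x: "x \<in> op_ball M 1"
  shows "\<rho> x \<in> op_ball N 1"
proof -
  interpret M: cstar_bimodule_norm M "model_norm T M" using is_model_bimodule_norm[OF M] .
  interpret N: cstar_bimodule_norm N "model_norm T N" using is_model_bimodule_norm[OF N] .
  have xc: "x \<in> carrier M" and rx: "\<rho> x \<in> carrier N"
    using x el by (auto simp: op_ball_def elementary_map_def)
  show ?thesis
  proof (cases T)
    case CStar_Prob
    have "interp T N (\<rho> \<circ> (\<lambda>_. x)) (NormOf (PVar 0)) = interp T M (\<lambda>_. x) (NormOf (PVar 0))"
      using el xc unfolding elementary_map_def by (metis image_subset_iff is_formula.simps(6) UNIV_I)
    then show ?thesis using CStar_Prob x rx by (simp add: op_ball_def)
  next
    case Tracial_VN
    interpret N': tracial_von_neumann_algebra N using N Tracial_VN by simp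
    define f :: "(nat \<Rightarrow> real) \<Rightarrow> real" where "f v = max 0 (v 0 - v 1)" for v
    \<comment> \<open>Variable 0 holds the element and variable 1 runs over the unit ball. The value
      is 0 if left multiplication by the element never increases the 2-norm on that ball.\<close>
    define \<phi> where "\<phi> = FSup 1 1 (Connective f [NormOf (PMult (PVar 0) (PVar 1)), NormOf (PVar 1)])"
    have "continuous_on UNIV f" unfolding f_def by (intro continuous_intros continuous_on_product_coordinates)
    then have "is_formula \<phi>"
      unfolding \<phi>_def by (auto simp: continuous_map_Euclidean_space_iff intro: continuous_on_subset)
    then have eq: "interp T N (\<rho> \<circ> (\<lambda>_. x)) \<phi> = interp T M (\<lambda>_. x) \<phi>"
      using el xc unfolding elementary_map_def by (metis image_subset_iff)
    have v: "interp T K (\<lambda>_. z) \<phi> = (SUP y\<in>op_ball K 1. max 0 (norm2 K (z \<otimes>\<^bsub>K\<^esub> y) - norm2 K y))" for K z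
      by (simp add: \<phi>_def f_def vec_of_def Tracial_VN)
    have "max 0 (norm2 M (x \<otimes>\<^bsub>M\<^esub> y) - norm2 M y) = 0" if "y \<in> op_ball M 1" for y
    proof -
      have "norm2 M (x \<otimes>\<^bsub>M\<^esub> y) \<le> opnorm M x * norm2 M y"
        using M.N_mult_left[OF xc op_ball_carrier[OF that]] Tracial_VN by simp
      also have "\<dots> \<le> norm2 M y"
        using x M.N_nonneg[OF op_ball_carrier[OF that]] Tracial_VN M.opnorm_nonneg[OF xc]
        by (intro mult_left_le_one_le) (auto simp: op_ball_def)
      finally show ?thesis by simp
    qed
    moreover have "op_ball M 1 \<noteq> {}" using x by auto
    ultimately have "interp T M (\<lambda>_. x) \<phi> = 0" unfolding v by simp
    then have 0: "(SUP y\<in>op_ball N 1. max 0 (norm2 N (\<rho> x \<otimes>\<^bsub>N\<^esub> y) - norm2 N y)) = 0"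
      using eq v[of N "\<rho> x"] by (simp add: comp_def)
    have le1: "norm2 N (\<rho> x \<otimes>\<^bsub>N\<^esub> y) \<le> norm2 N y" if y: "y \<in> op_ball N 1" for y
    proof -
      \<comment> \<open>A real supremum bounds its members only if the set is bounded above; without
        this, the value 0 would say nothing about a single \<open>y\<close>.\<close>
      have "bdd_above ((\<lambda>y. max 0 (norm2 N (\<rho> x \<otimes>\<^bsub>N\<^esub> y) - norm2 N y)) ` op_ball N 1)"
      proof (rule bdd_aboveI2)
        fix y assume y: "y \<in> op_ball N 1"
        have "norm2 N (\<rho> x \<otimes>\<^bsub>N\<^esub> y) \<le> opnorm N (\<rho> x) * norm2 N y"
          using N'.norm2_mult_le[OF rx op_ball_carrier[OF y]] .
        also have "\<dots> \<le> opnorm N (\<rho> x) * 1"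
          using N'.norm2_le_opnorm[OF op_ball_carrier[OF y]] y N.opnorm_nonneg[OF rx]
          by (intro mult_left_mono) (auto simp: op_ball_def)
        finally show "max 0 (norm2 N (\<rho> x \<otimes>\<^bsub>N\<^esub> y) - norm2 N y) \<le> opnorm N (\<rho> x)"
          using N'.norm2_nonneg[OF op_ball_carrier[OF y]] N.opnorm_nonneg[OF rx] by simp
      qed
      from cSUP_upper[OF y this] 0 show ?thesis by simp
    qed
    have "opnorm N (\<rho> x) \<le> 1"
    proof (rule N'.opnorm_le_1_of_norm2[OF N'.faithful rx])
      fix a assume a: "a \<in> carrier N"
      \<comment> \<open>Scales \<open>a\<close> into the unit ball; the added 1 avoids a case
        distinction for \<open>a\<close> of norm 0.\<close>
      define r where "r = 1 / (opnorm N a + 1)"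
      have r: "r > 0" "r * opnorm N a \<le> 1" using N.opnorm_nonneg[OF a] by (auto simp: r_def field_simps)
      have "of_real r \<odot>\<^bsub>N\<^esub> a \<in> op_ball N 1" using a r by (simp add: op_ball_def N.opnorm_smult)
      from le1[OF this] a rx r(1) show "norm2 N (\<rho> x \<otimes>\<^bsub>N\<^esub> a) \<le> norm2 N a"
        by (simp add: N.smult_mult_right N'.norm2_smult)
    qed auto
    then show ?thesis using rx by (simp add: op_ball_def)
  qed
qed

lemma elementary_map_state:
  assumes el: "elementary_map T M N \<rho>" and s: "range s \<subseteq> carrier M"
  shows "state N (poly_val N (\<rho> \<circ> s) t) = state M (poly_val M s t)"
proof -
  have "interp T N (\<rho> \<circ> s) (ReState t) = interp T M s (ReState t)"
    "interp T N (\<rho> \<circ> s) (ImState t) = interp T M s (ImState t)"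
    using el s unfolding elementary_map_def by (metis is_formula.simps)+
  then show ?thesis by (simp add: complex_eq_iff)
qed

text \<open>The relation \<open>R\<close> in the proof pairs the values of one and the same
  *-polynomial in both models. It is compatible with the operations, and states agree across it, so
  each word is matched with its counterpart by inductions on polynomials and words.\<close>

lemma elementary_map_freely_independent:
  assumes M: "is_model T M" and N: "is_model T N" and el: "elementary_map T M N \<rho>"
    and x: "x \<in> carrier M" and y: "y \<in> carrier M" and free: "freely_independent M x y"
  shows "freely_independent N (\<rho> x) (\<rho> y)"
proof -
  interpret M: cstar_probability_space M using is_model_cstar_probability_space[OF M] .
  interpret N: cstar_probability_space N using is_model_cstar_probability_space[OF N] .
  define s where "s j = (if j = 0 then x else y)" for j :: nat
  have s: "range s \<subseteq> carrier M" using x y by (auto simp: s_def)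
  have r: "\<rho> x \<in> carrier N" "\<rho> y \<in> carrier N" using el x y by (auto simp: elementary_map_def)
  define R where "R = {(poly_val M s t, poly_val N (\<rho> \<circ> s) t) |t. True}"
  have R: "state N b = state M a" if "(a, b) \<in> R" for a b
    using that elementary_map_state[OF el s] by (auto simp: R_def)
  have const: "(c \<odot>\<^bsub>M\<^esub> \<one>\<^bsub>M\<^esub>, c \<odot>\<^bsub>N\<^esub> \<one>\<^bsub>N\<^esub>) \<in> R" for c
    unfolding R_def by (rule CollectI, rule exI[of _ "PConst c"]) simp
  have var: "(if i then y else x, if i then \<rho> y else \<rho> x) \<in> R" for i
    unfolding R_def by (rule CollectI, rule exI[of _ "PVar (if i then 1 else 0)"]) (simp add: s_def)
  have add: "(a \<oplus>\<^bsub>M\<^esub> a', b \<oplus>\<^bsub>N\<^esub> b') \<in> R" if "(a, b) \<in> R" "(a', b') \<in> R" for a a' b b'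
    using that unfolding R_def by clarsimp (metis poly_val.simps(3))
  have mult: "(a \<otimes>\<^bsub>M\<^esub> a', b \<otimes>\<^bsub>N\<^esub> b') \<in> R" if "(a, b) \<in> R" "(a', b') \<in> R" for a a' b b'
    using that unfolding R_def by clarsimp (metis poly_val.simps(4))
  have p: "(poly_ev M (if i then y else x) p, poly_ev N (if i then \<rho> y else \<rho> x) p) \<in> R" for i p
  proof (induction p)
    case 0
    show ?case using const[of 0] by simp
  next
    case (pCons c p)
    have "(if i then y else x) \<in> carrier M" "(if i then \<rho> y else \<rho> x) \<in> carrier N" using x y r by auto
    then show ?case using add[OF const mult[OF var pCons.IH]] by (simp only: M.poly_ev_pCons N.poly_ev_pCons)
  qed
  have w: "(word_ev M x y w, word_ev N (\<rho> x) (\<rho> y) w) \<in> R" for w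
    using const[of 1] mult[OF p] by (induction w) auto
  show ?thesis using free unfolding freely_independent_iff R[OF p] R[OF w] .
qed

lemma elementary_map_model_dist:
  assumes M: "is_model T M" and N: "is_model T N" and el: "elementary_map T M N \<rho>"
    and x: "x \<in> carrier M" and y: "y \<in> carrier M"
  shows "model_dist T N (\<rho> x) (\<rho> y) = model_dist T M x y"
proof -
  interpret M: cstar_probability_space M using is_model_cstar_probability_space[OF M] .
  interpret N: cstar_probability_space N using is_model_cstar_probability_space[OF N] .
  define s where "s j = (if j = 0 then x else y)" for j :: nat
  have s: "range s \<subseteq> carrier M" using x y by (auto simp: s_def)
  have r: "\<rho> x \<in> carrier N" "\<rho> y \<in> carrier N" using el x y by (auto simp: elementary_map_def)
  define t where "t = PAdd (PVar 0) (PMult (PConst (-1)) (PVar 1))"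
  have "poly_val M s t = x \<ominus>\<^bsub>M\<^esub> y" "poly_val N (\<rho> \<circ> s) t = \<rho> x \<ominus>\<^bsub>N\<^esub> \<rho> y"
    using x y r by (simp_all add: t_def s_def M.smult_mult_left M.minus_eq_smult N.smult_mult_left N.minus_eq_smult)
  moreover have "interp T N (\<rho> \<circ> s) (NormOf t) = interp T M s (NormOf t)"
    using el s unfolding elementary_map_def by (metis is_formula.simps(6))
  ultimately show ?thesis using x y r by (simp add: model_dist_def dist_on_def)
qed

theorem T_functor_free_pairs: "T_functor T 2 free_pairs"
  unfolding T_functor_def
proof (intro conjI allI impI ballI, goal_cases)
  case (2 M)
  then show ?case by (rule closedin_free_pairs)
next
  case (3 M N \<rho> a)
  then show ?case using elementary_map_freely_independent[of T M N \<rho>] elementary_map_op_ball[of T M N \<rho>]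
    by (fastforce simp: free_pairs_def dest: op_ball_carrier)
next
  case (4 M N \<rho> a b)
  then show ?case using elementary_map_model_dist[of T M N \<rho>]
    by (auto simp: free_pairs_def tuple_dist_2 dest!: op_ball_carrier)
qed simp

section \<open>Atomic commutative models\<close>

text \<open>Representing functions on \<open>I\<close> inside functions on all of \<open>nat\<close>
  gives the algebras of different index sets one ambient type, and restriction to a smaller index
  set becomes truncation.\<close>

definition supported_on :: "nat set \<Rightarrow> (nat \<Rightarrow> complex) \<Rightarrow> bool" where
  "supported_on I f \<longleftrightarrow> (\<forall>i. i \<notin> I \<longrightarrow> f i = 0)"

definition bounded_funs :: "nat set \<Rightarrow> (nat \<Rightarrow> complex) set" where
  "bounded_funs I = {f. supported_on I f \<and> (\<exists>B. \<forall>i. cmod (f i) \<le> B)}"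

definition sup_norm :: "(nat \<Rightarrow> complex) \<Rightarrow> real" where
  "sup_norm f = (SUP i. cmod (f i))"

text \<open>The algebra \<open>l\<^sup>\<infinity>(I)\<close>. Models must have their carrier in the given type, hence the encoding \<open>e\<close>.\<close>

definition atomic_algebra :: "((nat \<Rightarrow> complex) \<Rightarrow> 'a) \<Rightarrow> nat set \<Rightarrow> (nat \<Rightarrow> real) \<Rightarrow> 'a ncps" where
  "atomic_algebra e I w =
    \<lparr>carrier = e ` bounded_funs I,
     mult = (\<lambda>x y. e (\<lambda>i. inv_into UNIV e x i * inv_into UNIV e y i)),
     one = e (\<lambda>i. if i \<in> I then 1 else 0),
     zero = e (\<lambda>_. 0),
     add = (\<lambda>x y. e (\<lambda>i. inv_into UNIV e x i + inv_into UNIV e y i)),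
     smult = (\<lambda>c x. e (\<lambda>i. c * inv_into UNIV e x i)),
     adj = (\<lambda>x. e (\<lambda>i. cnj (inv_into UNIV e x i))),
     opnorm = (\<lambda>x. sup_norm (inv_into UNIV e x)),
     state = (\<lambda>x. \<Sum>i. w i * inv_into UNIV e x i)\<rparr>"

lemma bounded_funsE:
  assumes "f \<in> bounded_funs I" obtains B where "supported_on I f" "B > 0" "\<And>i. cmod (f i) \<le> B"
proof -
  obtain B where B: "supported_on I f" "\<And>i. cmod (f i) \<le> B"
    using assms by (auto simp: bounded_funs_def)
  have "cmod (f i) \<le> \<bar>B\<bar> + 1" for i using B(2)[of i] by linarith
  then show thesis using that[of "\<bar>B\<bar> + 1"] B(1) by simp
qed

lemma bounded_funsI: "supported_on I f \<Longrightarrow> (\<And>i. cmod (f i) \<le> B) \<Longrightarrow> f \<in> bounded_funs I"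
  by (auto simp: bounded_funs_def)

lemma bounded_funs_zero: "f \<in> bounded_funs I \<Longrightarrow> i \<notin> I \<Longrightarrow> f i = 0"
  by (simp add: bounded_funs_def supported_on_def)

lemma bounded_funs_closed:
  assumes f: "f \<in> bounded_funs I"
  shows "(\<lambda>i. cnj (f i)) \<in> bounded_funs I" "(\<lambda>i. c * f i) \<in> bounded_funs I"
    "g \<in> bounded_funs I \<Longrightarrow> (\<lambda>i. f i + g i) \<in> bounded_funs I"
    "g \<in> bounded_funs I \<Longrightarrow> (\<lambda>i. f i - g i) \<in> bounded_funs I"
    "g \<in> bounded_funs I \<Longrightarrow> (\<lambda>i. f i * g i) \<in> bounded_funs I"
proof -
  obtain B where B: "supported_on I f" "B > 0" "\<And>i. cmod (f i) \<le> B" using bounded_funsE[OF f] by metis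
  show "(\<lambda>i. cnj (f i)) \<in> bounded_funs I" using B by (intro bounded_funsI[of _ _ B]) (auto simp: supported_on_def)
  show "(\<lambda>i. c * f i) \<in> bounded_funs I" using B
    by (intro bounded_funsI[of _ _ "cmod c * B"]) (auto simp: supported_on_def norm_mult mult_left_mono)
  assume g: "g \<in> bounded_funs I"
  obtain C where C: "supported_on I g" "C > 0" "\<And>i. cmod (g i) \<le> C" using bounded_funsE[OF g] by metis
  show "(\<lambda>i. f i + g i) \<in> bounded_funs I" using B C
    by (intro bounded_funsI[of _ _ "B + C"]) (auto simp: supported_on_def intro: norm_triangle_mono)
  show "(\<lambda>i. f i - g i) \<in> bounded_funs I" using B C
    by (intro bounded_funsI[of _ _ "B + C"] order_trans[OF norm_triangle_ineq4] add_mono)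
      (auto simp: supported_on_def)
  show "(\<lambda>i. f i * g i) \<in> bounded_funs I" using B C
    by (intro bounded_funsI[of _ _ "B * C"]) (auto simp: supported_on_def norm_mult less_imp_le intro!: mult_mono)
qed

lemma bounded_funs_const: "(\<lambda>_. 0) \<in> bounded_funs I" "(\<lambda>i. if i \<in> I then c else 0) \<in> bounded_funs I"
  by (rule bounded_funsI[of _ _ "cmod c"]; simp add: supported_on_def)+

lemma sup_norm_upper: "f \<in> bounded_funs I \<Longrightarrow> cmod (f i) \<le> sup_norm f"
  unfolding sup_norm_def by (rule cSUP_upper) (auto elim!: bounded_funsE simp: bdd_above_def)

lemma sup_norm_least: "(\<And>i. cmod (f i) \<le> B) \<Longrightarrow> sup_norm f \<le> B"
  unfolding sup_norm_def by (rule cSUP_least) auto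

lemma sup_norm_nonneg: "f \<in> bounded_funs I \<Longrightarrow> 0 \<le> sup_norm f"
  using sup_norm_upper[of f I 0] norm_ge_zero order_trans by blast

lemma sup_norm_smult:
  assumes "f \<in> bounded_funs I" shows "sup_norm (\<lambda>i. c * f i) = cmod c * sup_norm f"
proof (cases "c = 0")
  case True
  then show ?thesis by (simp add: sup_norm_def)
next
  case False
  show ?thesis
  proof (rule antisym)
    show "sup_norm (\<lambda>i. c * f i) \<le> cmod c * sup_norm f"
      by (rule sup_norm_least) (simp add: norm_mult mult_left_mono sup_norm_upper[OF assms])
    have "cmod (f i) \<le> sup_norm (\<lambda>i. c * f i) / cmod c" for i
      using sup_norm_upper[OF bounded_funs_closed(2)[OF assms, of c], of i] False
      by (simp add: norm_mult field_simps)
    then have "sup_norm f \<le> sup_norm (\<lambda>i. c * f i) / cmod c" by (rule sup_norm_least)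
    then show "cmod c * sup_norm f \<le> sup_norm (\<lambda>i. c * f i)" using False by (simp add: field_simps)
  qed
qed

lemma sup_norm_cstar:
  assumes f: "f \<in> bounded_funs I" shows "sup_norm (\<lambda>i. cnj (f i) * f i) = (sup_norm f)\<^sup>2"
proof (rule antisym)
  show "sup_norm (\<lambda>i. cnj (f i) * f i) \<le> (sup_norm f)\<^sup>2"
    using sup_norm_upper[OF f] by (intro sup_norm_least) (simp add: norm_mult power2_eq_square mult_mono')
  have g: "(\<lambda>i. cnj (f i) * f i) \<in> bounded_funs I" using f by (intro bounded_funs_closed)
  have "cmod (f i) \<le> sqrt (sup_norm (\<lambda>i. cnj (f i) * f i))" for i
    using sup_norm_upper[OF g, of i] by (intro real_le_rsqrt) (simp add: norm_mult power2_eq_square)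
  then have "sup_norm f \<le> sqrt (sup_norm (\<lambda>i. cnj (f i) * f i))" by (rule sup_norm_least)
  then have "(sup_norm f)\<^sup>2 \<le> (sqrt (sup_norm (\<lambda>i. cnj (f i) * f i)))\<^sup>2"
    using sup_norm_nonneg[OF f] by (rule power_mono)
  then show "(sup_norm f)\<^sup>2 \<le> sup_norm (\<lambda>i. cnj (f i) * f i)" using sup_norm_nonneg[OF g] by simp
qed

text \<open>Serves the sup norm and the norm of square summable sequences alike. Coordinates of a
  Cauchy sequence converge, and \<open>Fatou\<close>, lower semicontinuity under pointwise limits,
  recovers both membership and the norm estimate.\<close>

lemma mcomplete_image:
  fixes e :: "(nat \<Rightarrow> complex) \<Rightarrow> 'b"
  assumes e: "inj e" and metric: "Metric_space (e ` F) d"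
    and d: "\<And>f g. f \<in> F \<Longrightarrow> g \<in> F \<Longrightarrow> d (e f) (e g) = N (\<lambda>i. f i - g i)"
    and diff: "\<And>f g. f \<in> F \<Longrightarrow> g \<in> F \<Longrightarrow> (\<lambda>i. f i - g i) \<in> F"
    and component: "\<And>f i. f \<in> F \<Longrightarrow> cmod (f i) \<le> N f"
    and Fatou: "\<And>h g r. (\<And>n. h n \<in> F \<and> N (h n) \<le> r) \<Longrightarrow> (\<And>i. (\<lambda>n. h n i) \<longlonglongrightarrow> g i) \<Longrightarrow> g \<in> F \<and> N g \<le> r"
  shows "Metric_space.mcomplete (e ` F) d"
proof -
  interpret Metric_space "e ` F" d by (rule metric)
  show ?thesis
    unfolding mcomplete_def
  proof (intro allI impI)
    fix \<sigma> assume \<sigma>: "MCauchy \<sigma>"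
    define f where "f n = inv_into UNIV e (\<sigma> n)" for n
    have f: "\<sigma> n = e (f n)" "f n \<in> F" for n
    proof -
      have "\<sigma> n \<in> e ` F" using \<sigma> unfolding MCauchy_def by auto
      then show "\<sigma> n = e (f n)" "f n \<in> F" using e by (auto simp: f_def)
    qed
    have C: "\<exists>n0. \<forall>m\<ge>n0. \<forall>n\<ge>n0. N (\<lambda>i. f m i - f n i) < r" if "r > 0" for r
      using conjunct2[OF \<sigma>[unfolded MCauchy_def]] that unfolding f(1) d[OF f(2) f(2)] by metis
    have "Cauchy (\<lambda>n. f n i)" for i
    proof (rule CauchyI)
      fix r :: real assume "r > 0"
      then obtain n0 where "\<forall>m\<ge>n0. \<forall>n\<ge>n0. N (\<lambda>i. f m i - f n i) < r" using C by blast
      then have "norm (f m i - f n i) < r" if "m \<ge> n0" "n \<ge> n0" for m n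
        using that by (intro le_less_trans[OF component[OF diff[OF f(2) f(2)]]]) blast
      then show "\<exists>M. \<forall>m\<ge>M. \<forall>n\<ge>M. norm (f m i - f n i) < r" by blast
    qed
    then have conv: "convergent (\<lambda>n. f n i)" for i by (rule Cauchy_convergent)
    define g where "g i = lim (\<lambda>n. f n i)" for i
    have g: "(\<lambda>n. f n i) \<longlonglongrightarrow> g i" for i
      unfolding g_def using conv by (simp add: convergent_LIMSEQ_iff)
    \<comment> \<open>The Cauchy estimate for fixed \<open>m\<close> survives the limit in the other
      index.\<close>
    have tail: "(\<lambda>i. f m i - g i) \<in> F \<and> N (\<lambda>i. f m i - g i) \<le> r"
      if "\<forall>m\<ge>n0. \<forall>n\<ge>n0. N (\<lambda>i. f m i - f n i) < r" "m \<ge> n0" for m n0 r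
    proof (rule Fatou)
      show "(\<lambda>i. f m i - f (n + n0) i) \<in> F \<and> N (\<lambda>i. f m i - f (n + n0) i) \<le> r" for n
        using diff[OF f(2) f(2)] that by (simp add: less_imp_le)
      show "(\<lambda>n. f m i - f (n + n0) i) \<longlonglongrightarrow> f m i - g i" for i
        by (intro tendsto_diff tendsto_const LIMSEQ_ignore_initial_segment g)
    qed
    obtain n0 where "\<forall>m\<ge>n0. \<forall>n\<ge>n0. N (\<lambda>i. f m i - f n i) < 1" using C[of 1] by auto
    then have "(\<lambda>i. f n0 i - g i) \<in> F" using tail by blast
    \<comment> \<open>The limit is \<open>f n0\<close> minus the difference just shown to lie in
      \<open>F\<close>.\<close>
    from diff[OF f(2)[of n0] this] have gF: "g \<in> F" by simp
    have "limitin mtopology \<sigma> (e g) sequentially"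
      unfolding limitin_metric eventually_sequentially
    proof (intro conjI allI impI)
      fix r :: real assume r: "r > 0"
      then obtain n1 where "\<forall>m\<ge>n1. \<forall>n\<ge>n1. N (\<lambda>i. f m i - f n i) < r / 2" using C[of "r / 2"] by auto
      then have "N (\<lambda>i. f n i - g i) < r" if "n \<ge> n1" for n
        using tail[of n1 "r / 2" n] that r by auto
      then show "\<exists>N. \<forall>n\<ge>N. \<sigma> n \<in> e ` F \<and> d (\<sigma> n) (e g) < r" using f gF d[OF f(2) gF] by auto
    qed (use gF in auto)
    then show "\<exists>x. limitin mtopology \<sigma> x sequentially" by blast
  qed
qed

lemma supported_on_limit:
  assumes "\<And>n. supported_on I (h n)" "\<And>i. (\<lambda>n. h n i) \<longlonglongrightarrow> g i" shows "supported_on I g"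
  unfolding supported_on_def
proof (intro allI impI)
  fix i assume "i \<notin> I"
  then have "(\<lambda>n. h n i) = (\<lambda>_. 0)" using assms(1) by (auto simp: supported_on_def)
  then show "g i = 0" using assms(2)[of i] by (simp add: LIMSEQ_const_iff)
qed

lemma cring_complex_ring: "cring complex_ring"
proof (rule cringI)
  show "abelian_group complex_ring"
    by (rule abelian_groupI) (auto intro: exI[of _ "- x" for x] add.left_inverse)
  show "comm_monoid complex_ring" by (rule comm_monoidI) auto
qed (auto simp: distrib_right)

text \<open>Weights may vanish inside \<open>I\<close>, which admits the nonfaithful limit state of
  the C*-case. Positivity on \<open>I\<close> is assumed separately wherever a faithful state is
  wanted.\<close>

locale atomic =
  fixes e :: "(nat \<Rightarrow> complex) \<Rightarrow> 'a" and I :: "nat set" and w :: "nat \<Rightarrow> real"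
  assumes inj_e: "inj e"
    and w_nonneg: "w i \<ge> 0" and w_zero: "i \<notin> I \<Longrightarrow> w i = 0" and w_sums: "w sums 1"
begin

abbreviation "L \<equiv> atomic_algebra e I w"

lemma inv_e [simp]: "inv_into UNIV e (e f) = f"
  using inj_e by simp

lemma e_eq_iff [simp]: "e f = e g \<longleftrightarrow> f = g"
  using inj_e by (simp add: inj_eq)

lemma L_simps [simp]:
  fixes f g :: "nat \<Rightarrow> complex" shows
  "carrier L = e ` bounded_funs I"
  "e f \<otimes>\<^bsub>L\<^esub> e g = e (\<lambda>i. f i * g i)"
  "\<one>\<^bsub>L\<^esub> = e (\<lambda>i. if i \<in> I then 1 else 0)"
  "\<zero>\<^bsub>L\<^esub> = e (\<lambda>_. 0)"
  "e f \<oplus>\<^bsub>L\<^esub> e g = e (\<lambda>i. f i + g i)"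
  "c \<odot>\<^bsub>L\<^esub> e f = e (\<lambda>i. c * f i)"
  "adj L (e f) = e (\<lambda>i. cnj (f i))"
  "opnorm L (e f) = sup_norm f"
  "state L (e f) = (\<Sum>i. w i * f i)"
  by (simp_all add: atomic_algebra_def)

lemma e_in_image [simp]: "e f \<in> e ` F \<longleftrightarrow> f \<in> F"
  by (auto simp: image_iff)

lemma L_abelian_group: "abelian_group L"
proof (rule abelian_groupI)
  fix x assume "x \<in> carrier L"
  then obtain f where f: "x = e f" "f \<in> bounded_funs I" by auto
  show "\<exists>y\<in>carrier L. y \<oplus>\<^bsub>L\<^esub> x = \<zero>\<^bsub>L\<^esub>"
    using bounded_funs_closed(2)[OF f(2), of "-1"]
    by (intro bexI[of _ "e (\<lambda>i. -1 * f i)"]) (auto simp: f)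
qed (auto simp: bounded_funs_closed bounded_funs_const add_ac)

lemma L_unital_complex_algebra: "unital_complex_algebra L"
proof -
  interpret cring complex_ring by (rule cring_complex_ring)
  have "Module.module complex_ring L"
    by (rule moduleI[OF cring_complex_ring L_abelian_group])
      (auto simp: bounded_funs_closed algebra_simps)
  moreover have "Ring.ring L"
  proof (rule ringI[OF L_abelian_group])
    show "monoid L"
      by (rule monoidI)
        (auto simp: bounded_funs_closed bounded_funs_const mult_ac fun_eq_iff bounded_funs_zero)
  qed (auto simp: algebra_simps)
  ultimately show ?thesis
    by (auto simp: unital_complex_algebra_def unital_complex_algebra_axioms_def mult_ac)
qed

lemma L_minus: "f \<in> bounded_funs I \<Longrightarrow> g \<in> bounded_funs I \<Longrightarrow> e f \<ominus>\<^bsub>L\<^esub> e g = e (\<lambda>i. f i - g i)"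
proof -
  assume fg: "f \<in> bounded_funs I" "g \<in> bounded_funs I"
  interpret unital_complex_algebra L by (rule L_unital_complex_algebra)
  have "e f \<ominus>\<^bsub>L\<^esub> e g = e f \<oplus>\<^bsub>L\<^esub> (-1) \<odot>\<^bsub>L\<^esub> e g" by (rule minus_eq_smult) (use fg in simp_all)
  then show ?thesis by simp
qed

lemma sup_norm_eq_0: "f \<in> bounded_funs I \<Longrightarrow> sup_norm f = 0 \<longleftrightarrow> f = (\<lambda>_. 0)"
proof
  assume "f \<in> bounded_funs I" "sup_norm f = 0"
  then have "cmod (f i) \<le> 0" for i using sup_norm_upper[of f I i] by simp
  then show "f = (\<lambda>_. 0)" by (simp add: fun_eq_iff)
qed (simp add: sup_norm_def)

lemma sup_norm_triangle:
  "f \<in> bounded_funs I \<Longrightarrow> g \<in> bounded_funs I \<Longrightarrow> sup_norm (\<lambda>i. f i + g i) \<le> sup_norm f + sup_norm g"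
  by (intro sup_norm_least order_trans[OF norm_triangle_ineq] add_mono sup_norm_upper)

lemma L_Metric_space: "Metric_space (carrier L) (dist_on L (opnorm L))"
proof (rule Metric_space_dist_on)
  interpret unital_complex_algebra L by (rule L_unital_complex_algebra)
  show "Module.module complex_ring L" by (rule module_axioms)
qed (auto simp: sup_norm_nonneg sup_norm_eq_0 sup_norm_triangle sup_norm_smult)

lemma L_complete: "Metric_space.mcomplete (carrier L) (dist_on L (opnorm L))"
  unfolding L_simps(1)
proof (rule mcomplete_image[OF inj_e L_Metric_space[unfolded L_simps(1)]])
  fix f g :: "nat \<Rightarrow> complex" and i
  assume f: "f \<in> bounded_funs I"
  show "cmod (f i) \<le> sup_norm f" by (rule sup_norm_upper[OF f])
  assume g: "g \<in> bounded_funs I"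
  show "dist_on L (opnorm L) (e f) (e g) = sup_norm (\<lambda>i. f i - g i)"
    using f g by (simp add: dist_on_def L_minus)
  show "(\<lambda>i. f i - g i) \<in> bounded_funs I" by (rule bounded_funs_closed(4)[OF f g])
next
  fix h :: "nat \<Rightarrow> nat \<Rightarrow> complex" and g r
  assume h: "\<And>n. h n \<in> bounded_funs I \<and> sup_norm (h n) \<le> r" and lim: "\<And>i. (\<lambda>n. h n i) \<longlonglongrightarrow> g i"
  have "cmod (h n i) \<le> r" for n i using h[of n] sup_norm_upper[of "h n" I i] by linarith
  then have r: "cmod (g i) \<le> r" for i by (intro LIMSEQ_le_const2[OF tendsto_norm[OF lim]]) auto
  have "supported_on I g"
    using h by (intro supported_on_limit[where h = h, OF _ lim]) (simp add: bounded_funs_def)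
  then show "g \<in> bounded_funs I \<and> sup_norm g \<le> r" using r by (auto intro: bounded_funsI sup_norm_least)
qed

lemma L_unital_cstar_algebra: "unital_cstar_algebra L"
proof -
  interpret unital_complex_algebra L by (rule L_unital_complex_algebra)
  show ?thesis
  proof
    show "opnorm L (x \<otimes>\<^bsub>L\<^esub> y) \<le> opnorm L x * opnorm L y" if "x \<in> carrier L" "y \<in> carrier L" for x y
      using that by (auto intro!: sup_norm_least simp: norm_mult mult_mono sup_norm_upper sup_norm_nonneg)
    show "opnorm L (adj L x \<otimes>\<^bsub>L\<^esub> x) = (opnorm L x)\<^sup>2" if "x \<in> carrier L" for x
      using that by (auto simp: sup_norm_cstar)
    show "Metric_space.mcomplete (carrier L) (dist_on L (opnorm L))" by (rule L_complete)
  qed (auto simp: bounded_funs_closed sup_norm_nonneg sup_norm_eq_0 sup_norm_triangle sup_norm_smult mult.commute)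
qed

lemma w_summable: "summable w" "(\<Sum>i. w i) = 1"
  using w_sums by (auto simp: sums_iff)

lemma state_summable:
  assumes "f \<in> bounded_funs I" shows "summable (\<lambda>i. of_real (w i) * f i)"
proof -
  obtain B where B: "\<And>i. cmod (f i) \<le> B" using bounded_funsE[OF assms] by metis
  show ?thesis
  proof (rule summable_comparison_test')
  show "summable (\<lambda>i. w i * B)" using w_summable by (intro summable_mult2)
  show "norm (of_real (w i) * f i) \<le> w i * B" if "i \<ge> 0" for i
    using B[of i] w_nonneg[of i] by (simp add: norm_mult mult_left_mono)
  qed
qed

lemma real_state_summable:
  assumes "f \<in> bounded_funs I" shows "summable (\<lambda>i. w i * (cmod (f i))\<^sup>2)"
    and "(\<Sum>i. of_real (w i) * (cnj (f i) * f i)) = of_real (\<Sum>i. w i * (cmod (f i))\<^sup>2)"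
proof -
  have eq: "of_real (w i) * (cnj (f i) * f i) = of_real (w i * (cmod (f i))\<^sup>2)" for i
    using complex_norm_square[of "f i"] by (simp add: mult.commute)
  have "summable (\<lambda>i. of_real (w i) * (cnj (f i) * f i))"
    using assms by (intro state_summable bounded_funs_closed)
  then have "summable (\<lambda>i. complex_of_real (w i * (cmod (f i))\<^sup>2))" unfolding eq .
  then show s: "summable (\<lambda>i. w i * (cmod (f i))\<^sup>2)" by (rule summable_of_real_iff[THEN iffD1])
  show "(\<Sum>i. of_real (w i) * (cnj (f i) * f i)) = of_real (\<Sum>i. w i * (cmod (f i))\<^sup>2)"
    unfolding eq by (rule suminf_of_real[OF s, symmetric])
qed

lemma L_cstar_probability_space: "cstar_probability_space L"
proof -
  interpret unital_cstar_algebra L by (rule L_unital_cstar_algebra)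
  show ?thesis
  proof
    have "of_real (w i) * (if i \<in> I then 1 else 0) = complex_of_real (w i)" for i
      using w_zero by simp
    then have "(\<Sum>i. of_real (w i) * (if i \<in> I then 1 else 0)) = (\<Sum>i. complex_of_real (w i))"
      by (rule suminf_cong)
    then show "state L \<one>\<^bsub>L\<^esub> = 1"
      using suminf_of_real[OF w_summable(1), where 'a = complex] w_summable(2) by simp
    fix x assume "x \<in> carrier L"
    then obtain f where f: "x = e f" "f \<in> bounded_funs I" by auto
    have "(\<Sum>i. w i * (cmod (f i))\<^sup>2) \<ge> 0"
      using real_state_summable(1)[OF f(2)] w_nonneg by (intro suminf_nonneg) auto
    then show "state L (adj L x \<otimes>\<^bsub>L\<^esub> x) \<in> \<real>\<^sub>\<ge>\<^sub>0"
      using real_state_summable(2)[OF f(2)] by (simp add: f)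
    show "state L (c \<odot>\<^bsub>L\<^esub> x) = c * state L x" for c
      using suminf_mult[OF state_summable[OF f(2)], of c] by (simp add: f mult_ac)
    fix y assume "y \<in> carrier L"
    then obtain g where g: "y = e g" "g \<in> bounded_funs I" by auto
    show "state L (x \<oplus>\<^bsub>L\<^esub> y) = state L x + state L y"
      using suminf_add[OF state_summable[OF f(2)] state_summable[OF g(2)]] by (simp add: f g distrib_left)
  qed
qed

lemma L_norm2: "f \<in> bounded_funs I \<Longrightarrow> norm2 L (e f) = sqrt (\<Sum>i. w i * (cmod (f i))\<^sup>2)"
  by (simp add: norm2_def real_state_summable(2))

end

subsection \<open>The Hilbert space \<open>l\<^sup>2(I)\<close>\<close>

definition square_summable :: "nat set \<Rightarrow> (nat \<Rightarrow> complex) set" where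
  "square_summable I = {u. supported_on I u \<and> summable (\<lambda>i. (cmod (u i))\<^sup>2)}"

definition ell2 :: "((nat \<Rightarrow> complex) \<Rightarrow> 'h) \<Rightarrow> nat set \<Rightarrow> 'h inner_module" where
  "ell2 e I =
    \<lparr>carrier = e ` square_summable I,
     mult = (\<lambda>_ _. e (\<lambda>_. 0)),
     one = e (\<lambda>_. 0),
     zero = e (\<lambda>_. 0),
     add = (\<lambda>x y. e (\<lambda>i. inv_into UNIV e x i + inv_into UNIV e y i)),
     smult = (\<lambda>c x. e (\<lambda>i. c * inv_into UNIV e x i)),
     hinner = (\<lambda>x y. \<Sum>i. inv_into UNIV e x i * cnj (inv_into UNIV e y i))\<rparr>"

lemma square_summable_mult:
  assumes "u \<in> square_summable I" "v \<in> square_summable I"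
  shows "summable (\<lambda>i. u i * cnj (v i))"
proof (rule summable_comparison_test')
  show "summable (\<lambda>i. (cmod (u i))\<^sup>2 + (cmod (v i))\<^sup>2)"
    using assms by (intro summable_add) (auto simp: square_summable_def)
  show "norm (u i * cnj (v i)) \<le> (cmod (u i))\<^sup>2 + (cmod (v i))\<^sup>2" if "i \<ge> 0" for i
  proof -
    have "0 \<le> cmod (u i) * cmod (v i)" by simp
    then show ?thesis using sum_squares_bound[of "cmod (u i)" "cmod (v i)"]
      unfolding norm_mult complex_mod_cnj by linarith
  qed
qed

lemma square_summableI:
  assumes "supported_on I u" "\<And>n. (\<Sum>i<n. (cmod (u i))\<^sup>2) \<le> B"
  shows "u \<in> square_summable I" "(\<Sum>i. (cmod (u i))\<^sup>2) \<le> B"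
proof -
  have s: "summable (\<lambda>i. (cmod (u i))\<^sup>2)"
    by (rule summableI_nonneg_bounded[of _ B]) (use assms(2) in auto)
  then show "u \<in> square_summable I" using assms(1) by (simp add: square_summable_def)
  show "(\<Sum>i. (cmod (u i))\<^sup>2) \<le> B" using s assms(2) by (intro suminf_le_const) auto
qed

lemma square_summableD:
  "u \<in> square_summable I \<Longrightarrow> supported_on I u" "u \<in> square_summable I \<Longrightarrow> summable (\<lambda>i. (cmod (u i))\<^sup>2)"
  "u \<in> square_summable I \<Longrightarrow> i \<notin> I \<Longrightarrow> u i = 0"
  by (auto simp: square_summable_def supported_on_def)

definition ell2_norm :: "(nat \<Rightarrow> complex) \<Rightarrow> real" where
  "ell2_norm u = sqrt (\<Sum>i. (cmod (u i))\<^sup>2)"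

lemma ell2_norm_partial:
  assumes "u \<in> square_summable I" shows "L2_set (\<lambda>i. cmod (u i)) {..<n} \<le> ell2_norm u"
  unfolding L2_set_def ell2_norm_def
  using sum_le_suminf[OF square_summableD(2)[OF assms], of "{..<n}"] by simp

text \<open>Minkowski's inequality for finite sums bounds all partial sums at once, which yields
  both summability and the estimate.\<close>

lemma ell2_norm_add:
  assumes u: "u \<in> square_summable I" and v: "v \<in> square_summable I"
  shows "(\<lambda>i. u i + v i) \<in> square_summable I" "ell2_norm (\<lambda>i. u i + v i) \<le> ell2_norm u + ell2_norm v"
proof -
  have nn: "ell2_norm u \<ge> 0" "ell2_norm v \<ge> 0"
    using square_summableD(2)[OF u] square_summableD(2)[OF v] by (auto simp: ell2_norm_def intro: suminf_nonneg)
  have b: "(\<Sum>i<n. (cmod (u i + v i))\<^sup>2) \<le> (ell2_norm u + ell2_norm v)\<^sup>2" for n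
  proof -
    have "L2_set (\<lambda>i. cmod (u i + v i)) {..<n} \<le> L2_set (\<lambda>i. cmod (u i) + cmod (v i)) {..<n}"
      by (intro L2_set_mono norm_triangle_ineq) auto
    also have "\<dots> \<le> ell2_norm u + ell2_norm v"
      using L2_set_triangle_ineq[of "\<lambda>i. cmod (u i)" "\<lambda>i. cmod (v i)" "{..<n}"]
        ell2_norm_partial[OF u, of n] ell2_norm_partial[OF v, of n] by linarith
    finally have "sqrt (\<Sum>i<n. (cmod (u i + v i))\<^sup>2) \<le> ell2_norm u + ell2_norm v" by (simp add: L2_set_def)
    then show ?thesis by (rule sqrt_le_D)
  qed
  have s: "supported_on I (\<lambda>i. u i + v i)" using square_summableD(3)[OF u] square_summableD(3)[OF v]
    by (simp add: supported_on_def)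
  show "(\<lambda>i. u i + v i) \<in> square_summable I" by (rule square_summableI(1)[OF s b])
  have "(\<Sum>i. (cmod (u i + v i))\<^sup>2) \<le> (ell2_norm u + ell2_norm v)\<^sup>2" by (rule square_summableI(2)[OF s b])
  then show "ell2_norm (\<lambda>i. u i + v i) \<le> ell2_norm u + ell2_norm v"
    unfolding ell2_norm_def[of "\<lambda>i. u i + v i"] using nn real_le_lsqrt by simp
qed

lemma square_summable_bounded_mult:
  assumes f: "f \<in> bounded_funs J" and fB: "\<And>i. cmod (f i) \<le> B" and u: "u \<in> square_summable I"
  shows "(\<lambda>i. f i * u i) \<in> square_summable I" "ell2_norm (\<lambda>i. f i * u i) \<le> B * ell2_norm u"
proof -
  have B: "B \<ge> 0" using fB[of 0] norm_ge_zero order_trans by blast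
  have su: "summable (\<lambda>i. (cmod (u i))\<^sup>2)" by (rule square_summableD[OF u])
  have b: "(\<Sum>i<n. (cmod (f i * u i))\<^sup>2) \<le> B\<^sup>2 * (\<Sum>i. (cmod (u i))\<^sup>2)" for n
  proof -
    have "(\<Sum>i<n. (cmod (f i * u i))\<^sup>2) \<le> (\<Sum>i<n. B\<^sup>2 * (cmod (u i))\<^sup>2)"
      using fB by (intro sum_mono) (simp add: norm_mult power_mult_distrib mult_right_mono power_mono)
    also have "\<dots> \<le> B\<^sup>2 * (\<Sum>i. (cmod (u i))\<^sup>2)"
      unfolding sum_distrib_left[symmetric] using sum_le_suminf[OF su, of "{..<n}"]
      by (intro mult_left_mono) auto
    finally show ?thesis .
  qed
  have s: "supported_on I (\<lambda>i. f i * u i)" using square_summableD(3)[OF u] by (simp add: supported_on_def)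
  show "(\<lambda>i. f i * u i) \<in> square_summable I" by (rule square_summableI(1)[OF s b])
  have "(\<Sum>i. (cmod (f i * u i))\<^sup>2) \<le> B\<^sup>2 * (\<Sum>i. (cmod (u i))\<^sup>2)" by (rule square_summableI(2)[OF s b])
  then show "ell2_norm (\<lambda>i. f i * u i) \<le> B * ell2_norm u"
    unfolding ell2_norm_def using B by (metis real_sqrt_le_mono real_sqrt_mult real_sqrt_unique)
qed

lemma square_summable_smult: "u \<in> square_summable I \<Longrightarrow> (\<lambda>i. c * u i) \<in> square_summable I"
  using square_summable_bounded_mult(1)[of "\<lambda>_. c" UNIV "cmod c"]
  by (auto simp: bounded_funs_def supported_on_def)

lemma square_summable_0 [simp]: "(\<lambda>_. 0) \<in> square_summable I"
  by (simp add: square_summable_def supported_on_def)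

definition unit_fun :: "nat \<Rightarrow> nat \<Rightarrow> complex" where
  "unit_fun j = (\<lambda>i. if i = j then 1 else 0)"

lemma unit_fun_square_summable: "j \<in> I \<Longrightarrow> unit_fun j \<in> square_summable I"
proof -
  have "(\<lambda>i. (cmod (unit_fun j i))\<^sup>2) = (\<lambda>i. if i = j then 1 else 0)" by (auto simp: unit_fun_def)
  moreover assume "j \<in> I"
  ultimately show ?thesis using summable_single[of j "\<lambda>_. 1 :: real"]
    by (auto simp: square_summable_def supported_on_def unit_fun_def)
qed

lemma suminf_unit_fun: "(\<Sum>i. a i * cnj (unit_fun j i)) = a j" "(\<Sum>i. unit_fun j i * a i) = a j"
proof -
  have "(\<Sum>i. a i * cnj (unit_fun j i)) = (\<Sum>i\<in>{j}. a i * cnj (unit_fun j i))"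
    by (rule suminf_finite) (auto simp: unit_fun_def)
  then show "(\<Sum>i. a i * cnj (unit_fun j i)) = a j" by (simp add: unit_fun_def)
  have "(\<Sum>i. unit_fun j i * a i) = (\<Sum>i\<in>{j}. unit_fun j i * a i)"
    by (rule suminf_finite) (auto simp: unit_fun_def)
  then show "(\<Sum>i. unit_fun j i * a i) = a j" by (simp add: unit_fun_def)
qed

locale ell2_space =
  fixes e :: "(nat \<Rightarrow> complex) \<Rightarrow> 'h" and I :: "nat set"
  assumes inj_e: "inj e"
begin

abbreviation "H \<equiv> ell2 e I"

lemma inv_e [simp]: "inv_into UNIV e (e f) = f"
  using inj_e by simp

lemma e_eq_iff [simp]: "e f = e g \<longleftrightarrow> f = g"
  using inj_e by (simp add: inj_eq)

lemma e_in_image [simp]: "e f \<in> e ` F \<longleftrightarrow> f \<in> F"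
  by (auto simp: image_iff)

lemma H_simps [simp]:
  fixes u v :: "nat \<Rightarrow> complex" shows
  "carrier H = e ` square_summable I"
  "\<zero>\<^bsub>H\<^esub> = e (\<lambda>_. 0)"
  "e u \<oplus>\<^bsub>H\<^esub> e v = e (\<lambda>i. u i + v i)"
  "c \<odot>\<^bsub>H\<^esub> e u = e (\<lambda>i. c * u i)"
  "hinner H (e u) (e v) = (\<Sum>i. u i * cnj (v i))"
  by (simp_all add: ell2_def)

lemma H_abelian_group: "abelian_group H"
proof (rule abelian_groupI)
  fix x assume "x \<in> carrier H"
  then obtain u where u: "x = e u" "u \<in> square_summable I" by auto
  show "\<exists>y\<in>carrier H. y \<oplus>\<^bsub>H\<^esub> x = \<zero>\<^bsub>H\<^esub>"
    using square_summable_smult[OF u(2), of "-1"]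
    by (intro bexI[of _ "e (\<lambda>i. -1 * u i)"]) (auto simp: u)
qed (auto simp: ell2_norm_add add_ac)

lemma H_module: "Module.module complex_ring H"
  by (rule moduleI[OF cring_complex_ring H_abelian_group])
    (auto simp: square_summable_smult algebra_simps)

lemma H_hnorm:
  assumes "u \<in> square_summable I" shows "hinner H (e u) (e u) = of_real ((ell2_norm u)\<^sup>2)" "hnorm H (e u) = ell2_norm u"
proof -
  have s: "summable (\<lambda>i. (cmod (u i))\<^sup>2)" by (rule square_summableD[OF assms])
  then have nn: "(\<Sum>i. (cmod (u i))\<^sup>2) \<ge> 0" by (intro suminf_nonneg) auto
  have eq: "u i * cnj (u i) = of_real ((cmod (u i))\<^sup>2)" for i by (rule complex_norm_square[symmetric])
  show "hinner H (e u) (e u) = of_real ((ell2_norm u)\<^sup>2)"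
    unfolding H_simps eq suminf_of_real[OF s, symmetric] ell2_norm_def using nn by simp
  then show "hnorm H (e u) = ell2_norm u" using nn by (simp add: hnorm_def ell2_norm_def del: H_simps)
qed

lemma ell2_norm_nonneg: "u \<in> square_summable I \<Longrightarrow> ell2_norm u \<ge> 0"
  unfolding ell2_norm_def using square_summableD(2) by (auto intro!: suminf_nonneg)

lemma ell2_norm_component: "u \<in> square_summable I \<Longrightarrow> cmod (u i) \<le> ell2_norm u"
  unfolding ell2_norm_def using sum_le_suminf[OF square_summableD(2), of u I "{i}"] real_le_rsqrt by simp

lemma ell2_norm_eq_0: "u \<in> square_summable I \<Longrightarrow> ell2_norm u = 0 \<longleftrightarrow> u = (\<lambda>_. 0)"
proof
  assume "u \<in> square_summable I" "ell2_norm u = 0"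
  then have "cmod (u i) \<le> 0" for i using ell2_norm_component[of u i] by simp
  then show "u = (\<lambda>_. 0)" by (simp add: fun_eq_iff)
qed (simp add: ell2_norm_def)

lemma ell2_norm_smult: "u \<in> square_summable I \<Longrightarrow> ell2_norm (\<lambda>i. c * u i) = cmod c * ell2_norm u"
  using suminf_mult[OF square_summableD(2), of u I "(cmod c)\<^sup>2"]
  by (simp add: ell2_norm_def norm_mult power_mult_distrib real_sqrt_mult)

lemma H_minus:
  assumes "u \<in> square_summable I" "v \<in> square_summable I"
  shows "e u \<ominus>\<^bsub>H\<^esub> e v = e (\<lambda>i. u i - v i)" "(\<lambda>i. u i - v i) \<in> square_summable I"
proof -
  interpret Module.module complex_ring H by (rule H_module)
  have m: "(\<lambda>i. - v i) \<in> square_summable I" using square_summable_smult[OF assms(2), of "-1"] by simp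
  then have "\<ominus>\<^bsub>H\<^esub> e v = e (\<lambda>i. - v i)" using assms by (intro minus_equality) auto
  then show "e u \<ominus>\<^bsub>H\<^esub> e v = e (\<lambda>i. u i - v i)" by (simp add: a_minus_def)
  show "(\<lambda>i. u i - v i) \<in> square_summable I" using ell2_norm_add(1)[OF assms(1) m] by simp
qed

lemma H_dist:
  assumes "u \<in> square_summable I" "v \<in> square_summable I"
  shows "dist_on H (hnorm H) (e u) (e v) = ell2_norm (\<lambda>i. u i - v i)"
  using assms H_minus[OF assms] by (simp add: dist_on_def H_hnorm)

lemma H_Metric_space: "Metric_space (carrier H) (dist_on H (hnorm H))"
  by (rule Metric_space_dist_on[OF H_module])
    (auto simp: H_hnorm ell2_norm_nonneg ell2_norm_eq_0 ell2_norm_add ell2_norm_smult square_summable_smult)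

lemma H_complete: "Metric_space.mcomplete (carrier H) (dist_on H (hnorm H))"
  unfolding H_simps(1)
proof (rule mcomplete_image[OF inj_e H_Metric_space[unfolded H_simps(1)]])
  fix h :: "nat \<Rightarrow> nat \<Rightarrow> complex" and g r
  assume h: "\<And>n. h n \<in> square_summable I \<and> ell2_norm (h n) \<le> r" and lim: "\<And>i. (\<lambda>n. h n i) \<longlonglongrightarrow> g i"
  have s: "supported_on I g"
    using h by (intro supported_on_limit[where h = h, OF _ lim]) (simp add: square_summable_def)
  have r: "r \<ge> 0" using h[of 0] ell2_norm_nonneg[of "h 0"] by auto
  have b: "(\<Sum>i<k. (cmod (g i))\<^sup>2) \<le> r\<^sup>2" for k
  proof (rule LIMSEQ_le_const2)
    show "(\<lambda>n. \<Sum>i<k. (cmod (h n i))\<^sup>2) \<longlonglongrightarrow> (\<Sum>i<k. (cmod (g i))\<^sup>2)" by (intro tendsto_intros lim)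
    have "sqrt (\<Sum>i<k. (cmod (h n i))\<^sup>2) \<le> r" for n
      using ell2_norm_partial[of "h n" I k] h[of n] by (simp add: L2_set_def)
    then show "\<exists>N. \<forall>n\<ge>N. (\<Sum>i<k. (cmod (h n i))\<^sup>2) \<le> r\<^sup>2" using sqrt_le_D by blast
  qed
  show "g \<in> square_summable I \<and> ell2_norm g \<le> r"
    using square_summableI[OF s b] real_le_lsqrt r by (auto simp: ell2_norm_def)
qed (auto simp: H_dist H_minus ell2_norm_component)

lemma H_hilbert_space: "hilbert_space H"
proof -
  interpret Module.module complex_ring H by (rule H_module)
  show ?thesis
  proof
    fix x y assume "x \<in> carrier H" "y \<in> carrier H"
    then obtain u v where u: "x = e u" "u \<in> square_summable I" and v: "y = e v" "v \<in> square_summable I" by auto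
    show "hinner H y x = cnj (hinner H x y)"
      unfolding u v H_simps
      by (subst bounded_linear.suminf[OF bounded_linear_cnj square_summable_mult[OF u(2) v(2)]])
        (simp add: mult.commute)
    show "hinner H (c \<odot>\<^bsub>H\<^esub> x) y = c * hinner H x y" for c
      using suminf_mult[OF square_summable_mult[OF u(2) v(2)], of c] by (simp add: u v mult.assoc)
    fix z assume "z \<in> carrier H"
    then obtain t where t: "z = e t" "t \<in> square_summable I" by auto
    show "hinner H (x \<oplus>\<^bsub>H\<^esub> y) z = hinner H x z + hinner H y z"
      using suminf_add[OF square_summable_mult[OF u(2) t(2)] square_summable_mult[OF v(2) t(2)]]
      by (simp add: u v t distrib_right)
  next
    fix x assume "x \<in> carrier H"
    then obtain u where u: "x = e u" "u \<in> square_summable I" by auto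
    show "hinner H x x \<in> \<real>\<^sub>\<ge>\<^sub>0" unfolding u(1) H_hnorm[OF u(2)]
      by (subst nonneg_Reals_of_real_iff) simp
    show "hinner H x x = 0 \<longleftrightarrow> x = \<zero>\<^bsub>H\<^esub>"
      unfolding u(1) H_hnorm[OF u(2)] using ell2_norm_eq_0[OF u(2)] by simp
  qed (rule H_complete)
qed

end

subsection \<open>Atomic algebras are tracial von Neumann algebras\<close>

lemma ell2_norm_unit_fun: "ell2_norm (unit_fun j) = 1"
proof -
  have "(\<lambda>i. (cmod (unit_fun j i))\<^sup>2) = (\<lambda>i. if i = j then 1 else 0)" by (auto simp: unit_fun_def)
  then show ?thesis using sums_single[of j "\<lambda>_. 1 :: real"] by (simp add: ell2_norm_def sums_iff)
qed

lemma unit_fun_mult: "(\<lambda>i. unit_fun j i * u i) = (\<lambda>i. u j * unit_fun j i)"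
  by (auto simp: unit_fun_def)

context atomic
begin

text \<open>Hilbert spaces in \<open>von_neumann_algebra\<close> have carriers in
  \<open>'a \<Rightarrow> complex\<close>; a sequence is encoded there as the point mass at its code
  in \<open>'a\<close>.\<close>

definition eh :: "(nat \<Rightarrow> complex) \<Rightarrow> 'a \<Rightarrow> complex" where
  "eh f = (\<lambda>a. if a = e f then 1 else 0)"

sublocale HS: ell2_space eh I
proof
  show "inj eh"
  proof (rule injI)
    fix f g assume "eh f = eh g"
    then have "eh f (e f) = eh g (e f)" by simp
    then show "f = g" by (simp add: eh_def split: if_splits)
  qed
qed

text \<open>The abstraction is restricted to the carrier because \<open>bounded_operators\<close>
  consists of extensional functions.\<close>

definition mult_op :: "'a \<Rightarrow> ('a \<Rightarrow> complex) \<Rightarrow> 'a \<Rightarrow> complex" where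
  "mult_op x = (\<lambda>u\<in>carrier HS.H. eh (\<lambda>i. inv_into UNIV e x i * inv_into UNIV eh u i))"

lemma mult_op_apply: "u \<in> square_summable I \<Longrightarrow> mult_op (e f) (eh u) = eh (\<lambda>i. f i * u i)"
  by (simp add: mult_op_def)

lemma mult_summable:
  assumes "f \<in> bounded_funs I" "u \<in> square_summable I" shows "(\<lambda>i. f i * u i) \<in> square_summable I"
proof -
  obtain B where "\<And>i. cmod (f i) \<le> B" using bounded_funsE[OF assms(1)] by metis
  from square_summable_bounded_mult(1)[OF assms(1) this assms(2)] show ?thesis .
qed

lemma mult_op_bounded: "x \<in> carrier L \<Longrightarrow> mult_op x \<in> bounded_operators HS.H"
proof -
  assume "x \<in> carrier L"
  then obtain f where f: "x = e f" "f \<in> bounded_funs I" by auto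
  obtain B where B: "\<And>i. cmod (f i) \<le> B" using bounded_funsE[OF f(2)] by metis
  have "mult_op x \<in> carrier HS.H \<rightarrow>\<^sub>E carrier HS.H"
    using f(2) by (auto simp: mult_op_def f(1) mult_summable)
  moreover have "hnorm HS.H (mult_op x y) \<le> B * hnorm HS.H y" if "y \<in> carrier HS.H" for y
    using that square_summable_bounded_mult(2)[OF f(2) B]
    by (auto simp: f(1) mult_op_apply HS.H_hnorm mult_summable f(2))
  ultimately show ?thesis
    unfolding bounded_operators_def
  proof (intro CollectI conjI)
    show "\<forall>u\<in>carrier HS.H. \<forall>v\<in>carrier HS.H. mult_op x (u \<oplus>\<^bsub>HS.H\<^esub> v) = mult_op x u \<oplus>\<^bsub>HS.H\<^esub> mult_op x v"
      by (auto simp: f(1) mult_op_apply ell2_norm_add algebra_simps)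
    show "\<forall>c. \<forall>u\<in>carrier HS.H. mult_op x (c \<odot>\<^bsub>HS.H\<^esub> u) = c \<odot>\<^bsub>HS.H\<^esub> mult_op x u"
      by (auto simp: f(1) mult_op_apply square_summable_smult algebra_simps)
  qed blast+
qed

lemma mult_op_faithful: "faithful_representation L HS.H mult_op"
  unfolding faithful_representation_def
proof (intro conjI allI ballI)
  show "mult_op \<in> carrier L \<rightarrow> bounded_operators HS.H" using mult_op_bounded by blast
  show "inj_on mult_op (carrier L)"
  proof (rule inj_onI)
    fix x y assume "x \<in> carrier L" "y \<in> carrier L" and eq: "mult_op x = mult_op y"
    then obtain f g where f: "x = e f" "f \<in> bounded_funs I" and g: "y = e g" "g \<in> bounded_funs I" by auto
    have "f i = g i" for i
    proof (cases "i \<in> I")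
      case True
      have "mult_op x (eh (unit_fun i)) = mult_op y (eh (unit_fun i))" using eq by simp
      then have "(\<lambda>k. f k * unit_fun i k) = (\<lambda>k. g k * unit_fun i k)"
        unfolding f g mult_op_apply[OF unit_fun_square_summable[OF True]] by simp
      then have "f i * unit_fun i i = g i * unit_fun i i" by metis
      then show ?thesis by (simp add: unit_fun_def)
    qed (use f g bounded_funs_zero in metis)
    then show "x = y" by (simp add: f g ext)
  qed
next
  fix u assume "u \<in> carrier HS.H"
  then obtain v where v: "u = eh v" "v \<in> square_summable I" by auto
  have "(\<lambda>i. (if i \<in> I then 1 else 0) * v i) = v" using square_summableD(3)[OF v(2)] by auto
  then show "mult_op \<one>\<^bsub>L\<^esub> u = u" using v by (simp add: mult_op_apply)
qed (auto simp: mult_op_apply bounded_funs_closed mult_summable algebra_simps)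

lemma I_nonempty: "I \<noteq> {}"
proof
  assume "I = {}"
  then have "w = (\<lambda>_. 0)" using w_zero by auto
  then show False using w_sums by (simp add: sums_iff)
qed

text \<open>The equations say that coordinate \<open>j\<close> of \<open>T u\<close> depends only on
  coordinate \<open>j\<close> of \<open>u\<close>. So \<open>T\<close> multiplies by its diagonal
  matrix coefficients, and these are bounded by the operator bound because the unit vectors have
  norm 1.\<close>

lemma bounded_operator_diagonal:
  assumes T: "T \<in> bounded_operators HS.H"
    and diag: "\<And>j u. j \<in> I \<Longrightarrow> u \<in> square_summable I \<Longrightarrow>
      hinner HS.H (T (eh u)) (eh (unit_fun j)) = hinner HS.H (T (eh (\<lambda>i. unit_fun j i * u i))) (eh (unit_fun j))"
  shows "T \<in> mult_op ` carrier L"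
proof -
  define G where "G u = inv_into UNIV eh (T (eh u))" for u
  have ext: "T \<in> carrier HS.H \<rightarrow>\<^sub>E carrier HS.H" using T by (simp add: bounded_operators_def)
  have G: "T (eh u) = eh (G u) \<and> G u \<in> square_summable I" if "u \<in> square_summable I" for u
  proof -
    have "eh u \<in> carrier HS.H" using that by simp
    then have "T (eh u) \<in> carrier HS.H" using ext by (metis PiE_mem)
    then show ?thesis by (auto simp: G_def)
  qed
  define f where "f j = (if j \<in> I then G (unit_fun j) j else 0)" for j
  have Gf: "G u j = f j * u j" if u: "u \<in> square_summable I" for u j
  proof (cases "j \<in> I")
    case True
    have uj: "unit_fun j \<in> square_summable I" using True by (rule unit_fun_square_summable)
    have "T (u j \<odot>\<^bsub>HS.H\<^esub> eh (unit_fun j)) = u j \<odot>\<^bsub>HS.H\<^esub> T (eh (unit_fun j))"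
      using T uj by (simp add: bounded_operators_def del: HS.H_simps(4))
    then have "T (eh (\<lambda>i. unit_fun j i * u i)) = eh (\<lambda>i. u j * G (unit_fun j) i)"
      using G[OF uj] by (simp add: unit_fun_mult)
    then show ?thesis
      using diag[OF True u] G[OF u] True by (simp add: suminf_unit_fun f_def)
  next
    case False
    then show ?thesis using G[OF u] square_summableD(3) u by (metis mult_zero_right)
  qed
  obtain K where K: "\<forall>u\<in>carrier HS.H. hnorm HS.H (T u) \<le> K * hnorm HS.H u"
    using T by (auto simp: bounded_operators_def)
  \<comment> \<open>The maximum serves the indices outside \<open>I\<close>, where \<open>f\<close>
    is 0 and nothing is known about the sign of \<open>K\<close>.\<close>
  have "cmod (f j) \<le> max K 0" for j
  proof (cases "j \<in> I")
    case True
    have uj: "unit_fun j \<in> square_summable I" using True by (rule unit_fun_square_summable)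
    have "cmod (f j) \<le> ell2_norm (G (unit_fun j))"
      using True HS.ell2_norm_component G[OF uj] by (simp add: f_def)
    also have "\<dots> = hnorm HS.H (T (eh (unit_fun j)))" using G[OF uj] by (simp add: HS.H_hnorm(2))
    also have "\<dots> \<le> K" using K uj HS.H_hnorm(2)[OF uj] by (fastforce simp: ell2_norm_unit_fun)
    finally show ?thesis by simp
  qed (simp add: f_def)
  then have fb: "f \<in> bounded_funs I" by (rule bounded_funsI[rotated]) (simp add: supported_on_def f_def)
  have "T = mult_op (e f)"
  proof
    fix u
    show "T u = mult_op (e f) u"
    proof (cases "u \<in> carrier HS.H")
      case True
      then obtain v where v: "u = eh v" "v \<in> square_summable I" by auto
      have "G v = (\<lambda>i. f i * v i)" using Gf[OF v(2)] by blast
      then show ?thesis using G[OF v(2)] by (simp add: v mult_op_apply)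
    next
      case False
      then show ?thesis using ext by (auto simp: mult_op_def PiE_def extensional_def)
    qed
  qed
  then show ?thesis using fb by auto
qed

text \<open>The equations that characterise diagonal operators compare matrix coefficients, which
  are continuous in the weak operator topology. The multiplication operators are thus an
  intersection of closed sets.\<close>

lemma closedin_mult_op: "closedin (weak_operator_topology HS.H) (mult_op ` carrier L)"
proof -
  let ?X = "weak_operator_topology HS.H"
  let ?P = "product_topology (\<lambda>_. euclidean :: complex topology) (carrier HS.H \<times> carrier HS.H)"
  let ?f = "\<lambda>T. \<lambda>(u, v)\<in>carrier HS.H \<times> carrier HS.H. hinner HS.H (T u) v"
  have top: "topspace ?X = bounded_operators HS.H"
    unfolding weak_operator_topology_def topspace_pullback_topology by auto
  have cont: "continuous_map ?X euclidean (\<lambda>T. hinner HS.H (T u) v)"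
    if "u \<in> carrier HS.H" "v \<in> carrier HS.H" for u v
  proof -
    have "continuous_map ?P euclidean (\<lambda>h. h (u, v))"
      using that by (intro continuous_map_product_projection) auto
    then have "continuous_map ?X euclidean ((\<lambda>h. h (u, v)) \<circ> ?f)"
      unfolding weak_operator_topology_def by (rule continuous_map_pullback)
    then show ?thesis using that by (simp add: o_def)
  qed
  define S where "S = (\<lambda>(j, u). {T \<in> topspace ?X. hinner HS.H (T (eh u)) (eh (unit_fun j)) =
      hinner HS.H (T (eh (\<lambda>i. unit_fun j i * u i))) (eh (unit_fun j))})"
  have cl: "closedin ?X (S p)" if "p \<in> I \<times> square_summable I" for p
  proof -
    from that obtain j u where p: "p = (j, u)" "j \<in> I" "u \<in> square_summable I" by (rule SigmaE)
    show ?thesis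
      unfolding S_def p(1) case_prod_conv
      by (rule closedin_continuous_maps_eq[OF Hausdorff_space_euclidean])
        (use p in \<open>auto intro!: cont simp: unit_fun_square_summable unit_fun_mult square_summable_smult
            simp del: HS.H_simps(5)\<close>)
  qed
  have "mult_op ` carrier L = (\<Inter>p\<in>I \<times> square_summable I. S p)"
  proof
    show "mult_op ` carrier L \<subseteq> (\<Inter>p\<in>I \<times> square_summable I. S p)"
    proof
      fix T assume "T \<in> mult_op ` carrier L"
      then obtain f where f: "T = mult_op (e f)" "f \<in> bounded_funs I" by auto
      have "T \<in> bounded_operators HS.H" unfolding f(1) by (rule mult_op_bounded) (use f in simp)
      moreover have "hinner HS.H (T (eh u)) (eh (unit_fun j)) =
          hinner HS.H (T (eh (\<lambda>i. unit_fun j i * u i))) (eh (unit_fun j))"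
        if "j \<in> I" "u \<in> square_summable I" for j u
      proof -
        have "(\<lambda>i. unit_fun j i * u i) \<in> square_summable I"
          unfolding unit_fun_mult by (intro square_summable_smult unit_fun_square_summable that)
        then show ?thesis
          unfolding f(1) using that by (simp add: mult_op_apply suminf_unit_fun) (simp add: unit_fun_def)
      qed
      ultimately show "T \<in> (\<Inter>p\<in>I \<times> square_summable I. S p)" unfolding S_def top by auto
    qed
    show "(\<Inter>p\<in>I \<times> square_summable I. S p) \<subseteq> mult_op ` carrier L"
    proof
      fix T assume T: "T \<in> (\<Inter>p\<in>I \<times> square_summable I. S p)"
      obtain i where i: "i \<in> I" using I_nonempty by auto
      \<comment> \<open>Membership in any one set of the family shows that \<open>T\<close> is a
        bounded operator; an index is available because \<open>I\<close> is nonempty.\<close>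
      have "T \<in> S (i, \<lambda>_. 0)" using T i square_summable_0 by blast
      then have "T \<in> bounded_operators HS.H" by (simp add: S_def top)
      then show "T \<in> mult_op ` carrier L"
      proof (rule bounded_operator_diagonal)
        fix j u assume "j \<in> I" "u \<in> square_summable I"
        then have "T \<in> S (j, u)" using T by blast
        then show "hinner HS.H (T (eh u)) (eh (unit_fun j)) =
          hinner HS.H (T (eh (\<lambda>i. unit_fun j i * u i))) (eh (unit_fun j))" unfolding S_def by simp
      qed
    qed
  qed
  moreover have "closedin ?X (\<Inter>p\<in>I \<times> square_summable I. S p)"
  proof (rule closedin_INT)
    show "I \<times> square_summable I \<noteq> {}" using I_nonempty square_summable_0 by blast
  qed (rule cl)
  ultimately show ?thesis by simp
qed

lemma L_von_neumann_algebra: "von_neumann_algebra L"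
  unfolding von_neumann_algebra_def
  using L_unital_cstar_algebra HS.H_hilbert_space mult_op_faithful closedin_mult_op by blast

lemma L_self_adjoint: "e f \<in> self_adjoints L \<longleftrightarrow> f \<in> bounded_funs I \<and> (\<forall>i. Im (f i) = 0)"
  by (auto simp: self_adjoints_def fun_eq_iff complex_eq_iff)

lemma L_op_le:
  assumes f: "e f \<in> self_adjoints L" and g: "e g \<in> self_adjoints L"
  shows "op_le L (e f) (e g) \<longleftrightarrow> (\<forall>i. Re (f i) \<le> Re (g i))"
proof
  have fg: "f \<in> bounded_funs I" "g \<in> bounded_funs I" "\<And>i. Im (f i) = 0" "\<And>i. Im (g i) = 0"
    using f g unfolding L_self_adjoint by auto
  {
    assume "op_le L (e f) (e g)"
    then obtain c where c: "e g \<ominus>\<^bsub>L\<^esub> e f = e (\<lambda>i. cnj (c i) * c i)" by (auto simp: op_le_def)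
    have "g i - f i = cnj (c i) * c i" for i using c fg by (simp add: L_minus fun_eq_iff)
    then have "Re (g i - f i) \<ge> 0" for i by simp
    then show "\<forall>i. Re (f i) \<le> Re (g i)" by simp
  next
    assume le: "\<forall>i. Re (f i) \<le> Re (g i)"
    obtain B where B: "\<And>i. cmod (g i - f i) \<le> B" using bounded_funsE[OF bounded_funs_closed(4)[OF fg(2,1)]] by metis
    define c where "c i = complex_of_real (sqrt (Re (g i) - Re (f i)))" for i
    have "c \<in> bounded_funs I"
    proof (rule bounded_funsI)
      show "supported_on I c" using fg bounded_funs_zero[OF fg(1)] bounded_funs_zero[OF fg(2)]
        by (auto simp: supported_on_def c_def)
      show "cmod (c i) \<le> sqrt B" for i
        using le B[of i] complex_Re_le_cmod[of "g i - f i"] by (simp add: c_def)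
    qed
    moreover have "g i - f i = cnj (c i) * c i" for i
      using le fg by (simp add: c_def complex_eq_iff flip: of_real_mult)
    ultimately show "op_le L (e f) (e g)"
      unfolding op_le_def using fg by (intro bexI[of _ "e c"]) (auto simp: L_minus fun_eq_iff)
  }
qed

lemma Re_state:
  assumes "f \<in> bounded_funs I"
  shows "Re (state L (e f)) = (\<Sum>i. w i * Re (f i))" "summable (\<lambda>i. w i * Re (f i))"
  using bounded_linear.suminf[OF bounded_linear_Re state_summable[OF assms]]
    bounded_linear.summable[OF bounded_linear_Re state_summable[OF assms]] by simp_all

text \<open>A least upper bound in \<open>l\<^sup>\<infinity>(I)\<close> is a pointwise supremum; up to a tail of small weight
  it is approximated at finitely many atoms, simultaneously by directedness.\<close>

lemma L_normal_state: "normal_state L"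
  unfolding normal_state_def
proof (intro allI impI, elim conjE)
  fix D s
  assume D: "D \<subseteq> self_adjoints L" "D \<noteq> {}" and dir: "\<forall>x\<in>D. \<forall>y\<in>D. \<exists>z\<in>D. op_le L x z \<and> op_le L y z"
    and lub: "is_op_lub L D s"
  define F where "F = {f. e f \<in> D}"
  have De: "D = e ` F"
    using D(1) by (auto simp: F_def self_adjoints_def image_iff)
  have F: "f \<in> bounded_funs I" "Im (f i) = 0" "e f \<in> self_adjoints L" if "f \<in> F" for f i
    using that D(1) L_self_adjoint[of f] unfolding F_def by blast+
  obtain f0 where f0: "f0 \<in> F" using D(2) De by auto
  have s: "s \<in> self_adjoints L" using lub by (simp add: is_op_lub_def)
  then obtain g where g: "s = e g" by (auto simp: self_adjoints_def)
  have gb: "g \<in> bounded_funs I" "\<And>i. Im (g i) = 0" using s L_self_adjoint[of g] unfolding g by blast+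
  have up: "Re (f i) \<le> Re (g i)" if "f \<in> F" for f i
    using lub that L_op_le[OF F(3)[OF that] s[unfolded g]] by (auto simp: is_op_lub_def De g)
  have bdd: "bdd_above ((\<lambda>f. Re (f i)) ` F)" for i using up by (intro bdd_aboveI2) blast
  define t where "t i = (SUP f\<in>F. Re (f i))" for i
  have t_le: "t i \<le> Re (g i)" for i unfolding t_def using f0 up by (intro cSUP_least) auto
  have le_t: "Re (f i) \<le> t i" if "f \<in> F" for f i unfolding t_def by (rule cSUP_upper[OF that bdd])
  have "(\<lambda>i. of_real (t i)) \<in> bounded_funs I"
  proof -
    obtain B where B: "\<And>i. cmod (f0 i) \<le> B" using bounded_funsE[OF F(1)[OF f0]] by metis
    obtain C where C: "\<And>i. cmod (g i) \<le> C" using bounded_funsE[OF gb(1)] by metis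
    show ?thesis
    proof (rule bounded_funsI)
      show "supported_on I (\<lambda>i. complex_of_real (t i))"
        unfolding supported_on_def
      proof (intro allI impI)
        fix i assume "i \<notin> I"
        then have "f0 i = 0" "g i = 0" using bounded_funs_zero F(1)[OF f0] gb(1) by blast+
        then show "complex_of_real (t i) = 0" using t_le[of i] le_t[OF f0, of i] by simp
      qed
      show "cmod (complex_of_real (t i)) \<le> B + C" for i
        using t_le[of i] le_t[OF f0, of i] B[of i] C[of i] abs_Re_le_cmod[of "f0 i"] abs_Re_le_cmod[of "g i"]
        by simp
    qed
  qed
  then have ts: "e (\<lambda>i. of_real (t i)) \<in> self_adjoints L" by (simp add: L_self_adjoint)
  have "op_le L (e f) (e (\<lambda>i. of_real (t i)))" if "f \<in> F" for f
    using L_op_le[OF F(3)[OF that] ts] le_t[OF that] by simp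
  \<comment> \<open>The pointwise supremum is itself an upper bound inside the algebra, so the least
    upper bound lies below it. Together with \<open>t_le\<close> the two agree at every
    atom.\<close>
  then have "op_le L s (e (\<lambda>i. of_real (t i)))" using lub ts by (auto simp: is_op_lub_def De)
  then have gt: "Re (g i) = t i" for i using L_op_le[OF s[unfolded g] ts] t_le[of i] g by (auto intro: antisym)
  have ub: "\<exists>z\<in>F. \<forall>f\<in>G. \<forall>i. Re (f i) \<le> Re (z i)" if "finite G" "G \<subseteq> F" for G
    using that
  proof (induction G rule: finite_induct)
    case empty
    then show ?case using f0 by auto
  next
    case (insert f G)
    then obtain z where z: "z \<in> F" "\<forall>f\<in>G. \<forall>i. Re (f i) \<le> Re (z i)" by auto
    obtain y where y: "y \<in> D" "op_le L (e f) y" "op_le L (e z) y"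
      using dir insert.prems z(1) De by blast
    then obtain h where h: "y = e h" "h \<in> F" using De by auto
    have fF: "f \<in> F" using insert.prems by simp
    have "\<forall>i. Re (f i) \<le> Re (h i)" "\<forall>i. Re (z i) \<le> Re (h i)"
      using y L_op_le[OF F(3)[OF fF] F(3)[OF h(2)]] L_op_le[OF F(3)[OF z(1)] F(3)[OF h(2)]] by (auto simp: h)
    then have "\<forall>k\<in>insert f G. \<forall>i. Re (k i) \<le> Re (h i)" using z(2) order_trans by blast
    then show ?case using h(2) by blast
  qed
  have upper: "Re (state L (e f)) \<le> Re (state L (e g))" if "f \<in> F" for f
    unfolding Re_state(1)[OF F(1)[OF that]] Re_state(1)[OF gb(1)]
    using up[OF that] w_nonneg by (intro suminf_le mult_left_mono Re_state(2) F(1)[OF that] gb(1))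
  have bddD: "bdd_above ((\<lambda>x. Re (state L x)) ` D)"
    unfolding De image_image using upper by (intro bdd_aboveI2) blast
  show "Re (state L s) = (SUP x\<in>D. Re (state L x))"
  proof (rule antisym)
    show "(SUP x\<in>D. Re (state L x)) \<le> Re (state L s)"
      using D(2) upper De g by (intro cSUP_least) auto
    show "Re (state L s) \<le> (SUP x\<in>D. Re (state L x))"
    proof (rule field_le_epsilon)
      fix r :: real assume r: "r > 0"
      \<comment> \<open>The loss from using the fixed member \<open>f0\<close> in place of
        \<open>g\<close>. Any member above \<open>f0\<close> loses at most this much, so its tail
        controls all but finitely many atoms.\<close>
      define h where "h i = w i * (Re (g i) - Re (f0 i))" for i
      have hs: "summable h"
        unfolding h_def right_diff_distrib by (intro summable_diff Re_state(2) gb(1) F(1)[OF f0])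
      obtain n where n: "\<bar>(\<Sum>i<n. h i) - suminf h\<bar> < r / 2"
        using summable_LIMSEQ[OF hs] r unfolding LIMSEQ_iff by (metis half_gt_zero order_refl real_norm_def)
      have "\<exists>f\<in>F. Re (g i) - r / 2 < Re (f i)" for i
        using less_cSUP_iff[OF _ bdd[of i], of "Re (g i) - r / 2"] f0 r gt[of i] unfolding t_def by auto
      then obtain a where a: "\<And>i. a i \<in> F" "\<And>i. Re (g i) - r / 2 < Re (a i i)" by metis
      obtain z where z: "z \<in> F" "\<forall>f\<in>insert f0 (a ` {..<n}). \<forall>i. Re (f i) \<le> Re (z i)"
        using ub[of "insert f0 (a ` {..<n})"] f0 a(1) by auto
      \<comment> \<open>A summable majorant of the loss of \<open>z\<close>: a share of
        \<open>r / 2\<close> at every atom, and the loss of \<open>f0\<close> only from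
        \<open>n\<close> on.\<close>
      define k where "k i = w i * (r / 2) + (h i - (if i \<in> {..<n} then h i else 0))" for i
      have ks: "k sums (1 * (r / 2) + (suminf h - sum h {..<n}))"
        unfolding k_def by (intro sums_add sums_mult2 sums_diff w_sums summable_sums[OF hs] sums_If_finite_set) simp
      have "w i * Re (g i) - w i * Re (z i) \<le> k i" for i
      proof (cases "i < n")
        case True
        then have "Re (a i i) \<le> Re (z i)" using z(2) by simp
        then have "Re (g i) - Re (z i) \<le> r / 2" using a(2)[of i] by linarith
        then show ?thesis using mult_left_mono[OF _ w_nonneg[of i]] True by (fastforce simp: k_def right_diff_distrib)
      next
        case False
        have "w i * Re (f0 i) \<le> w i * Re (z i)" using z(2) w_nonneg[of i] by (intro mult_left_mono) auto
        moreover have "0 \<le> w i * (r / 2)" using r w_nonneg[of i] by simp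
        ultimately show ?thesis using False unfolding k_def h_def right_diff_distrib by simp
      qed
      then have "(\<Sum>i. w i * Re (g i) - w i * Re (z i)) \<le> suminf k"
        using ks by (intro suminf_le summable_diff Re_state(2) gb(1) F(1)[OF z(1)]) (auto simp: sums_iff)
      also have "suminf k = r / 2 + (suminf h - sum h {..<n})" using ks by (simp add: sums_iff)
      also have "\<dots> \<le> r" using n by linarith
      finally have "Re (state L s) \<le> Re (state L (e z)) + r"
        unfolding g Re_state(1)[OF gb(1)] Re_state(1)[OF F(1)[OF z(1)]]
        using suminf_diff[OF Re_state(2)[OF gb(1)] Re_state(2)[OF F(1)[OF z(1)]]] by simp
      also have "Re (state L (e z)) \<le> (SUP x\<in>D. Re (state L x))"
        using z(1) De by (intro cSUP_upper[OF _ bddD]) auto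
      finally show "Re (state L s) \<le> (SUP x\<in>D. Re (state L x)) + r" by simp
    qed
  qed
qed

lemma L_tracial_von_neumann_algebra:
  assumes pos: "\<And>i. i \<in> I \<Longrightarrow> w i > 0" shows "tracial_von_neumann_algebra L"
proof -
  interpret cstar_probability_space L by (rule L_cstar_probability_space)
  show ?thesis
  proof
    fix x assume "x \<in> carrier L"
    then obtain f where f: "x = e f" "f \<in> bounded_funs I" by auto
    show "x = \<zero>\<^bsub>L\<^esub>" if "state L (adj L x \<otimes>\<^bsub>L\<^esub> x) = 0"
    proof -
      have "(\<Sum>i. w i * (cmod (f i))\<^sup>2) = 0"
        using that real_state_summable(2)[OF f(2)] by (simp add: f)
      then have "\<forall>i. w i * (cmod (f i))\<^sup>2 = 0"
        using suminf_eq_zero_iff[OF real_state_summable(1)[OF f(2)]] w_nonneg by simp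
      then have "w i * (cmod (f i))\<^sup>2 = 0" for i by blast
      then have "f i = 0" for i
        using pos[of i] bounded_funs_zero[OF f(2), of i] by (cases "i \<in> I") force+
      then show ?thesis by (simp add: f ext)
    qed
    show "state L (x \<otimes>\<^bsub>L\<^esub> y) = state L (y \<otimes>\<^bsub>L\<^esub> x)" if "y \<in> carrier L" for y
      using that by (auto simp: f mult.commute)
  qed (rule L_von_neumann_algebra L_normal_state)+
qed

end

section \<open>Packing the unit disc by discs\<close>

text \<open>The change of variables formula is available for \<^typ>\<open>real^2\<close> only, not for
  \<^typ>\<open>complex\<close>.\<close>

definition plane_complex :: "real^2 \<Rightarrow> complex" where
  "plane_complex v = Complex (v $ 1) (v $ 2)"

definition complex_plane :: "complex \<Rightarrow> real^2" where
  "complex_plane z = (\<chi> i. if i = 1 then Re z else Im z)"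

lemma complex_plane_inverse [simp]: "plane_complex (complex_plane z) = z"
  by (simp add: plane_complex_def complex_plane_def)

lemma plane_complex_inverse [simp]: "complex_plane (plane_complex v) = v"
  using exhaust_2 by (auto simp: plane_complex_def complex_plane_def vec_eq_iff)

lemma linear_plane_complex: "linear plane_complex"
  by (rule linearI) (auto simp: plane_complex_def complex_eq_iff)

lemma linear_complex_plane: "linear complex_plane"
  by (rule linearI) (auto simp: complex_plane_def vec_eq_iff)

lemma continuous_on_plane_complex [continuous_intros]:
  "continuous_on S f \<Longrightarrow> continuous_on S (\<lambda>x. plane_complex (f x))"
  using continuous_on_compose2[OF linear_continuous_on[of plane_complex UNIV]] linear_plane_complex
  by (simp add: linear_conv_bounded_linear)

lemma continuous_on_complex_plane [continuous_intros]:
  "continuous_on S f \<Longrightarrow> continuous_on S (\<lambda>x. complex_plane (f x))"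
  using continuous_on_compose2[OF linear_continuous_on[of complex_plane UNIV]] linear_complex_plane
  by (simp add: linear_conv_bounded_linear)

lemma norm_plane_complex [simp]: "cmod (plane_complex v) = norm v"
  by (simp add: plane_complex_def cmod_def norm_vec_def L2_set_def UNIV_2)

lemma norm_complex_plane [simp]: "norm (complex_plane z) = cmod z"
  using norm_plane_complex[of "complex_plane z"] by simp

lemma plane_complex_0 [simp]: "plane_complex 0 = 0"
  using linear_0[OF linear_plane_complex] .

lemma plane_complex_eq_0 [simp]: "plane_complex v = 0 \<longleftrightarrow> v = 0"
  by (metis norm_plane_complex norm_eq_zero)

lemma plane_complex_diff: "plane_complex (v - u) = plane_complex v - plane_complex u"
  using linear_diff[OF linear_plane_complex] .

lemma absolutely_integrable_on_ball:
  fixes f :: "'a::euclidean_space \<Rightarrow> 'b::euclidean_space"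
  assumes "continuous_on UNIV f" shows "f absolutely_integrable_on ball a r"
proof -
  obtain c d where cd: "ball a r \<subseteq> cbox c d"
    using bounded_subset_cbox_symmetric[OF bounded_ball] by blast
  have "f absolutely_integrable_on cbox c d"
    using assms continuous_on_subset by (intro absolutely_integrable_continuous) blast
  then show ?thesis by (rule set_integrable_subset) (use cd in auto)
qed

text \<open>Rotation about \<open>a\<close> by the angle \<open>pi / k\<close> preserves the disc
  and its area but changes the sign of the integrand, since the \<open>k\<close>-th power of the
  rotation factor is -1.\<close>

lemma integral_ball_power_eq_0:
  fixes a :: "real^2"
  assumes k: "k \<ge> 1"
  shows "integral (ball a r) (\<lambda>v. (plane_complex v - plane_complex a) ^ k) = 0"
proof -
  define \<omega> where "\<omega> = cis (pi / k)"
  have \<omega>: "\<omega> ^ k = -1" "cmod \<omega> = 1" "\<omega> \<noteq> 0"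
  proof -
    have "real k * (pi / real k) = pi" using k by simp
    then show "\<omega> ^ k = -1" unfolding \<omega>_def Complex.DeMoivre by (metis cis_pi)
  qed (auto simp: \<omega>_def)
  define f where "f v = complex_plane (\<omega> * plane_complex v)" for v
  have lin: "linear f"
    unfolding f_def
    by (intro linear_compose[OF _ linear_complex_plane, unfolded o_def] linear_compose[OF linear_plane_complex, unfolded o_def])
      (auto intro: linearI simp: distrib_left)
  have orth: "orthogonal_transformation f"
    unfolding orthogonal_transformation using lin by (simp add: f_def norm_mult \<omega>)
  define g where "g v = (a - f a) + f v" for v
  define h where "h v = a + complex_plane (plane_complex (v - a) / \<omega>)" for v
  have g_a: "g v - a = f (v - a)" for v by (simp add: g_def linear_diff[OF lin])
  have hg: "h (g v) = v" for v by (simp add: h_def g_a) (simp add: f_def \<omega>)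
  have gh: "g (h v) = v" for v
  proof -
    have "g (h v) - a = v - a" unfolding g_a by (simp add: h_def f_def \<omega>)
    then show ?thesis by simp
  qed
  have dist: "dist a (g v) = dist a v" for v
  proof -
    have "norm (g v - a) = norm (v - a)" unfolding g_a by (rule orthogonal_transformation_norm[OF orth])
    then show ?thesis unfolding dist_norm norm_minus_commute[of a] .
  qed
  have img: "g ` ball a r = ball a r"
  proof
    show "g ` ball a r \<subseteq> ball a r" by (auto simp: dist)
    have "v \<in> g ` ball a r" if "v \<in> ball a r" for v
      using that dist[of "h v"] gh[of v] by (intro image_eqI[of _ _ "h v"]) auto
    then show "ball a r \<subseteq> g ` ball a r" by blast
  qed
  define F where "F v = complex_plane ((plane_complex v - plane_complex a) ^ k)" for v
  have contF: "continuous_on UNIV F"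
    unfolding F_def
    by (intro continuous_intros)
  have F: "F absolutely_integrable_on ball a r" by (rule absolutely_integrable_on_ball[OF contF])
  have Fg: "F (g v) = - F v" for v
  proof -
    have "plane_complex (g v) - plane_complex a = \<omega> * (plane_complex v - plane_complex a)"
      unfolding plane_complex_diff[symmetric] g_a by (simp add: f_def)
    then show ?thesis
      using linear_neg[OF linear_complex_plane] by (simp add: F_def power_mult_distrib \<omega>)
  qed
  have "(\<lambda>x. \<bar>det (matrix f)\<bar> *\<^sub>R F (g x)) absolutely_integrable_on ball a r \<and>
      integral (ball a r) (\<lambda>x. \<bar>det (matrix f)\<bar> *\<^sub>R F (g x)) = integral (ball a r) F"
  proof (rule has_absolute_integral_change_of_variables_invertible
        [where f = F and g = g and g' = "\<lambda>_. f" and h = h, THEN iffD2])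
    show "(g has_derivative f) (at x within ball a r)" for x
      unfolding g_def using has_derivative_add[OF has_derivative_const linear_imp_has_derivative[OF lin]]
      by simp
    show "continuous_on (g ` ball a r) h"
      unfolding h_def
      by (intro continuous_intros) (simp add: \<omega>)
    show "F absolutely_integrable_on g ` ball a r \<and> integral (g ` ball a r) F = integral (ball a r) F"
      using F img by simp
  qed (use hg in auto)
  then have "integral (ball a r) (\<lambda>x. - F x) = integral (ball a r) F"
    using orth by (simp add: Fg)
  then have "integral (ball a r) F + integral (ball a r) F = 0"
    unfolding integral_neg by (metis add.left_inverse)
  then have "integral (ball a r) F = 0" by (metis scaleR_2 scaleR_eq_0_iff zero_neq_numeral)
  moreover have "integral (ball a r) (plane_complex \<circ> F) = plane_complex (integral (ball a r) F)"
    using F linear_conv_bounded_linear[THEN iffD1, OF linear_plane_complex]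
    by (intro integral_linear) (auto simp: absolutely_integrable_on_def)
  ultimately show ?thesis by (simp add: F_def o_def)
qed

lemma continuous_on_poly_plane: "continuous_on S (\<lambda>v. poly p (plane_complex v))"
  by (intro continuous_intros)

text \<open>In the Taylor expansion of \<open>p\<close> about the centre, computed by
  \<open>pcompose\<close>, only the constant term survives integration.\<close>

lemma mean_value_poly_ball:
  "(LINT v:ball a r|lebesgue. poly p (plane_complex v)) = measure lebesgue (ball a r) *\<^sub>R poly p (plane_complex a)"
proof -
  define q where "q = pcompose p [:plane_complex a, 1:]"
  have pq: "poly p z = (\<Sum>k\<le>degree q. coeff q k * (z - plane_complex a) ^ k)" for z
  proof -
    have "poly q (z - plane_complex a) = poly p z" by (simp add: q_def poly_pcompose)
    then show ?thesis by (simp add: poly_altdef)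
  qed
  have ai: "(\<lambda>v. coeff q k * (plane_complex v - plane_complex a) ^ k) absolutely_integrable_on ball a r" for k
    by (intro absolutely_integrable_on_ball continuous_intros)
  have t: "(LINT v:ball a r|lebesgue. coeff q k * (plane_complex v - plane_complex a) ^ k) =
      (if k = 0 then measure lebesgue (ball a r) *\<^sub>R coeff q 0 else 0)" for k
  proof (cases "k = 0")
    case True
    have "(LINT v:ball a r|lebesgue. coeff q 0) = measure lebesgue (ball a r) *\<^sub>R coeff q 0"
      using lmeasurable_ball[of a r] by (simp add: set_lebesgue_integral_def fmeasurable_def)
    then show ?thesis using True by simp
  next
    case False
    then have "integral (ball a r) (\<lambda>v. coeff q k * (plane_complex v - plane_complex a) ^ k) = 0"
      using integral_ball_power_eq_0[of k a r] by simp
    then have "(LINT v:ball a r|lebesgue. coeff q k * (plane_complex v - plane_complex a) ^ k) = 0"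
      unfolding set_lebesgue_integral_eq_integral(2)[OF ai] .
    then show ?thesis unfolding if_not_P[OF False] .
  qed
  have "(LINT v:ball a r|lebesgue. poly p (plane_complex v)) =
      (\<Sum>k\<le>degree q. LINT v:ball a r|lebesgue. coeff q k * (plane_complex v - plane_complex a) ^ k)"
    unfolding pq set_lebesgue_integral_def scaleR_sum_right
    by (rule Bochner_Integration.integral_sum) (use ai in \<open>simp add: set_integrable_def\<close>)
  also have "\<dots> = measure lebesgue (ball a r) *\<^sub>R coeff q 0"
    unfolding t by (simp add: sum.delta)
  also have "coeff q 0 = poly p (plane_complex a)"
    by (simp add: q_def poly_pcompose flip: poly_0_coeff_0)
  finally show ?thesis .
qed

text \<open>Vitali's theorem packs the unit disc, up to a null set, by discs with centres \<open>c\<close> other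
  than 0; the weights are their relative areas.\<close>

lemma disc_packing:
  obtains I :: "nat set" and w :: "nat \<Rightarrow> real" and c :: "nat \<Rightarrow> complex"
  where "\<And>i. i \<in> I \<Longrightarrow> w i > 0" "\<And>i. i \<notin> I \<Longrightarrow> w i = 0" "w sums 1"
    "\<And>i. cmod (c i) \<le> 1" "\<And>i. i \<in> I \<longleftrightarrow> c i \<noteq> 0"
    "\<And>p. (\<Sum>i. w i * poly p (c i)) = poly p 0"
proof -
  let ?D = "ball 0 1 :: (real^2) set"
  \<comment> \<open>Without the condition on \<open>a\<close>, the unit disc alone would be a
    packing, and \<open>c\<close> would be scalar. Nonzero centres also let \<open>I\<close> be
    recovered as the support of \<open>c\<close>.\<close>
  define K where "K = {(a :: real^2, r). r > 0 \<and> a \<noteq> 0 \<and> ball a r \<subseteq> ?D}"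
  have "\<exists>i. i \<in> K \<and> x \<in> ball (fst i) (snd i) \<and> snd i < d" if x: "x \<in> ?D - {0}" and d: "d > 0" for x d
  proof -
    define r where "r = min (d / 2) (1 - norm x)"
    have r: "r > 0" "r < d" "r \<le> 1 - norm x" using x d by (auto simp: r_def)
    have "norm y < 1" if "dist x y < r" for y
      using that r(3) norm_triangle_sub[of y x] by (simp add: dist_norm norm_minus_commute)
    then have "(x, r) \<in> K" using x r by (auto simp: K_def)
    then show ?thesis using r by (intro exI[of _ "(x, r)"]) auto
  qed
  from Vitali_covering_theorem_balls[of "?D - {0}" K fst snd, OF this]
  obtain C where C: "countable C" "C \<subseteq> K"
    "pairwise (\<lambda>i j. disjnt (ball (fst i) (snd i)) (ball (fst j) (snd j))) C"
    "negligible (?D - {0} - (\<Union>i\<in>C. ball (fst i) (snd i)))"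
    by blast
  define I where "I = to_nat_on C ` C"
  define z where "z = from_nat_into C"
  have z: "z (to_nat_on C x) = x" if "x \<in> C" for x
    using that C(1) by (simp add: z_def)
  have zI: "z i \<in> C \<and> to_nat_on C (z i) = i" if "i \<in> I" for i
    using that z by (auto simp: I_def)
  define A where "A i = (if i \<in> I then ball (fst (z i)) (snd (z i)) else {})" for i
  define c where "c i = (if i \<in> I then plane_complex (fst (z i)) else 0)" for i
  have disj: "A i \<inter> A j = {}" if "i \<noteq> j" for i j
  proof (cases "i \<in> I \<and> j \<in> I")
    case True
    then have "z i \<noteq> z j" using zI that by metis
    then show ?thesis using True C(3) zI by (auto simp: A_def pairwise_def disjnt_def)
  qed (auto simp: A_def)
  have U: "(\<Union>i. A i) = (\<Union>i\<in>C. ball (fst i) (snd i))"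
  proof
    show "(\<Union>i. A i) \<subseteq> (\<Union>i\<in>C. ball (fst i) (snd i))"
      using zI by (auto simp: A_def split: if_splits)
    show "(\<Union>i\<in>C. ball (fst i) (snd i)) \<subseteq> (\<Union>i. A i)"
    proof
      fix v assume "v \<in> (\<Union>i\<in>C. ball (fst i) (snd i))"
      then obtain x where "x \<in> C" "v \<in> ball (fst x) (snd x)" by blast
      then have "v \<in> A (to_nat_on C x)" using z by (auto simp: A_def I_def)
      then show "v \<in> (\<Union>i. A i)" by blast
    qed
  qed
  have zK: "snd (z i) > 0 \<and> fst (z i) \<noteq> 0 \<and> ball (fst (z i)) (snd (z i)) \<subseteq> ?D" if "i \<in> I" for i
  proof -
    have "z i \<in> K" using zI[OF that] C(2) by blast
    then show ?thesis by (simp add: K_def case_prod_beta)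
  qed
  have UD: "(\<Union>i. A i) \<subseteq> ?D" using zK by (fastforce simp: A_def split: if_splits)
  \<comment> \<open>The covering was stated for the punctured disc; the origin is a null
    set.\<close>
  have "negligible (insert 0 (?D - {0} - (\<Union>i. A i)))" using C(4) U by simp
  then have neg: "negligible (?D - (\<Union>i. A i))" by (rule negligible_subset) auto
  have Am: "A i \<in> sets lebesgue" for i by (simp add: A_def)
  have Um: "(\<Union>i. A i) \<in> sets lebesgue" using Am by auto
  have D: "?D \<in> lmeasurable" by simp
  have mU: "measure lebesgue (\<Union>i. A i) = measure lebesgue ?D"
    by (rule measure_negligible_symdiff[OF D]) (use neg UD in \<open>simp add: Diff_eq_empty_iff[THEN iffD2]\<close>)
  define m where "m = measure lebesgue ?D"
  have m: "m > 0" unfolding m_def by (simp add: content_ball_pos)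
  define w where "w i = measure lebesgue (A i) / m" for i
  have "(\<lambda>i. measure lebesgue (A i)) sums measure lebesgue (\<Union>i. A i)"
  proof (rule measure_UNION)
    show "disjoint_family A" using disj by (auto simp: disjoint_family_on_def)
    show "emeasure lebesgue (\<Union>i. A i) \<noteq> \<infinity>"
      using fmeasurableI2[OF D UD Um] by (auto simp: fmeasurable_def)
  qed (use Am in auto)
  then have ws: "w sums 1"
    using sums_divide[of _ _ m] m mU unfolding w_def m_def by fastforce
  have mv: "(\<Sum>i. w i * poly p (c i)) = poly p 0" for p
  proof -
    have ai: "set_integrable lebesgue ?D (\<lambda>v. poly p (plane_complex v))"
      by (rule absolutely_integrable_on_ball[OF continuous_on_poly_plane])
    have aU: "set_integrable lebesgue (\<Union>i. A i) (\<lambda>v. poly p (plane_complex v))"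
      by (rule set_integrable_subset[OF ai Um UD])
    have "m *\<^sub>R poly p 0 = (LINT v:?D|lebesgue. poly p (plane_complex v))"
      unfolding mean_value_poly_ball m_def by simp
    also have "\<dots> = (LINT v:(\<Union>i. A i)|lebesgue. poly p (plane_complex v))"
    proof (rule set_integral_cong_set[symmetric])
      have "AE v in lebesgue. v \<notin> ?D - (\<Union>i. A i)"
        using neg by (intro AE_not_in) (simp add: negligible_iff_null_sets)
      then show "AE v in lebesgue. v \<in> ?D \<longleftrightarrow> v \<in> (\<Union>i. A i)"
        by (rule eventually_mono) (use UD in blast)
    qed (use ai aU in \<open>auto simp: set_borel_measurable_def set_integrable_def intro: borel_measurable_integrable\<close>)
    also have "\<dots> = (\<Sum>i. LINT v:A i|lebesgue. poly p (plane_complex v))"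
      by (rule lebesgue_integral_countable_add[OF Am disj aU])
    also have "\<dots> = (\<Sum>i. of_real m * (of_real (w i) * poly p (c i)))"
    proof (rule suminf_cong)
      fix i
      show "(LINT v:A i|lebesgue. poly p (plane_complex v)) = of_real m * (of_real (w i) * poly p (c i))"
      proof (cases "i \<in> I")
        case True
        then show ?thesis using m by (simp add: A_def mean_value_poly_ball w_def c_def scaleR_conv_of_real)
      qed (simp add: A_def w_def set_lebesgue_integral_def)
    qed
    also have "\<dots> = of_real m * (\<Sum>i. of_real (w i) * poly p (c i))"
    proof (rule suminf_mult)
      have cont: "continuous_on (cball 0 1) (\<lambda>v. poly p v)" by (intro continuous_intros)
      obtain B where B: "\<And>v. v \<in> cball 0 1 \<Longrightarrow> cmod (poly p v) \<le> B"
        using compact_imp_bounded[OF compact_continuous_image[OF cont compact_cball]]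
        unfolding bounded_iff by (metis imageI)
      have "cmod (of_real (w i) * poly p (c i)) \<le> w i * B" for i
      proof -
        have "cmod (c i) \<le> 1"
        proof (cases "i \<in> I")
          case True
          then have "fst (z i) \<in> ?D" using zK[OF True] centre_in_ball by blast
          then show ?thesis using True by (simp add: c_def)
        qed (simp add: c_def)
        moreover have "w i \<ge> 0" using m by (simp add: w_def)
        ultimately show ?thesis using B[of "c i"] by (simp add: norm_mult mult_left_mono)
      qed
      then show "summable (\<lambda>i. of_real (w i) * poly p (c i))"
        using summable_mult2[OF sums_summable[OF ws], of B] by (rule summable_comparison_test'[rotated])
    qed
    finally show ?thesis using m by (simp add: scaleR_conv_of_real)
  qed
  show thesis
  proof (rule that[of I w c])
    show "w i > 0" if "i \<in> I" for i
      using zK[OF that] m that by (simp add: w_def A_def content_ball_pos)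
    show "cmod (c i) \<le> 1" for i
    proof (cases "i \<in> I")
      case True
      then have "fst (z i) \<in> ?D" using zK[OF True] centre_in_ball by blast
      then show ?thesis using True by (simp add: c_def)
    qed (simp add: c_def)
    show "i \<in> I \<longleftrightarrow> c i \<noteq> 0" for i
      using zK[of i] by (auto simp: c_def)
  qed (use ws mv in \<open>auto simp: w_def A_def\<close>)
qed

section \<open>Convergence of the values of formulas\<close>

text \<open>The metric on sequences weights coordinates by powers of \<open>1/2\<close>; the factor
  2 is the total weight.\<close>

lemma dist_fun_le:
  fixes x y :: "nat \<Rightarrow> real"
  assumes "\<And>i. dist (x i) (y i) \<le> \<eta>" shows "dist x y \<le> 2 * \<eta>"
proof (rule LIMSEQ_le_const)
  show "(\<lambda>n. 2 * \<eta> + (1/2) ^ n) \<longlonglongrightarrow> 2 * \<eta>"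
    using tendsto_add[OF tendsto_const[of "2 * \<eta>"] LIMSEQ_realpow_zero[of "1/2"]] by simp
  have "dist x y \<le> 2 * \<eta> + (1/2) ^ n" for n
  proof -
    have "{dist (x (from_nat k)) (y (from_nat k)) |k. k \<le> n} = (\<lambda>k. dist (x (from_nat k)) (y (from_nat k))) ` {..n}"
      by auto
    then have "Max {dist (x (from_nat k)) (y (from_nat k)) |k. k \<le> n} \<le> \<eta>"
      using assms by (auto intro!: Max.boundedI)
    then show ?thesis using dist_fun_le_dist_first_terms[of x y n] by linarith
  qed
  then show "\<exists>N. \<forall>n\<ge>N. dist x y \<le> 2 * \<eta> + (1/2) ^ n" by blast
qed

text \<open>Connectives act on sequences, so the compact sets on which they are uniformly continuous
  come from Tychonoff's theorem.\<close>

lemma compact_nat_box: "compact {v :: nat \<Rightarrow> real. \<forall>i. v i \<in> S i}" if "\<And>i. compact (S i)"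
proof -
  have "compactin (product_topology (\<lambda>_. euclidean) UNIV) (PiE UNIV S)"
    unfolding compactin_PiE using that by (simp add: compactin_euclidean_iff)
  then show ?thesis
    by (simp add: euclidean_product_topology compactin_euclidean_iff PiE_UNIV_domain Pi_def)
qed

lemma abs_SUP_le:
  fixes f :: "'b \<Rightarrow> real"
  assumes "A \<noteq> {}" "\<And>x. x \<in> A \<Longrightarrow> \<bar>f x\<bar> \<le> B" shows "\<bar>SUP x\<in>A. f x\<bar> \<le> B"
proof -
  obtain a where a: "a \<in> A" using assms by auto
  have "(SUP x\<in>A. f x) \<le> B" using assms by (intro cSUP_least) (auto simp: abs_le_iff)
  moreover have "f a \<le> (SUP x\<in>A. f x)"
    using assms by (intro cSUP_upper[OF a] bdd_aboveI2[of _ _ B]) (auto simp: abs_le_iff)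
  ultimately show ?thesis using assms(2)[OF a] by linarith
qed

text \<open>The bound \<open>B\<close> ensures that both real suprema are genuine. For this reason
  the induction over formulas carries bounds along with convergence.\<close>

lemma abs_SUP_diff_le:
  fixes f g :: "'b \<Rightarrow> real"
  assumes "A \<noteq> {}" "\<And>x. x \<in> A \<Longrightarrow> \<bar>g x\<bar> \<le> B" and fg: "\<And>x. x \<in> A \<Longrightarrow> \<bar>f x - g x\<bar> \<le> r"
  shows "\<bar>(SUP x\<in>A. f x) - (SUP x\<in>A. g x)\<bar> \<le> r"
proof -
  have g: "bdd_above (g ` A)" using assms(2) by (intro bdd_aboveI2[of _ _ B]) (auto simp: abs_le_iff)
  have f: "bdd_above (f ` A)"
    using assms(2) fg by (intro bdd_aboveI2[of _ _ "B + r"]) (smt (verit))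
  have "(SUP x\<in>A. f x) \<le> (SUP x\<in>A. g x) + r"
    using assms(1) fg cSUP_upper[OF _ g] by (intro cSUP_least) (auto, smt (verit))
  moreover have "(SUP x\<in>A. g x) \<le> (SUP x\<in>A. f x) + r"
    using assms(1) fg cSUP_upper[OF _ f] by (intro cSUP_least) (auto, smt (verit))
  ultimately show ?thesis by linarith
qed

lemma INF_eq_SUP_real:
  fixes f :: "'b \<Rightarrow> real" shows "(INF x\<in>A. f x) = - (SUP x\<in>A. - f x)"
  by (simp add: Inf_real_def image_image)

text \<open>The map \<open>b\<close> records a radius for each variable. A quantifier changes it at
  the bound variable, so convergence has to be proved for all \<open>b\<close> at once.\<close>

definition assignments :: "'a ncps \<Rightarrow> (nat \<Rightarrow> nat) \<Rightarrow> (nat \<Rightarrow> 'a) set" where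
  "assignments M b = {s. \<forall>i. s i \<in> op_ball M (b i)}"

text \<open>The models \<open>N k\<close> are images of \<open>M\<close> under *-homomorphisms that map balls onto balls,
  and only the state and the norm depend on \<open>k\<close> asymptotically. Quantifiers then range over
  the same set in \<open>M\<close> and in all \<open>N k\<close>.\<close>

locale model_limit = unital_cstar_algebra M for M :: "'a ncps" (structure) +
  fixes T :: model_theory and N :: "nat \<Rightarrow> 'a ncps" and \<pi> :: "nat \<Rightarrow> 'a \<Rightarrow> 'a"
  assumes hom_add: "\<lbrakk>x \<in> carrier M; y \<in> carrier M\<rbrakk> \<Longrightarrow> \<pi> k (x \<oplus> y) = \<pi> k x \<oplus>\<^bsub>N k\<^esub> \<pi> k y"
    and hom_mult: "\<lbrakk>x \<in> carrier M; y \<in> carrier M\<rbrakk> \<Longrightarrow> \<pi> k (x \<otimes> y) = \<pi> k x \<otimes>\<^bsub>N k\<^esub> \<pi> k y"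
    and hom_const: "\<pi> k (c \<odot> \<one>) = c \<odot>\<^bsub>N k\<^esub> \<one>\<^bsub>N k\<^esub>"
    and hom_adj: "x \<in> carrier M \<Longrightarrow> \<pi> k (adj M x) = adj (N k) (\<pi> k x)"
    and ball_image: "op_ball (N k) r = \<pi> k ` op_ball M r"
    and state_limit: "uniform_limit (op_ball M r) (\<lambda>k x. state (N k) (\<pi> k x)) (state M) sequentially"
    and norm_limit: "uniform_limit (op_ball M r) (\<lambda>k x. model_norm T (N k) (\<pi> k x)) (model_norm T M) sequentially"
    and state_bounded: "\<exists>B. \<forall>x\<in>op_ball M r. cmod (state M x) \<le> B"
    and norm_bounded: "\<exists>B. \<forall>x\<in>op_ball M r. \<bar>model_norm T M x\<bar> \<le> B"
begin

text \<open>Convergence must be uniform in the assignment, because suprema do not commute with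
  pointwise limits in general.\<close>

abbreviation bounded_limit ::
    "(nat \<Rightarrow> nat) \<Rightarrow> (nat \<Rightarrow> (nat \<Rightarrow> 'a) \<Rightarrow> real) \<Rightarrow> ((nat \<Rightarrow> 'a) \<Rightarrow> real) \<Rightarrow> bool" where
  "bounded_limit b F G \<equiv> uniform_limit (assignments M b) F G sequentially
     \<and> (\<exists>B. \<forall>s\<in>assignments M b. \<bar>G s\<bar> \<le> B)"

lemma op_ball_closed:
  "x \<in> op_ball M q \<Longrightarrow> y \<in> op_ball M r \<Longrightarrow> x \<oplus> y \<in> op_ball M (q + r)"
  "x \<in> op_ball M q \<Longrightarrow> y \<in> op_ball M r \<Longrightarrow> x \<otimes> y \<in> op_ball M (q * r)"
  "x \<in> op_ball M q \<Longrightarrow> adj M x \<in> op_ball M q"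
  using opnorm_triangle[of x y] order_trans[OF opnorm_mult[of x y] mult_mono[of "opnorm M x" q "opnorm M y" r]]
  by (auto simp: op_ball_def opnorm_nonneg)

lemma op_ball_nonempty: "op_ball M r \<noteq> {}"
proof -
  have "\<zero> \<in> op_ball M r" by (simp add: op_ball_def)
  then show ?thesis by blast
qed

lemma poly_val_op_ball: "\<exists>r. \<forall>s\<in>assignments M b. poly_val M s p \<in> op_ball M r"
proof (induction p)
  case (PConst c)
  have "c \<odot> \<one> \<in> op_ball M (nat \<lceil>opnorm M (c \<odot> \<one>)\<rceil>)"
    by (simp add: op_ball_def real_nat_ceiling_ge)
  then show ?case by auto
qed (auto simp: assignments_def intro: op_ball_closed, (meson op_ball_closed)+)

lemma poly_val_hom:
  assumes "range s \<subseteq> carrier M"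
  shows "poly_val M s p \<in> carrier M \<and> poly_val (N k) (\<pi> k \<circ> s) p = \<pi> k (poly_val M s p)"
  using assms by (induction p) (auto simp: hom_add hom_mult hom_const hom_adj)

lemma assignments_range: "s \<in> assignments M b \<Longrightarrow> range s \<subseteq> carrier M"
  by (auto simp: assignments_def op_ball_def)

lemma assignments_upd: "s \<in> assignments M b \<Longrightarrow> x \<in> op_ball M r \<Longrightarrow> s(i := x) \<in> assignments M (b(i := r))"
  by (auto simp: assignments_def)

lemma poly_value_limit:
  assumes "\<And>r. uniform_limit (op_ball M r) (\<lambda>k x. F (N k) (\<pi> k x)) (F M) sequentially"
    and "\<And>r. \<exists>B. \<forall>x\<in>op_ball M r. \<bar>F M x\<bar> \<le> (B :: real)"
  shows "bounded_limit b (\<lambda>k s. F (N k) (poly_val (N k) (\<pi> k \<circ> s) p)) (\<lambda>s. F M (poly_val M s p))"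
proof -
  obtain r where r: "\<And>s. s \<in> assignments M b \<Longrightarrow> poly_val M s p \<in> op_ball M r" using poly_val_op_ball by blast
  have "F (N k) (poly_val (N k) (\<pi> k \<circ> s) p) = F (N k) (\<pi> k (poly_val M s p))" if "s \<in> assignments M b" for k s
    using poly_val_hom[OF assignments_range[OF that]] by simp
  then have "uniform_limit (assignments M b) (\<lambda>k s. F (N k) (poly_val (N k) (\<pi> k \<circ> s) p)) (\<lambda>s. F M (poly_val M s p)) sequentially
    \<longleftrightarrow> uniform_limit (assignments M b) (\<lambda>k s. F (N k) (\<pi> k (poly_val M s p))) (\<lambda>s. F M (poly_val M s p)) sequentially"
    by (intro uniform_limit_cong') auto
  moreover have "uniform_limit (assignments M b) (\<lambda>k s. F (N k) (\<pi> k (poly_val M s p))) (\<lambda>s. F M (poly_val M s p)) sequentially"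
    using r by (intro uniform_limit_compose'[OF assms(1)[of r]]) auto
  moreover have "\<exists>B. \<forall>s\<in>assignments M b. \<bar>F M (poly_val M s p)\<bar> \<le> B" using assms(2)[of r] r by blast
  ultimately show ?thesis by blast
qed

text \<open>Since \<open>\<pi> k\<close> maps balls onto balls, the supremum in \<open>N k\<close>
  is one over the ball of \<open>M\<close>. Uniform closeness then passes to the suprema.\<close>

lemma sup_limit:
  fixes g :: "(nat \<Rightarrow> 'a) \<Rightarrow> real" and f :: "nat \<Rightarrow> (nat \<Rightarrow> 'a) \<Rightarrow> real"
  assumes lim: "bounded_limit (b(i := r)) (\<lambda>k s. f k (\<pi> k \<circ> s)) g"
  shows "bounded_limit b (\<lambda>k s. SUP x\<in>op_ball (N k) r. f k ((\<pi> k \<circ> s)(i := x)))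
    (\<lambda>s. SUP x\<in>op_ball M r. g (s(i := x)))"
proof
  obtain B where B: "\<And>s. s \<in> assignments M (b(i := r)) \<Longrightarrow> \<bar>g s\<bar> \<le> B" using lim by blast
  show "\<exists>B. \<forall>s\<in>assignments M b. \<bar>SUP x\<in>op_ball M r. g (s(i := x))\<bar> \<le> B"
    using B assignments_upd op_ball_nonempty by (intro exI[of _ B] ballI abs_SUP_le) auto
  have eq: "(SUP x\<in>op_ball (N k) r. f k ((\<pi> k \<circ> s)(i := x))) = (SUP x\<in>op_ball M r. f k (\<pi> k \<circ> s(i := x)))" for k s
    unfolding ball_image image_image by (simp add: fun_upd_comp)
  show "uniform_limit (assignments M b) (\<lambda>k s. SUP x\<in>op_ball (N k) r. f k ((\<pi> k \<circ> s)(i := x)))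
      (\<lambda>s. SUP x\<in>op_ball M r. g (s(i := x))) sequentially"
    unfolding eq uniform_limit_iff dist_real_def
  proof (intro allI impI)
    fix \<epsilon> :: real assume \<epsilon>: "\<epsilon> > 0"
    have "\<forall>\<^sub>F k in sequentially. \<forall>s\<in>assignments M (b(i := r)). \<bar>f k (\<pi> k \<circ> s) - g s\<bar> < \<epsilon> / 2"
      using lim \<epsilon> unfolding uniform_limit_iff dist_real_def by (meson half_gt_zero)
    then show "\<forall>\<^sub>F k in sequentially. \<forall>s\<in>assignments M b.
        \<bar>(SUP x\<in>op_ball M r. f k (\<pi> k \<circ> s(i := x))) - (SUP x\<in>op_ball M r. g (s(i := x)))\<bar> < \<epsilon>"
    proof (rule eventually_mono, intro ballI)
      fix k s assume k: "\<forall>s\<in>assignments M (b(i := r)). \<bar>f k (\<pi> k \<circ> s) - g s\<bar> < \<epsilon> / 2" and s: "s \<in> assignments M b"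
      have "\<bar>(SUP x\<in>op_ball M r. f k (\<pi> k \<circ> s(i := x))) - (SUP x\<in>op_ball M r. g (s(i := x)))\<bar> \<le> \<epsilon> / 2"
        using k B assignments_upd[OF s] by (intro abs_SUP_diff_le[OF op_ball_nonempty, where B = B]) (auto intro: less_imp_le)
      then show "\<bar>(SUP x\<in>op_ball M r. f k (\<pi> k \<circ> s(i := x))) - (SUP x\<in>op_ball M r. g (s(i := x)))\<bar> < \<epsilon>"
        using \<epsilon> by linarith
    qed
  qed
qed

lemma vec_of_eq: "vec_of (map f xs) i = (if i < length xs then f (xs ! i) else 0)"
  by (simp add: vec_of_def)

text \<open>A continuous connective is in general uniformly continuous only on compact sets; the
  bounds on the subformulas confine their values to one.\<close>

lemma connective_limit:
  fixes f :: "(nat \<Rightarrow> real) \<Rightarrow> real" and G :: "formula \<Rightarrow> (nat \<Rightarrow> 'a) \<Rightarrow> real"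
  assumes f: "continuous_map (Euclidean_space (length \<phi>s)) euclideanreal f"
    and lim: "\<And>\<phi>. \<phi> \<in> set \<phi>s \<Longrightarrow> bounded_limit b (\<lambda>k s. H k \<phi> s) (\<lambda>s. G \<phi> s)"
  shows "bounded_limit b (\<lambda>k s. f (vec_of (map (\<lambda>\<phi>. H k \<phi> s) \<phi>s)))
    (\<lambda>s. f (vec_of (map (\<lambda>\<phi>. G \<phi> s) \<phi>s)))"
proof
  let ?n = "length \<phi>s"
  have "\<forall>\<phi>\<in>set \<phi>s. \<exists>B. \<forall>s\<in>assignments M b. \<bar>G \<phi> s\<bar> \<le> B" using lim by blast
  then obtain c where c: "\<forall>\<phi>\<in>set \<phi>s. \<forall>s\<in>assignments M b. \<bar>G \<phi> s\<bar> \<le> c \<phi>" by (rule bchoice[THEN exE])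
  define B where "B = (\<Sum>\<phi>\<in>set \<phi>s. \<bar>c \<phi>\<bar>)"
  have B: "\<bar>G \<phi> s\<bar> \<le> B" if "\<phi> \<in> set \<phi>s" "s \<in> assignments M b" for \<phi> s
  proof -
    have "\<bar>c \<phi>\<bar> \<le> B" unfolding B_def using that(1) by (intro member_le_sum) auto
    then show ?thesis using c that by fastforce
  qed
  \<comment> \<open>The margin of 1 keeps the values in \<open>N k\<close>, eventually within 1 of
    those in \<open>M\<close>, inside the box. The coordinates from \<open>?n\<close> on are the
    padding of \<open>vec_of\<close>.\<close>
  define S where "S i = (if i < ?n then {-(B+1)..B+1} else {0})" for i
  define K where "K = {v :: nat \<Rightarrow> real. \<forall>i. v i \<in> S i}"
  have K: "compact K" unfolding K_def by (rule compact_nat_box) (simp add: S_def)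
  have "v i = 0" if "v \<in> K" "i \<ge> ?n" for v i
  proof -
    have "v i \<in> S i" using that(1) by (simp add: K_def)
    then show ?thesis using that(2) by (simp add: S_def)
  qed
  then have "K \<subseteq> {x. \<forall>i\<ge>?n. x i = 0}" by blast
  then have cont: "continuous_on K f"
    using f unfolding continuous_map_Euclidean_space_iff by (rule continuous_on_subset[rotated])
  have G_K: "vec_of (map (\<lambda>\<phi>. G \<phi> s) \<phi>s) \<in> K" if "s \<in> assignments M b" for s
    using B[OF nth_mem that] by (fastforce simp: K_def S_def vec_of_eq abs_le_iff)
  obtain C where "\<And>v. v \<in> K \<Longrightarrow> \<bar>f v\<bar> \<le> C"
    using compact_imp_bounded[OF compact_continuous_image[OF cont K]] unfolding bounded_iff real_norm_def by blast
  then show "\<exists>B. \<forall>s\<in>assignments M b. \<bar>f (vec_of (map (\<lambda>\<phi>. G \<phi> s) \<phi>s))\<bar> \<le> B" using G_K by blast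
  show "uniform_limit (assignments M b) (\<lambda>k s. f (vec_of (map (\<lambda>\<phi>. H k \<phi> s) \<phi>s))) (\<lambda>s. f (vec_of (map (\<lambda>\<phi>. G \<phi> s) \<phi>s))) sequentially"
    unfolding uniform_limit_iff
  proof (intro allI impI)
    fix \<epsilon> :: real assume "\<epsilon> > 0"
    then obtain d where d: "d > 0" "\<forall>x\<in>K. \<forall>x'\<in>K. dist x' x < d \<longrightarrow> dist (f x') (f x) < \<epsilon>"
      using compact_uniformly_continuous[OF cont K] unfolding uniformly_continuous_on_def by metis
    \<comment> \<open>The 1 matches the margin of the box; \<open>d / 4\<close> absorbs the factor 2
      of \<open>dist_fun_le\<close> and keeps the inequality strict.\<close>
    define \<eta> where "\<eta> = min 1 (d / 4)"
    have \<eta>: "\<eta> > 0" "\<eta> \<le> 1" "2 * \<eta> < d" using d(1) by (auto simp: \<eta>_def min_def)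
    have "\<forall>\<^sub>F k in sequentially. \<forall>\<phi>\<in>set \<phi>s. \<forall>s\<in>assignments M b. dist (H k \<phi> s) (G \<phi> s) < \<eta>"
      by (rule eventually_ball_finite) (use lim \<eta>(1) in \<open>auto simp: uniform_limit_iff\<close>)
    then show "\<forall>\<^sub>F k in sequentially. \<forall>s\<in>assignments M b.
        dist (f (vec_of (map (\<lambda>\<phi>. H k \<phi> s) \<phi>s))) (f (vec_of (map (\<lambda>\<phi>. G \<phi> s) \<phi>s))) < \<epsilon>"
    proof (rule eventually_mono, intro ballI)
      fix k s assume k: "\<forall>\<phi>\<in>set \<phi>s. \<forall>s\<in>assignments M b. dist (H k \<phi> s) (G \<phi> s) < \<eta>" and s: "s \<in> assignments M b"
      have *: "\<bar>H k (\<phi>s ! i) s - G (\<phi>s ! i) s\<bar> < \<eta>" if "i < ?n" for i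
        using k s nth_mem[OF that] by (auto simp: dist_real_def)
      have "H k (\<phi>s ! i) s \<in> S i" if "i < ?n" for i
        using *[OF that] B[OF nth_mem[OF that] s] \<eta>(2) that by (auto simp: S_def abs_le_iff abs_less_iff)
      then have "vec_of (map (\<lambda>\<phi>. H k \<phi> s) \<phi>s) \<in> K" by (auto simp: K_def vec_of_eq) (auto simp: S_def)
      moreover have "dist (vec_of (map (\<lambda>\<phi>. H k \<phi> s) \<phi>s)) (vec_of (map (\<lambda>\<phi>. G \<phi> s) \<phi>s)) \<le> 2 * \<eta>"
        by (rule dist_fun_le) (use * \<eta>(1) in \<open>auto simp: vec_of_eq dist_real_def less_imp_le\<close>)
      ultimately show "dist (f (vec_of (map (\<lambda>\<phi>. H k \<phi> s) \<phi>s))) (f (vec_of (map (\<lambda>\<phi>. G \<phi> s) \<phi>s))) < \<epsilon>"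
        using d(2) G_K[OF s] \<eta>(3) by fastforce
    qed
  qed
qed

theorem interp_uniform_limit:
  assumes "is_formula \<phi>"
  shows "bounded_limit b (\<lambda>k s. interp T (N k) (\<pi> k \<circ> s) \<phi>) (\<lambda>s. interp T M s \<phi>)"
  using assms
proof (induction \<phi> arbitrary: b)
  case (ReState p)
  have "uniform_limit (op_ball M r) (\<lambda>k x. Re (state (N k) (\<pi> k x))) (\<lambda>x. Re (state M x)) sequentially" for r
    by (rule bounded_linear.uniform_limit[OF bounded_linear_Re state_limit])
  moreover have "\<exists>B. \<forall>x\<in>op_ball M r. \<bar>Re (state M x)\<bar> \<le> B" for r
    using state_bounded[of r] abs_Re_le_cmod order_trans by meson
  ultimately show ?case using poly_value_limit[where F = "\<lambda>M x. Re (state M x)" and b = b and p = p] unfolding interp.simps by blast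
next
  case (ImState p)
  have "uniform_limit (op_ball M r) (\<lambda>k x. Im (state (N k) (\<pi> k x))) (\<lambda>x. Im (state M x)) sequentially" for r
    by (rule bounded_linear.uniform_limit[OF bounded_linear_Im state_limit])
  moreover have "\<exists>B. \<forall>x\<in>op_ball M r. \<bar>Im (state M x)\<bar> \<le> B" for r
    using state_bounded[of r] abs_Im_le_cmod order_trans by meson
  ultimately show ?case using poly_value_limit[where F = "\<lambda>M x. Im (state M x)" and b = b and p = p] unfolding interp.simps by blast
next
  case (NormOf p)
  then show ?case using poly_value_limit[where F = "model_norm T" and b = b and p = p] norm_limit norm_bounded
    unfolding interp.simps by blast
next
  case (Connective f \<phi>s)
  then show ?case
    using connective_limit[where \<phi>s = \<phi>s and f = f and b = b and
        H = "\<lambda>k \<phi> s. interp T (N k) (\<pi> k \<circ> s) \<phi>" and G = "\<lambda>\<phi> s. interp T M s \<phi>"]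
    unfolding interp.simps is_formula.simps by blast
next
  case (FSup i r \<phi>)
  then show ?case using sup_limit[where b = b and i = i and r = r and
        f = "\<lambda>k s. interp T (N k) s \<phi>" and g = "\<lambda>s. interp T M s \<phi>"]
    unfolding interp.simps is_formula.simps by blast
next
  case (FInf i r \<phi>)
  have "uniform_limit (assignments M (b(i := r))) (\<lambda>k s. - interp T (N k) (\<pi> k \<circ> s) \<phi>) (\<lambda>s. - interp T M s \<phi>) sequentially"
    using FInf.IH[of "b(i := r)"] FInf.prems unfolding is_formula.simps
    by (intro uniform_limit_uminus) blast
  moreover have "\<exists>B. \<forall>s\<in>assignments M (b(i := r)). \<bar>- interp T M s \<phi>\<bar> \<le> B" using FInf by simp
  ultimately have *: "bounded_limit b
      (\<lambda>k s. SUP x\<in>op_ball (N k) r. - interp T (N k) ((\<pi> k \<circ> s)(i := x)) \<phi>)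
      (\<lambda>s. SUP x\<in>op_ball M r. - interp T M (s(i := x)) \<phi>)"
    by (intro sup_limit[where f = "\<lambda>k s. - interp T (N k) s \<phi>"] conjI)
  show ?case
    unfolding interp.simps INF_eq_SUP_real abs_minus_cancel
    by (rule conjI[OF uniform_limit_uminus[OF conjunct1[OF *]] conjunct2[OF *]])
qed

end

section \<open>Freeness in atomic models\<close>

context atomic
begin

text \<open>The cut-off is there because the unit is the indicator of \<open>I\<close>: a constant
  term contributes nothing outside.\<close>

lemma poly_ev_L:
  assumes f: "f \<in> bounded_funs I"
  shows "poly_ev L (e f) p = e (\<lambda>i. if i \<in> I then poly p (f i) else 0)"
proof -
  interpret unital_cstar_algebra L by (rule L_unital_cstar_algebra)
  show ?thesis
  proof (induction p)
    case 0
    then show ?case by (simp add: fun_eq_iff)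
  next
    case (pCons c p)
    have "e f \<in> carrier L" using f by simp
    from poly_ev_pCons[OF this, of c p] show ?case
      unfolding pCons.IH L_simps by (auto simp: bounded_funs_zero[OF f] fun_eq_iff)
  qed
qed

lemma word_ev_L:
  assumes f: "f \<in> bounded_funs I" "g \<in> bounded_funs I"
  shows "word_ev L (e f) (e g) u =
    e (\<lambda>i. if i \<in> I then prod_list (map (\<lambda>(b, p). poly p (if b then g i else f i)) u) else 0)"
proof (induction u)
  case (Cons bp u)
  obtain b p where "bp = (b, p)" by (cases bp)
  then show ?case using Cons f by (auto simp: poly_ev_L fun_eq_iff)
qed (simp add: fun_eq_iff)

lemma state_restrict: "(\<Sum>i. of_real (w i) * (if i \<in> I then h i else 0)) = (\<Sum>i. of_real (w i) * (h i :: complex))"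
  by (rule suminf_cong) (simp add: w_zero)

text \<open>If the state is a character on \<open>\<complex>[f]\<close>, a product of centred elements has a
  vanishing factor at the character.\<close>

lemma free_of_character:
  fixes f :: "nat \<Rightarrow> complex"
  assumes f: "f \<in> bounded_funs I" and z: "\<And>p. (\<Sum>i. w i * poly p (f i)) = poly p z"
  shows "freely_independent L (e f) (e f)"
  unfolding freely_independent_iff if_cancel
proof (intro allI impI, elim conjE)
  fix u :: "(bool \<times> complex poly) list"
  assume u: "u \<noteq> []" "\<forall>(i, p)\<in>set u. state L (poly_ev L (e f) p) = 0"
  have 0: "poly p z = 0" if "p \<in> snd ` set u" for p
  proof -
    have "state L (poly_ev L (e f) p) = 0" using u(2) that by auto
    then show ?thesis using z[of p] by (simp add: poly_ev_L[OF f] state_restrict)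
  qed
  \<comment> \<open>All letters are evaluated at the same element, so a word is a single polynomial,
    to which the character applies.\<close>
  have "prod_list (map (\<lambda>(b, p). poly p y) u) = poly (prod_list (map snd u)) y" for y
    by (induction u) auto
  then have "state L (word_ev L (e f) (e f) u) = poly (prod_list (map snd u)) z"
    unfolding if_cancel unfolding word_ev_L[OF f f, unfolded if_cancel] unfolding L_simps state_restrict using z by simp
  also have "\<dots> = 0"
  proof -
    obtain v us where "u = v # us" using u(1) by (cases u) auto
    then show ?thesis using 0[of "snd v"] by simp
  qed
  finally show "state L (foldr (\<lambda>(i, p) y. poly_ev L (e f) p \<otimes>\<^bsub>L\<^esub> y) u \<one>\<^bsub>L\<^esub>) = 0"
    by simp
qed

end

text \<open>Lagrange interpolation, which places indicators of level sets in \<complex>[f]. This is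
  where finiteness of the approximating models enters.\<close>

lemma separating_poly:
  fixes S :: "complex set" assumes "finite S" "v \<in> S"
  obtains p where "poly p v = 1" "\<And>u. u \<in> S \<Longrightarrow> u \<noteq> v \<Longrightarrow> poly p u = 0"
proof -
  define q where "q = (\<Prod>u\<in>S - {v}. [:-u, 1:])"
  have "poly q v \<noteq> 0" using assms by (simp add: q_def poly_prod)
  moreover have "poly q u = 0" if "u \<in> S" "u \<noteq> v" for u
    using assms that by (auto simp: q_def poly_prod)
  ultimately show thesis using that[of "Polynomial.smult (inverse (poly q v)) q"] by simp
qed

locale finite_atomic = atomic +
  assumes finite_I: "finite I" and w_pos: "i \<in> I \<Longrightarrow> w i > 0"
begin

lemma finite_state: "(\<Sum>i. of_real (w i) * h i) = (\<Sum>i\<in>I. of_real (w i) * (h i :: complex))"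
  by (rule suminf_finite[OF finite_I]) (simp add: w_zero)

lemma sum_w: "(\<Sum>i\<in>I. w i) = 1"
  using suminf_finite[OF finite_I, of w] w_summable(2) w_zero by simp

text \<open>The centred indicator of a level set of \<open>f\<close>.\<close>

lemma centred_poly:
  fixes f :: "nat \<Rightarrow> complex"
  assumes ij: "i0 \<in> I" "i1 \<in> I" "f i0 \<noteq> f i1"
  obtains p h where "\<And>i. i \<in> I \<Longrightarrow> poly p (f i) = of_real (h i)" "\<And>i. i \<in> I \<Longrightarrow> h i \<noteq> (0::real)"
    "(\<Sum>i\<in>I. of_real (w i) * poly p (f i)) = 0"
proof -
  obtain q where q: "poly q (f i0) = 1" "\<And>u. u \<in> f ` I \<Longrightarrow> u \<noteq> f i0 \<Longrightarrow> poly q u = 0"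
    using separating_poly[of "f ` I" "f i0"] finite_I ij(1) by blast
  \<comment> \<open>The weight of the level set. It lies strictly between 0 and 1, as
    \<open>i0\<close> is inside and \<open>i1\<close> outside, so the two values
    \<open>1 - a\<close> and \<open>-a\<close> of \<open>h\<close> are nonzero.\<close>
  define a where "a = (\<Sum>i\<in>I. w i * (if f i = f i0 then 1 else 0))"
  define p where "p = q - [:of_real a:]"
  define h where "h i = (if f i = f i0 then 1 else 0) - a" for i
  have ph: "poly p (f i) = of_real (h i)" if "i \<in> I" for i
    using q that by (auto simp: p_def h_def)
  have "w i0 \<le> a"
    using member_le_sum[of i0 I "\<lambda>i. w i * (if f i = f i0 then 1 else 0)"] ij finite_I w_nonneg
    by (simp add: a_def)
  then have a0: "a > 0" using w_pos[OF ij(1)] by linarith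
  have "w i1 \<le> (\<Sum>i\<in>I. w i * (if f i = f i0 then 0 else 1))"
    using member_le_sum[of i1 I "\<lambda>i. w i * (if f i = f i0 then 0 else 1)"] ij finite_I w_nonneg
    by simp
  also have "\<dots> = (\<Sum>i\<in>I. w i - w i * (if f i = f i0 then 1 else 0))" by (rule sum.cong) auto
  also have "\<dots> = 1 - a" by (simp add: sum_subtractf a_def sum_w)
  finally have a1: "a < 1" using w_pos[OF ij(2)] by linarith
  have "(\<Sum>i\<in>I. of_real (w i) * poly p (f i)) = of_real (\<Sum>i\<in>I. w i * h i)"
    using ph by simp
  also have "(\<Sum>i\<in>I. w i * h i) = a - (\<Sum>i\<in>I. w i) * a"
  proof -
    have "(\<Sum>i\<in>I. w i * (if f i = f i0 then 1 else 0)) = a" by (simp only: a_def)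
    then show ?thesis unfolding h_def right_diff_distrib sum_subtractf sum_distrib_right by simp
  qed
  finally show thesis using that[of p h] ph a0 a1 by (simp add: h_def sum_w)
qed

text \<open>If \<open>f\<close> and \<open>g\<close> are both nonconstant, let \<open>h\<close> and \<open>k\<close> be centred indicators of level
  sets. These vanish nowhere, so the state of the alternating word \<open>h k h k\<close> is positive.\<close>

lemma free_imp_const:
  assumes f: "f \<in> bounded_funs I" "g \<in> bounded_funs I" and free: "freely_independent L (e f) (e g)"
  shows "(\<exists>a. \<forall>i\<in>I. f i = a) \<or> (\<exists>a. \<forall>i\<in>I. g i = a)"
proof (rule ccontr)
  assume "\<not> ?thesis"
  then have nc: "\<not> (\<exists>a. \<forall>i\<in>I. f i = a)" "\<not> (\<exists>a. \<forall>i\<in>I. g i = a)" by auto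
  obtain i0 where i0: "i0 \<in> I" using I_nonempty by auto
  obtain i1 where i1: "i1 \<in> I" "f i0 \<noteq> f i1" using nc(1) by metis
  obtain i2 where i2: "i2 \<in> I" "g i0 \<noteq> g i2" using nc(2) by metis
  obtain p h where p: "\<And>i. i \<in> I \<Longrightarrow> poly p (f i) = of_real (h i)" "\<And>i. i \<in> I \<Longrightarrow> h i \<noteq> 0"
    "(\<Sum>i\<in>I. of_real (w i) * poly p (f i)) = 0" using centred_poly[of i0 i1 f] i0 i1 by metis
  obtain q k where q: "\<And>i. i \<in> I \<Longrightarrow> poly q (g i) = of_real (k i)" "\<And>i. i \<in> I \<Longrightarrow> k i \<noteq> 0"
    "(\<Sum>i\<in>I. of_real (w i) * poly q (g i)) = 0" using centred_poly[of i0 i2 g] i0 i2 by metis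
  let ?u = "[(False, p), (True, q), (False, p), (True, q)]"
  have "state L (word_ev L (e f) (e g) ?u) = 0"
  proof (rule free[unfolded freely_independent_iff, rule_format], intro conjI)
    show "alternating ?u" by (auto simp: alternating_def less_Suc_eq numeral_eq_Suc)
    show "\<forall>(i, p)\<in>set ?u. state L (poly_ev L (if i then e g else e f) p) = 0"
      using p(3) q(3) f by (simp add: poly_ev_L state_restrict finite_state)
  qed simp
  then have "(\<Sum>i\<in>I. of_real (w i) * prod_list (map (\<lambda>(b, p). poly p (if b then g i else f i)) ?u)) = 0"
    unfolding word_ev_L[OF f] unfolding L_simps state_restrict finite_state .
  also have "(\<Sum>i\<in>I. of_real (w i) * prod_list (map (\<lambda>(b, p). poly p (if b then g i else f i)) ?u))
      = of_real (\<Sum>i\<in>I. w i * (h i * k i)\<^sup>2)"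
    using p(1) q(1) by (simp add: power2_eq_square mult_ac)
  finally have "(\<Sum>i\<in>I. w i * (h i * k i)\<^sup>2) = 0" by (simp only: of_real_eq_0_iff)
  moreover have "(\<Sum>i\<in>I. w i * (h i * k i)\<^sup>2) > 0"
    using p(2) q(2) w_pos by (intro sum_pos finite_I I_nonempty) simp
  ultimately show False by simp
qed

end

section \<open>Free pairs are not definable\<close>

text \<open>A formula for distance \<open>r / 2\<close> would vanish at \<open>(x, x)\<close> in
  \<open>M\<close>. By convergence it would fall below its \<delta> at the image of this pair in
  some \<open>N k\<close>, although all free pairs there are at distance at least
  \<open>r\<close>.\<close>

lemma not_T_definable_limit:
  fixes M :: "'a ncps"
  assumes lim: "model_limit M T N \<pi>" and M: "is_model T M" and N: "\<And>k. is_model T (N k)"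
    and free: "[x, x] \<in> free_pairs M" and r: "r > 0"
    and far: "\<And>k u v. [u, v] \<in> free_pairs (N k) \<Longrightarrow>
      r \<le> max (model_dist T (N k) (\<pi> k x) u) (model_dist T (N k) (\<pi> k x) v)"
  shows "\<not> T_definable T 2 (free_pairs :: 'a ncps \<Rightarrow> 'a list set)"
proof
  interpret model_limit M T N \<pi> by (rule lim)
  assume "T_definable T 2 (free_pairs :: 'a ncps \<Rightarrow> 'a list set)"
  then obtain \<phi> \<delta> where \<phi>: "is_formula \<phi>" "\<delta> > 0"
    and zero: "\<And>M :: 'a ncps. is_model T M \<Longrightarrow> free_pairs M \<subseteq> zero_set T 2 M \<phi>"
    and near: "\<And>(M :: 'a ncps) a. is_model T M \<Longrightarrow> a \<in> ball_tuples 2 M \<Longrightarrow> interp_tuple T M \<phi> a < \<delta> \<Longrightarrow>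
      (INF y\<in>free_pairs M. ereal (tuple_dist T 2 M a y)) \<le> ereal (r / 2)"
    using r unfolding T_definable_def by (metis half_gt_zero)
  define s where "s i = (if i < length [x, x] then [x, x] ! i else \<zero>\<^bsub>M\<^esub>)" for i
  have x: "x \<in> op_ball M 1" using free by (auto simp: free_pairs_def)
  have "s i \<in> op_ball M 1" for i
    using x by (auto simp: s_def op_ball_def less_Suc_eq)
  then have s: "s \<in> assignments M (\<lambda>_. 1)" by (simp add: assignments_def)
  have s0: "interp T M s \<phi> = 0"
    using zero[OF M] free by (auto simp: zero_set_def interp_tuple_def s_def[abs_def])
  have "(\<lambda>k. interp T (N k) (\<pi> k \<circ> s) \<phi>) \<longlonglongrightarrow> interp T M s \<phi>"
    by (rule tendsto_uniform_limitI[OF conjunct1[OF interp_uniform_limit[OF \<phi>(1)]] s])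
  then have "\<forall>\<^sub>F k in sequentially. interp T (N k) (\<pi> k \<circ> s) \<phi> < \<delta>"
    unfolding s0 using \<phi>(2) by (rule order_tendstoD(2))
  then obtain k where k: "interp T (N k) (\<pi> k \<circ> s) \<phi> < \<delta>"
    by (meson eventually_sequentially order_refl)
  interpret Nk: cstar_probability_space "N k" by (rule is_model_cstar_probability_space[OF N])
  \<comment> \<open>Variables beyond the tuple are filled with zero in \<open>interp_tuple\<close>,
    so the filling must also be carried from \<open>M\<close> to \<open>N k\<close>.\<close>
  have "\<pi> k \<zero>\<^bsub>M\<^esub> = \<zero>\<^bsub>N k\<^esub>" using hom_const[of k 0] by simp
  then have "\<pi> k \<circ> s = (\<lambda>i. if i < length [\<pi> k x, \<pi> k x] then [\<pi> k x, \<pi> k x] ! i else \<zero>\<^bsub>N k\<^esub>)"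
    by (auto simp: s_def fun_eq_iff nth_Cons split: nat.splits)
  then have "interp_tuple T (N k) \<phi> [\<pi> k x, \<pi> k x] < \<delta>"
    using k by (simp add: interp_tuple_def)
  moreover have "\<pi> k x \<in> op_ball (N k) 1" using x ball_image by blast
  ultimately have "(INF y\<in>free_pairs (N k). ereal (tuple_dist T 2 (N k) [\<pi> k x, \<pi> k x] y)) \<le> ereal (r / 2)"
    by (intro near N) (auto simp: ball_tuples_2)
  moreover have "ereal r \<le> (INF y\<in>free_pairs (N k). ereal (tuple_dist T 2 (N k) [\<pi> k x, \<pi> k x] y))"
  proof (rule INF_greatest)
    fix y assume y: "y \<in> free_pairs (N k)"
    then obtain u v where "y = [u, v]" by (auto simp: free_pairs_def)
    then have "r \<le> tuple_dist T 2 (N k) [\<pi> k x, \<pi> k x] y"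
      using far[of u v k] y by (simp add: tuple_dist_2)
    then show "ereal r \<le> ereal (tuple_dist T 2 (N k) [\<pi> k x, \<pi> k x] y)" by (simp only: ereal_less_eq)
  qed
  ultimately have "ereal r \<le> ereal (r / 2)" by (rule order_trans[rotated])
  then show False using r by simp
qed

section \<open>Approximation of atomic models by finite ones\<close>

lemma abs_sqrt_diff_le: "a \<ge> 0 \<Longrightarrow> b \<ge> 0 \<Longrightarrow> \<bar>sqrt a - sqrt b\<bar> \<le> sqrt \<bar>a - b\<bar>"
proof (induction a b rule: linorder_wlog)
  case (le a b)
  have "sqrt b \<le> sqrt (b - a) + sqrt a"
    using sqrt_add_le_add_sqrt[of "b - a" a] le by simp
  then show ?case using le by simp
qed (simp add: abs_minus_commute)

lemma uniform_limit_of_bound: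
  fixes F :: "nat \<Rightarrow> 'b \<Rightarrow> 'c::metric_space"
  assumes "\<And>k x. x \<in> S \<Longrightarrow> dist (F k x) (G x) \<le> b k" "b \<longlonglongrightarrow> 0"
  shows "uniform_limit S F G sequentially"
  unfolding uniform_limit_iff
proof (intro allI impI)
  fix \<epsilon> :: real assume "\<epsilon> > 0"
  then have "\<forall>\<^sub>F k in sequentially. b k < \<epsilon>" by (rule order_tendstoD(2)[OF assms(2)])
  then show "\<forall>\<^sub>F k in sequentially. \<forall>x\<in>S. dist (F k x) (G x) < \<epsilon>"
    by (rule eventually_mono) (use assms(1) in \<open>meson le_less_trans\<close>)
qed

text \<open>The approximating models \<open>l\<^sup>\<infinity>(J k)\<close> are restrictions of \<open>l\<^sup>\<infinity>(I)\<close>; restriction maps balls onto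
  balls, and weights converging in \<open>l\<^sup>1\<close> give uniform convergence of the state and of the 2-norm.\<close>

locale atomic_approximation = M: atomic e I w
  for e :: "(nat \<Rightarrow> complex) \<Rightarrow> 'a" and I w +
  fixes J :: "nat \<Rightarrow> nat set" and v :: "nat \<Rightarrow> nat \<Rightarrow> real" and T :: model_theory
  assumes fin: "finite_atomic e (J k) (v k)" and J: "J k \<subseteq> I"
    and lim: "(\<lambda>k. \<Sum>i. \<bar>v k i - w i\<bar>) \<longlonglongrightarrow> 0"
    and pos: "T = Tracial_VN \<Longrightarrow> i \<in> I \<Longrightarrow> w i > 0"
    and same: "T = CStar_Prob \<Longrightarrow> J k = I"
begin

abbreviation "N k \<equiv> atomic_algebra e (J k) (v k)"

definition restr :: "nat \<Rightarrow> 'a \<Rightarrow> 'a" where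
  "restr k x = e (\<lambda>i. if i \<in> J k then inv_into UNIV e x i else 0)"

lemma restr_e:
  fixes f :: "nat \<Rightarrow> complex" shows "restr k (e f) = e (\<lambda>i. if i \<in> J k then f i else 0)"
  unfolding restr_def M.inv_e ..

lemma is_model_M: "is_model T M.L"
  using M.L_cstar_probability_space M.L_tracial_von_neumann_algebra pos by (cases T) auto

lemma is_model_N: "is_model T (N k)"
proof -
  interpret N: finite_atomic e "J k" "v k" by (rule fin)
  show ?thesis using N.L_cstar_probability_space N.L_tracial_von_neumann_algebra N.w_pos by (cases T) auto
qed

lemma restrict_bounded:
  assumes "f \<in> bounded_funs I"
  shows "(\<lambda>i. if i \<in> J k then f i else 0) \<in> bounded_funs (J k)"
    "sup_norm (\<lambda>i. if i \<in> J k then f i else 0) \<le> sup_norm f"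
proof -
  show "(\<lambda>i. if i \<in> J k then f i else 0) \<in> bounded_funs (J k)"
    by (rule bounded_funsI[of _ _ "sup_norm f"])
      (auto simp: supported_on_def sup_norm_upper[OF assms] sup_norm_nonneg[OF assms])
  show "sup_norm (\<lambda>i. if i \<in> J k then f i else 0) \<le> sup_norm f"
    by (rule sup_norm_least) (auto simp: sup_norm_upper[OF assms] sup_norm_nonneg[OF assms])
qed

lemma op_ball_M: "op_ball M.L r = {e f |f. f \<in> bounded_funs I \<and> sup_norm f \<le> real r}"
  by (auto simp: op_ball_def)

lemma op_ball_N: "op_ball (N k) r = {e f |f. f \<in> bounded_funs (J k) \<and> sup_norm f \<le> real r}"
proof -
  interpret N: finite_atomic e "J k" "v k" by (rule fin)
  show ?thesis by (auto simp: op_ball_def)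
qed

text \<open>Stated for Banach-valued \<open>h\<close> to serve both the complex-valued state and the
  real-valued squared 2-norm.\<close>

lemma weighted_sum_diff:
  fixes h :: "nat \<Rightarrow> 'b::banach"
  assumes h: "\<And>i. norm (h i) \<le> B"
  shows "norm ((\<Sum>i. v k i *\<^sub>R h i) - (\<Sum>i. w i *\<^sub>R h i)) \<le> B * (\<Sum>i. \<bar>v k i - w i\<bar>)"
proof -
  interpret N: finite_atomic e "J k" "v k" by (rule fin)
  have B: "B \<ge> 0" using h[of 0] norm_ge_zero order_trans by blast
  have sv: "summable (\<lambda>i. v k i *\<^sub>R h i)" and sw: "summable (\<lambda>i. w i *\<^sub>R h i)"
  proof -
    show "summable (\<lambda>i. v k i *\<^sub>R h i)"
      by (rule summable_comparison_test'[OF summable_mult2[OF N.w_summable(1), of B], of 0])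
        (simp add: mult_left_mono N.w_nonneg h)
    show "summable (\<lambda>i. w i *\<^sub>R h i)"
      by (rule summable_comparison_test'[OF summable_mult2[OF M.w_summable(1), of B], of 0])
        (simp add: mult_left_mono M.w_nonneg h)
  qed
  have sd: "summable (\<lambda>i. \<bar>v k i - w i\<bar>)"
    using summable_add[OF N.w_summable(1) M.w_summable(1)]
  proof (rule summable_comparison_test'[of _ 0])
    fix i show "norm \<bar>v k i - w i\<bar> \<le> v k i + w i" using N.w_nonneg[of i] M.w_nonneg[of i] by simp
  qed
  have "(\<Sum>i. v k i *\<^sub>R h i) - (\<Sum>i. w i *\<^sub>R h i) = (\<Sum>i. (v k i - w i) *\<^sub>R h i)"
    unfolding scaleR_left_diff_distrib by (rule suminf_diff[OF sv sw])
  also have "norm \<dots> \<le> (\<Sum>i. B * \<bar>v k i - w i\<bar>)"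
  proof (rule norm_suminf_le)
    show "norm ((v k i - w i) *\<^sub>R h i) \<le> B * \<bar>v k i - w i\<bar>" for i
      using mult_right_mono[OF h[of i], of "\<bar>v k i - w i\<bar>"] by (simp add: mult.commute)
  qed (rule summable_mult[OF sd])
  also have "\<dots> = B * (\<Sum>i. \<bar>v k i - w i\<bar>)" by (rule suminf_mult[OF sd])
  finally show ?thesis .
qed

lemma state_diff:
  assumes "x \<in> op_ball M.L r"
  shows "cmod (state (N k) (restr k x) - state M.L x) \<le> real r * (\<Sum>i. \<bar>v k i - w i\<bar>)"
proof -
  interpret N: finite_atomic e "J k" "v k" by (rule fin)
  obtain f where f: "x = e f" "f \<in> bounded_funs I" "sup_norm f \<le> real r" using assms by (auto simp: op_ball_M)
  have "cmod (f i) \<le> real r" for i using sup_norm_upper[OF f(2), of i] f(3) by simp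
  from weighted_sum_diff[of f, OF this, of k] show ?thesis
    by (simp add: f(1) restr_e N.state_restrict scaleR_conv_of_real)
qed

lemma norm2_diff:
  assumes "x \<in> op_ball M.L r"
  shows "\<bar>norm2 (N k) (restr k x) - norm2 M.L x\<bar> \<le> sqrt ((real r)\<^sup>2 * (\<Sum>i. \<bar>v k i - w i\<bar>))"
proof -
  interpret N: finite_atomic e "J k" "v k" by (rule fin)
  obtain f where f: "x = e f" "f \<in> bounded_funs I" "sup_norm f \<le> real r" using assms by (auto simp: op_ball_M)
  have "norm ((cmod (f i))\<^sup>2) \<le> (real r)\<^sup>2" for i
    using sup_norm_upper[OF f(2), of i] f(3) by (simp add: power_mono)
  from weighted_sum_diff[of "\<lambda>i. (cmod (f i))\<^sup>2", OF this, of k]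
  have "\<bar>(\<Sum>i. v k i * (cmod (f i))\<^sup>2) - (\<Sum>i. w i * (cmod (f i))\<^sup>2)\<bar> \<le> (real r)\<^sup>2 * (\<Sum>i. \<bar>v k i - w i\<bar>)"
    by simp
  moreover have "norm2 (N k) (restr k x) = sqrt (\<Sum>i. v k i * (cmod (f i))\<^sup>2)"
  proof -
    have "v k i * (cmod (if i \<in> J k then f i else 0))\<^sup>2 = v k i * (cmod (f i))\<^sup>2" for i
      using N.w_zero by simp
    then show ?thesis unfolding f(1) restr_e N.L_norm2[OF restrict_bounded(1)[OF f(2)]] by presburger
  qed
  moreover have "norm2 M.L x = sqrt (\<Sum>i. w i * (cmod (f i))\<^sup>2)" unfolding f(1) by (rule M.L_norm2[OF f(2)])
  moreover have "(\<Sum>i. w i * (cmod (f i))\<^sup>2) \<ge> 0"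
    using M.w_nonneg by (intro suminf_nonneg M.real_state_summable(1) f(2)) auto
  moreover have "(\<Sum>i. v k i * (cmod (f i))\<^sup>2) \<ge> 0"
  proof -
    have "(\<Sum>i. v k i * (cmod (f i))\<^sup>2) = (\<Sum>i\<in>J k. v k i * (cmod (f i))\<^sup>2)"
      by (rule suminf_finite[OF N.finite_I]) (simp add: N.w_zero)
    then show ?thesis using N.w_nonneg by (simp add: sum_nonneg)
  qed
  ultimately show ?thesis
    using order_trans[OF abs_sqrt_diff_le real_sqrt_le_mono, of "\<Sum>i. v k i * (cmod (f i))\<^sup>2"
        "\<Sum>i. w i * (cmod (f i))\<^sup>2" "(real r)\<^sup>2 * (\<Sum>i. \<bar>v k i - w i\<bar>)"] by simp
qed

lemma model_limit: "model_limit M.L T N restr"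
proof -
  interpret unital_cstar_algebra M.L by (rule M.L_unital_cstar_algebra)
  interpret Mp: cstar_probability_space M.L by (rule M.L_cstar_probability_space)
  have ball: "cmod (state M.L x) \<le> real r \<and> \<bar>model_norm T M.L x\<bar> \<le> real r" if "x \<in> op_ball M.L r" for x r
  proof -
    have x: "x \<in> carrier M.L" "opnorm M.L x \<le> real r" using that unfolding op_ball_def by auto
    then show ?thesis
      using Mp.cmod_state_le_norm2[OF x(1)] Mp.norm2_le_opnorm[OF x(1)] Mp.norm2_nonneg[OF x(1)]
        opnorm_nonneg[OF x(1)] by (cases T) auto
  qed
  show ?thesis
  proof
    fix k
    interpret N: finite_atomic e "J k" "v k" by (rule fin)
    show "restr k (x \<oplus>\<^bsub>M.L\<^esub> y) = restr k x \<oplus>\<^bsub>N k\<^esub> restr k y"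
      "restr k (x \<otimes>\<^bsub>M.L\<^esub> y) = restr k x \<otimes>\<^bsub>N k\<^esub> restr k y"
      if "x \<in> carrier M.L" "y \<in> carrier M.L" for x y
      using that by (auto simp: restr_e fun_eq_iff)
    show "restr k (adj M.L x) = adj (N k) (restr k x)" if "x \<in> carrier M.L" for x
      using that by (auto simp: restr_e fun_eq_iff)
    show "restr k (c \<odot>\<^bsub>M.L\<^esub> \<one>\<^bsub>M.L\<^esub>) = c \<odot>\<^bsub>N k\<^esub> \<one>\<^bsub>N k\<^esub>" for c
      using J[of k] by (auto simp: restr_e fun_eq_iff)
    show "op_ball (N k) r = restr k ` op_ball M.L r" for r
    proof
      show "restr k ` op_ball M.L r \<subseteq> op_ball (N k) r"
        using restrict_bounded by (fastforce simp: op_ball_M op_ball_N restr_e intro: order_trans)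
      show "op_ball (N k) r \<subseteq> restr k ` op_ball M.L r"
      proof
        fix y assume "y \<in> op_ball (N k) r"
        then obtain g where g: "y = e g" "g \<in> bounded_funs (J k)" "sup_norm g \<le> real r" by (auto simp: op_ball_N)
        \<comment> \<open>A function on \<open>J k\<close> is already one on \<open>I\<close>, with
          the same norm; it is its own preimage under restriction.\<close>
        have "g \<in> bounded_funs I"
          using g(2) J[of k] by (auto simp: bounded_funs_def supported_on_def)
        moreover have "restr k (e g) = y"
          using bounded_funs_zero[OF g(2)] by (auto simp: restr_e g(1) fun_eq_iff)
        ultimately show "y \<in> restr k ` op_ball M.L r" using g by (force simp: op_ball_M)
      qed
    qed
  next
    fix r
    show "uniform_limit (op_ball M.L r) (\<lambda>k x. state (N k) (restr k x)) (state M.L) sequentially"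
    proof (rule uniform_limit_of_bound)
      show "(\<lambda>k. real r * (\<Sum>i. \<bar>v k i - w i\<bar>)) \<longlonglongrightarrow> 0"
        using tendsto_mult[OF tendsto_const lim, of "real r"] by simp
    qed (use state_diff in \<open>simp add: dist_norm\<close>)
    show "uniform_limit (op_ball M.L r) (\<lambda>k x. model_norm T (N k) (restr k x)) (model_norm T M.L) sequentially"
    proof (cases T)
      case CStar_Prob
      show ?thesis
      proof (rule uniform_limit_of_bound[OF _ tendsto_const])
        fix k x assume "x \<in> op_ball M.L r"
        then obtain f where f: "x = e f" "f \<in> bounded_funs I" by (auto simp: op_ball_M)
        interpret N: finite_atomic e "J k" "v k" by (rule fin)
        \<comment> \<open>Operator norms need not converge uniformly under truncation. In the
          C*-case the index set is therefore kept and only the weights move, so that norms agree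
          exactly.\<close>
        have "restr k x = x" using same[OF CStar_Prob, of k] bounded_funs_zero[OF f(2)]
          by (auto simp: f(1) restr_e fun_eq_iff)
        then show "dist (model_norm T (N k) (restr k x)) (model_norm T M.L x) \<le> 0"
          by (simp add: f(1) CStar_Prob)
      qed
    next
      case Tracial_VN
      show ?thesis
      proof (rule uniform_limit_of_bound)
        show "(\<lambda>k. sqrt ((real r)\<^sup>2 * (\<Sum>i. \<bar>v k i - w i\<bar>))) \<longlonglongrightarrow> 0"
          using tendsto_real_sqrt[OF tendsto_mult[OF tendsto_const lim, of "(real r)\<^sup>2"]] by simp
      qed (use norm2_diff Tracial_VN in \<open>simp add: dist_real_def\<close>)
    qed
    show "\<exists>B. \<forall>x\<in>op_ball M.L r. cmod (state M.L x) \<le> B" "\<exists>B. \<forall>x\<in>op_ball M.L r. \<bar>model_norm T M.L x\<bar> \<le> B"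
      using ball by blast+
  qed
qed

text \<open>One atom of weight at least \<eta> already contributes this much to the 2-norm. The
  condition \<open>\<eta> \<le> 1\<close> lets the operator norm obey the same bound.\<close>

lemma model_norm_N_component:
  assumes f: "f \<in> bounded_funs (J k)" and i: "i \<in> J k"
    and \<eta>: "0 < \<eta>" "\<eta> \<le> 1" "T = Tracial_VN \<Longrightarrow> \<eta> \<le> v k i"
  shows "sqrt \<eta> * cmod (f i) \<le> model_norm T (N k) (e f)"
proof -
  interpret N: finite_atomic e "J k" "v k" by (rule fin)
  show ?thesis
  proof (cases T)
    case CStar_Prob
    have "sqrt \<eta> * cmod (f i) \<le> 1 * cmod (f i)" using \<eta> by (intro mult_right_mono) auto
    then show ?thesis using sup_norm_upper[OF f, of i] CStar_Prob by simp
  next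
    case Tracial_VN
    have "\<eta> * (cmod (f i))\<^sup>2 \<le> v k i * (cmod (f i))\<^sup>2" using \<eta>(3)[OF Tracial_VN] by (intro mult_right_mono) auto
    also have "\<dots> \<le> (\<Sum>i. v k i * (cmod (f i))\<^sup>2)"
      using sum_le_suminf[OF N.real_state_summable(1)[OF f], of "{i}"] N.w_nonneg by simp
    finally have "sqrt (\<eta> * (cmod (f i))\<^sup>2) \<le> sqrt (\<Sum>i. v k i * (cmod (f i))\<^sup>2)" by simp
    then show ?thesis using Tracial_VN by (simp add: N.L_norm2[OF f] real_sqrt_mult)
  qed
qed

text \<open>A free pair in \<open>N k\<close> has a scalar entry \<open>a\<close>. By the triangle
  inequality, \<open>a\<close> differs from \<open>f s\<close> or from \<open>f t\<close> by at
  least half of their distance, and the weights at \<open>s\<close> and \<open>t\<close> turn this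
  into a bound independent of \<open>k\<close>.\<close>

lemma not_T_definable:
  fixes f :: "nat \<Rightarrow> complex"
  assumes f: "f \<in> bounded_funs I" "\<And>i. cmod (f i) \<le> 1" and z: "\<And>p. (\<Sum>i. w i * poly p (f i)) = poly p z"
    and i: "\<And>k. s \<in> J k" "\<And>k. t \<in> J k" "f s \<noteq> f t"
    and \<eta>: "0 < \<eta>" "\<eta> \<le> 1" "\<And>k. T = Tracial_VN \<Longrightarrow> \<eta> \<le> v k s \<and> \<eta> \<le> v k t"
  shows "\<not> T_definable T 2 (free_pairs :: 'a ncps \<Rightarrow> 'a list set)"
proof (rule not_T_definable_limit[OF model_limit is_model_M is_model_N])
  have "sup_norm f \<le> 1" using f(2) by (rule sup_norm_least)
  then have "e f \<in> op_ball M.L 1" using f(1) by (auto simp: op_ball_M)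
  then show "[e f, e f] \<in> free_pairs M.L"
    using M.free_of_character[OF f(1) z] by (auto simp: free_pairs_def)
  let ?r = "sqrt \<eta> * (cmod (f s - f t) / 2)"
  show "?r > 0" using \<eta>(1) i(3) by simp
  fix k x y assume xy: "[x, y] \<in> free_pairs (N k)"
  interpret N: finite_atomic e "J k" "v k" by (rule fin)
  obtain g h where g: "x = e g" "g \<in> bounded_funs (J k)" and h: "y = e h" "h \<in> bounded_funs (J k)"
    using xy by (auto simp: free_pairs_def op_ball_N)
  have "freely_independent (N k) (e g) (e h)" using xy g h by (auto simp: free_pairs_def)
  then have "(\<exists>a. \<forall>i\<in>J k. g i = a) \<or> (\<exists>a. \<forall>i\<in>J k. h i = a)"
    using N.free_imp_const[OF g(2) h(2)] by blast
  moreover have "?r \<le> model_dist T (N k) (restr k (e f)) (e u)"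
    if u: "u \<in> bounded_funs (J k)" and a: "\<forall>i\<in>J k. u i = a" for u a
  proof -
    let ?f = "\<lambda>i. if i \<in> J k then f i else 0"
    have d: "(\<lambda>i. ?f i - u i) \<in> bounded_funs (J k)"
      by (rule bounded_funs_closed(4)[OF restrict_bounded(1)[OF f(1)] u])
    have m: "model_dist T (N k) (restr k (e f)) (e u) = model_norm T (N k) (e (\<lambda>i. ?f i - u i))"
      unfolding restr_e model_dist_def dist_on_def
      using restrict_bounded(1)[OF f(1), of k] u by (simp add: N.L_minus)
    have "sqrt \<eta> * cmod (f s - a) \<le> model_norm T (N k) (e (\<lambda>i. ?f i - u i))"
      using model_norm_N_component[OF d i(1) \<eta>(1,2) conjunct1[OF \<eta>(3)]] a i(1)[of k] by simp
    moreover have "sqrt \<eta> * cmod (f t - a) \<le> model_norm T (N k) (e (\<lambda>i. ?f i - u i))"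
      using model_norm_N_component[OF d i(2) \<eta>(1,2) conjunct2[OF \<eta>(3)]] a i(2)[of k] by simp
    moreover have "sqrt \<eta> * cmod (f s - f t) \<le> sqrt \<eta> * (cmod (f s - a) + cmod (f t - a))"
      using norm_triangle_ineq4[of "f s - a" "f t - a"] \<eta>(1) by (intro mult_left_mono) auto
    ultimately show ?thesis unfolding m distrib_left by simp
  qed
  ultimately show "?r \<le> max (model_dist T (N k) (restr k (e f)) x) (model_dist T (N k) (restr k (e f)) y)"
    using g h by (auto simp: le_max_iff_disj)
qed

end

section \<open>The two theories\<close>

lemma finite_atomicI:
  assumes "inj e" "finite I" "\<And>i. i \<in> I \<Longrightarrow> w i > 0" "\<And>i. i \<notin> I \<Longrightarrow> w i = 0" "(\<Sum>i\<in>I. w i) = 1"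
  shows "finite_atomic e I w"
proof
  show "w sums 1" using sums_finite[OF assms(2), of w] assms(4,5) by simp
  show "w i \<ge> 0" for i using assms(3,4)[of i] by (cases "i \<in> I") auto
qed (use assms in auto)

text \<open>The limit state is evaluation at atom 0, a character of the whole algebra. The witness
  is the projection onto that atom, at norm distance at least 1/2 from all scalars.\<close>

lemma not_T_definable_CStar:
  fixes e :: "(nat \<Rightarrow> complex) \<Rightarrow> 'a"
  assumes "inj e"
  shows "\<not> T_definable CStar_Prob 2 (free_pairs :: 'a ncps \<Rightarrow> 'a list set)"
proof -
  define I :: "nat set" where "I = {0, 1}"
  define w :: "nat \<Rightarrow> real" where "w i = (if i = 0 then 1 else 0)" for i
  \<comment> \<open>The shift by 2 keeps both weights strictly positive for all \<open>k\<close>,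
    including 0.\<close>
  define q where "q k = 1 / (real k + 2)" for k :: nat
  define v :: "nat \<Rightarrow> nat \<Rightarrow> real" where "v k i = (if i = 0 then 1 - q k else if i = 1 then q k else 0)" for k i
  define f :: "nat \<Rightarrow> complex" where "f i = (if i = 0 then 1 else 0)" for i
  have q: "0 < q k" "q k < 1" for k by (auto simp: q_def)
  have wsum: "(\<Sum>i. of_real (w i) * h i) = h 0" for h :: "nat \<Rightarrow> complex"
  proof -
    have "(\<Sum>i. of_real (w i) * h i) = (\<Sum>i\<in>{0}. of_real (w i) * h i)" by (rule suminf_finite) (auto simp: w_def)
    then show ?thesis by (simp add: w_def)
  qed
  interpret atomic_approximation e I w "\<lambda>_. I" v CStar_Prob
  proof (intro atomic_approximation.intro atomic.intro atomic_approximation_axioms.intro)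
    show "w sums 1" using sums_single[of 0 "\<lambda>_. 1 :: real"] by (simp add: w_def[abs_def])
    show "finite_atomic e I (v k)" for k
      by (rule finite_atomicI) (use assms q in \<open>auto simp: I_def v_def\<close>)
    have "(\<Sum>i. \<bar>v k i - w i\<bar>) = 2 * q k" for k
    proof -
      have "(\<Sum>i. \<bar>v k i - w i\<bar>) = (\<Sum>i\<in>{0,1}. \<bar>v k i - w i\<bar>)" by (rule suminf_finite) (auto simp: v_def w_def)
      then show ?thesis using q[of k] by (simp add: v_def w_def)
    qed
    moreover have "q \<longlonglongrightarrow> 0"
      unfolding q_def[abs_def] using LIMSEQ_ignore_initial_segment[OF lim_inverse_n', of 2] by (simp add: add.commute)
    ultimately show "(\<lambda>k. \<Sum>i. \<bar>v k i - w i\<bar>) \<longlonglongrightarrow> 0" using tendsto_mult[OF tendsto_const, of q 0 _ 2] by simp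
  qed (use assms in \<open>auto simp: w_def I_def\<close>)
  show ?thesis
  proof (rule not_T_definable[where f = f and z = "f 0" and s = 0 and t = 1 and \<eta> = 1])
    show "f \<in> bounded_funs I" by (rule bounded_funsI[of _ _ 1]) (auto simp: f_def I_def supported_on_def)
    show "(\<Sum>i. w i * poly p (f i)) = poly p (f 0)" for p by (rule wsum)
  qed (auto simp: f_def I_def)
qed

lemma not_T_definable_Tracial_VN:
  fixes e :: "(nat \<Rightarrow> complex) \<Rightarrow> 'a"
  assumes e: "inj e"
  shows "\<not> T_definable Tracial_VN 2 (free_pairs :: 'a ncps \<Rightarrow> 'a list set)"
proof -
  obtain I and w :: "nat \<Rightarrow> real" and c :: "nat \<Rightarrow> complex" where w: "\<And>i. i \<in> I \<Longrightarrow> w i > 0" "\<And>i. i \<notin> I \<Longrightarrow> w i = 0" "w sums 1"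
    and c: "\<And>i. cmod (c i) \<le> 1" "\<And>i. i \<in> I \<longleftrightarrow> c i \<noteq> 0"
    and mean: "\<And>p. (\<Sum>i. w i * poly p (c i)) = poly p 0"
    by (rule disc_packing) (rule that)
  have w0: "w i \<ge> 0" for i using w(1,2)[of i] by (cases "i \<in> I") auto
  interpret M: atomic e I w
    by unfold_locales (use e w w0 in auto)
  obtain i0 where i0: "i0 \<in> I" using M.I_nonempty by auto
  have "\<exists>i1\<in>I. c i0 \<noteq> c i1"
  proof (rule ccontr)
    assume "\<not> ?thesis"
    \<comment> \<open>If all centres coincided, their weighted mean would be this common centre, but
      the mean value property makes it 0, which is not a centre.\<close>
    then have "of_real (w i) * c i = of_real (w i) * c i0" for i using w(2)[of i] by (cases "i \<in> I") auto
    then have "(\<Sum>i. of_real (w i) * c i) = (\<Sum>i. of_real (w i) * c i0)" by (rule suminf_cong)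
    also have "\<dots> = (\<Sum>i. of_real (w i)) * c i0"
      using w(3) by (intro suminf_mult2[symmetric]) (simp add: summable_of_real_iff sums_summable)
    also have "(\<Sum>i. complex_of_real (w i)) = 1"
      using suminf_of_real[of w, where 'a = complex] w(3) by (simp add: sums_iff)
    finally have "c i0 = 0" using mean[of "[:0, 1:]"] by simp
    then show False using c(2) i0 by simp
  qed
  then obtain i1 where i1: "i1 \<in> I" "c i0 \<noteq> c i1" by blast
  \<comment> \<open>The truncations start beyond both chosen atoms, so that every approximating
    model contains them.\<close>
  define J where "J k = I \<inter> {..<k + max i0 i1 + 1}" for k
  define W where "W k = (\<Sum>i\<in>J k. w i)" for k
  define v where "v k i = (if i \<in> J k then w i / W k else 0)" for k i
  have trunc: "finite (J k)" "J k \<subseteq> I" "i0 \<in> J k" "i1 \<in> J k" for k using i0 i1 by (auto simp: J_def)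
  have W: "W k > 0" "W k \<le> 1" for k
  proof -
    show "W k > 0" unfolding W_def using trunc[of k] w(1) by (intro sum_pos) auto
    show "W k \<le> 1" unfolding W_def using sum_le_suminf[OF sums_summable[OF w(3)], of "J k"] trunc(1) w0 w(3)
      by (simp add: sums_iff)
  qed
  have W_eq: "W k = (\<Sum>i<k + max i0 i1 + 1. w i)" for k
    unfolding W_def J_def by (rule sum.mono_neutral_left) (use w(2) in auto)
  have "(\<lambda>n. \<Sum>i<n + (max i0 i1 + 1). w i) \<longlonglongrightarrow> 1"
    using w(3) unfolding sums_def by (rule LIMSEQ_ignore_initial_segment)
  then have W_lim: "W \<longlonglongrightarrow> 1" unfolding W_eq[abs_def] by (simp add: add.assoc)
  \<comment> \<open>The mass \<open>1 - W k\<close> is counted twice: once as removed by truncation,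
    once as redistributed by normalisation.\<close>
  have diff: "(\<Sum>i. \<bar>v k i - w i\<bar>) = 2 * (1 - W k)" for k
  proof -
    have "\<bar>v k i - w i\<bar> = v k i + w i - 2 * (if i \<in> J k then w i else 0)" for i
    proof (cases "i \<in> J k")
      case True
      have "w i \<le> w i / W k" using W[of k] w0[of i] by (simp add: le_divide_eq mult_left_le)
      then show ?thesis using True by (simp add: v_def)
    qed (use w0 in \<open>simp add: v_def\<close>)
    moreover have "(\<lambda>i. v k i + w i - 2 * (if i \<in> J k then w i else 0)) sums (W k / W k + 1 - 2 * W k)"
    proof (intro sums_diff sums_add sums_mult w(3))
      show "(\<lambda>i. if i \<in> J k then w i else 0) sums W k" unfolding W_def by (rule sums_If_finite_set[OF trunc(1)])
      have "v k sums (\<Sum>i\<in>J k. w i / W k)" unfolding v_def[abs_def] by (rule sums_If_finite_set[OF trunc(1)])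
      then show "v k sums (W k / W k)" unfolding sum_divide_distrib[symmetric] W_def[symmetric] .
    qed
    ultimately show ?thesis using W(1)[of k] by (simp add: sums_iff)
  qed
  interpret atomic_approximation e I w J v Tracial_VN
  proof (intro atomic_approximation.intro M.atomic_axioms atomic_approximation_axioms.intro)
    show "finite_atomic e (J k) (v k)" for k
    proof (rule finite_atomicI[OF e trunc(1)])
      show "v k i > 0" if "i \<in> J k" for i using that trunc(2)[of k] w(1)[of i] W(1)[of k] by (auto simp: v_def)
      show "(\<Sum>i\<in>J k. v k i) = 1" using W(1)[of k] by (simp add: v_def W_def flip: sum_divide_distrib)
    qed (simp add: v_def)
    show "(\<lambda>k. \<Sum>i. \<bar>v k i - w i\<bar>) \<longlonglongrightarrow> 0"
      unfolding diff using tendsto_mult[OF tendsto_const tendsto_diff[OF tendsto_const W_lim], of 2 1] by simp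
  qed (use trunc w in auto)
  \<comment> \<open>Normalisation only increases the weights of retained atoms, so the limit weights
    of \<open>i0\<close> and \<open>i1\<close> are lower bounds for all \<open>k\<close>.\<close>
  have vw: "w i \<le> v k i" if "i \<in> J k" for i k
    using that W[of k] w0[of i] by (simp add: v_def le_divide_eq mult_left_le)
  have w1: "w i \<le> 1" for i using sum_le_suminf[OF sums_summable[OF w(3)], of "{i}"] w0 w(3) by (simp add: sums_iff)
  show ?thesis
  proof (rule not_T_definable[where f = c and z = 0 and s = i0 and t = i1 and \<eta> = "min (w i0) (w i1)"])
    show "c \<in> bounded_funs I" using c by (intro bounded_funsI[of _ _ 1]) (auto simp: supported_on_def)
    show "min (w i0) (w i1) \<le> v k i0 \<and> min (w i0) (w i1) \<le> v k i1" for k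
      using vw[OF trunc(3)[of k]] vw[OF trunc(4)[of k]] by linarith
  qed (use c mean trunc i1 i0 w(1) w1 in \<open>auto simp: min_le_iff_disj\<close>)
qed

text \<open>Real and imaginary parts are interleaved into a sequence of reals, each real is coded as
  a set of naturals, and the pairing function merges these countably many sets into one.\<close>

lemma inj_sequences_into_reals: "\<exists>g :: (nat \<Rightarrow> complex) \<Rightarrow> real. inj g"
proof -
  obtain \<theta> :: "nat set \<Rightarrow> real" where \<theta>: "inj \<theta>"
    using nat_sets_eqpoll_reals unfolding eqpoll_def bij_betw_def by blast
  obtain \<psi> :: "real \<Rightarrow> nat set" where \<psi>: "inj \<psi>"
    using eqpoll_sym[OF nat_sets_eqpoll_reals] unfolding eqpoll_def bij_betw_def by blast
  define r where "r f n = (if even n then Re (f (n div 2)) else Im (f (n div 2)))" for f :: "nat \<Rightarrow> complex" and n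
  define \<Phi> where "\<Phi> f = {k. snd (prod_decode k) \<in> \<psi> (r f (fst (prod_decode k)))}" for f
  have "inj \<Phi>"
  proof (rule injI)
    fix f g assume eq: "\<Phi> f = \<Phi> g"
    have rr: "r f n = r g n" for n
    proof (rule injD[OF \<psi>])
      have "m \<in> \<psi> (r h n) \<longleftrightarrow> prod_encode (n, m) \<in> \<Phi> h" for h m by (simp add: \<Phi>_def)
      then show "\<psi> (r f n) = \<psi> (r g n)" using eq by blast
    qed
    have "f n = g n" for n
      using rr[of "2 * n"] rr[of "2 * n + 1"] by (simp add: r_def complex_eq_iff)
    then show "f = g" by (rule ext)
  qed
  then have "inj (\<theta> \<circ> \<Phi>)" using \<theta> by (rule inj_compose[rotated])
  then show ?thesis by blast
qed

theorem mainTheorem1: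
  fixes T :: model_theory
  assumes "\<exists>f :: real \<Rightarrow> 'a. inj f"
  shows "T_functor T 2 (free_pairs :: 'a ncps \<Rightarrow> 'a list set) \<and>
         \<not> T_definable T 2 (free_pairs :: 'a ncps \<Rightarrow> 'a list set)"
proof
  show "T_functor T 2 (free_pairs :: 'a ncps \<Rightarrow> 'a list set)" by (rule T_functor_free_pairs)
  obtain f :: "real \<Rightarrow> 'a" where "inj f" using assms by blast
  moreover obtain g :: "(nat \<Rightarrow> complex) \<Rightarrow> real" where "inj g" using inj_sequences_into_reals by blast
  \<comment> \<open>The encoding \<open>e\<close>: a type at least as large as the reals has room
    for all bounded sequences.\<close>
  ultimately have "inj (f \<circ> g)" by (rule inj_compose)
  then show "\<not> T_definable T 2 (free_pairs :: 'a ncps \<Rightarrow> 'a list set)"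
    using not_T_definable_CStar not_T_definable_Tracial_VN by (cases T) auto
qed

end
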